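(* For every $\delta>0$ and $M\in\mathbb{N}$ there exist $N_0$ and $c_0>0$ such that for every $N\ge N_0$ the following holds. Let $A\subseteq[N]$ with $|A|\ge\delta N$, and let $B$ be an $M$-homogeneous set of positive integers. Then $$\#\{(x_1,x_2,y_1,y_2,y_3)\in A^2\times B^3:\ x_1^2-x_2^2=y_1^2+y_2^2+y_3^2\}\ \ge\ c_0N^3.$$
   Context: $[N]=\{1,\dots,\lfloor N\rfloor\}$. For $q\in\mathbb{N}$, $q\cdot[M]=\{q,2q,\dots,Mq\}$. A set $B$ of positive integers is $M$-homogeneous if $B\cap q\cdot[M]\neq\emptyset$ for every $q\in\mathbb{N}$. *)

theory Defs
  imports "HOL-Analysis.Analysis"
begin

text \<open>The paper's \<open>[N]\<close>. Integers rather than naturals are used throughout, so that differences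
  of squares are not truncated.\<close>

definition initial_segment :: "real \<Rightarrow> int set" where
  "initial_segment N = {1..\<lfloor>N\<rfloor>}"

text \<open>Positivity of the elements of \<open>B\<close> is not part of this predicate and has to be assumed
  separately. The multiplier \<open>q\<close> ranges over the positive integers.\<close>

definition homogeneous_set :: "nat \<Rightarrow> int set \<Rightarrow> bool" where
  "homogeneous_set M B \<longleftrightarrow>
     (\<forall>q::int. q \<ge> 1 \<longrightarrow> B \<inter> (\<lambda>m. q * m) ` initial_segment (real M) \<noteq> {})"

text \<open>For finite \<open>A\<close> this set is finite (the \<open>y\<^sub>i\<close> are bounded through the equation), even when
  \<open>B\<close> is infinite, so its \<open>card\<close> is the true number of solutions.\<close>

definition solutions :: "int set \<Rightarrow> int set \<Rightarrow> (int \<times> int \<times> int \<times> int \<times> int) set" where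
  "solutions A B =
     {(x1, x2, y1, y2, y3). x1 \<in> A \<and> x2 \<in> A \<and> y1 \<in> B \<and> y2 \<in> B \<and> y3 \<in> B \<and>
        x1\<^sup>2 - x2\<^sup>2 = y1\<^sup>2 + y2\<^sup>2 + y3\<^sup>2}"

end

theory Submission
  imports Defs "HOL-Library.Ramsey"
begin

text \<open>The equation is counted by the circle method on \<open>\<int>/m\<close>. Passing to a residue class,
  \<open>x = b + (V\<^sup>2 / g) t\<close> with \<open>g = gcd (2 b) (V\<^sup>2)\<close> and \<open>y = V y'\<close>, and dividing by \<open>V\<^sup>2\<close> turns
  \<open>x\<^sup>2\<close> into a quadratic \<open>u t + s\<^sup>2 t\<^sup>2\<close> up to a constant; for most \<open>b\<close> this quadratic is a bijection
  modulo every power of a small prime, so that its Weyl sums are large only at fractions whose denominators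
  have no small prime factor. Together with summation by parts this bounds the energy of the dense set on
  any bounded set of frequencies by a constant that does not depend on the number of frequencies.
  Hence among boundedly many thresholds there is one at which the energy of the large spectrum hardly
  increases. Homogeneity and quadratic recurrence give a set \<open>Y \<subseteq> B\<close> of positive density on
  which all frequencies of that large spectrum are nearly trivial; these frequencies contribute a main term of order
  \<open>|A|\<^sup>2 |Y|\<^sup>3\<close>. The remaining frequencies are controlled by the small increment of energy and,
  below the next threshold, by a restriction estimate with exponent \<open>4.9 < 5\<close>.\<close>

section \<open>Exponential sums modulo \<open>m\<close>\<close>

text \<open>The obstacle is the order of choices. The density of \<open>Y\<close> comes from
  recurrence, whose bounds rest on Ramsey's theorem and compactness and are therefore not explicit
  in the number of frequencies; each threshold must be small in terms of the density belonging to
  the previous one. Restriction alone bounds the energy above threshold \<eta> only by a multiple of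
  \<eta>^(-14/5) L^2. This grows along the sequence of thresholds, so pigeonholing would never
  close; the energy has to be bounded before the thresholds are chosen, and removing the small
  primes achieves this. The exponents fit as follows. Differencing saves the power 12/25 of the
  denominator, slightly less than 1/2, which avoids logarithms. Since 12/25 times 21/10 is 126/125 >
  1, the kernels of the fractions become summable after raising the Weyl sum to the power 21/10. The
  level sets then have exponent 24/5 = 2 (21/10) (8/7), where 8/7 is the price of an eighth moment
  of divisor weights. Finally 24/5 < 49/10 < 5, and 5 = 2 + 3 is the number of exponential sums in
  the count.\<close>

definition eexp :: "real \<Rightarrow> complex" where
  "eexp x = cis (2 * pi * x)"

lemma norm_eexp [simp]: "cmod (eexp x) = 1"
  by (simp add: eexp_def)

lemma eexp_0 [simp]: "eexp 0 = 1"
  by (simp add: eexp_def)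

lemma eexp_add: "eexp (x + y) = eexp x * eexp y"
  by (simp add: eexp_def cis_mult distrib_left)

lemma cnj_eexp: "cnj (eexp x) = eexp (- x)"
  by (simp add: eexp_def cis_cnj)

lemma eexp_int [simp]: "eexp (of_int n) = 1"
  unfolding eexp_def by (rule cis_multiple_2pi) simp

lemma eexp_nat_mult: "eexp (of_nat n * x) = eexp x ^ n"
proof -
  have "2 * pi * (of_nat n * x) = of_nat n * (2 * pi * x)" by simp
  then show ?thesis by (simp only: eexp_def Complex.DeMoivre)
qed

lemma eexp_minus_1_le: "cmod (eexp x - 1) \<le> 2 * pi * \<bar>x\<bar>"
proof -
  have "cmod (exp (\<i> * of_real (2 * pi * x)) - (\<Sum>k\<le>0. (\<i> * of_real (2 * pi * x)) ^ k / fact k)) \<le> 2 * pi * \<bar>x\<bar>"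
    using Taylor_exp[of "\<i> * of_real (2 * pi * x)" 0] by (simp add: norm_mult abs_mult)
  then show ?thesis by (simp add: eexp_def cis_conv_exp)
qed

lemma eexp_second_order: "cmod (eexp x - 1 - 2 * pi * \<i> * x) \<le> (2 * pi * x)\<^sup>2"
proof -
  have "cmod (exp (\<i> * of_real (2 * pi * x)) - (\<Sum>k\<le>Suc 0. (\<i> * of_real (2 * pi * x)) ^ k / fact k)) \<le> (2 * pi * \<bar>x\<bar>) ^ 2"
    using Taylor_exp[of "\<i> * of_real (2 * pi * x)" "Suc 0"] by (simp add: norm_mult abs_mult power2_eq_square)
  moreover have "eexp x - 1 - 2 * pi * \<i> * x = exp (\<i> * of_real (2 * pi * x)) - (\<Sum>k\<le>Suc 0. (\<i> * of_real (2 * pi * x)) ^ k / fact k)"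
    by (simp add: eexp_def cis_conv_exp mult_ac)
  moreover have "(2 * pi * \<bar>x\<bar>) ^ 2 = (2 * pi * x)\<^sup>2" by (simp add: power_mult_distrib)
  ultimately show ?thesis by (simp only:)
qed

section \<open>Distance to the nearest integer\<close>

definition nint :: "real \<Rightarrow> real" where
  "nint x = \<bar>x - of_int (round x)\<bar>"

lemma nint_nonneg [simp]: "0 \<le> nint x"
  by (simp add: nint_def)

lemma nint_le_half: "nint x \<le> 1 / 2"
  using of_int_round_abs_le[of x] by (simp add: nint_def abs_minus_commute)

lemma nint_le: "nint x \<le> \<bar>x - of_int k\<bar>"
  using round_diff_minimal[of x k] by (simp add: nint_def)

lemma nint_le_abs: "nint x \<le> \<bar>x\<bar>"
  using nint_le[of x 0] by simp

lemma nint_add_le: "nint (x + y) \<le> nint x + nint y"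
proof -
  have "nint (x + y) \<le> \<bar>x + y - of_int (round x + round y)\<bar>" by (rule nint_le)
  also have "\<dots> \<le> nint x + nint y" by (simp add: nint_def)
  finally show ?thesis .
qed

lemma nint_minus [simp]: "nint (- x) = nint x"
proof -
  have "nint (- x) \<le> nint x" for x
    using nint_le[of "- x" "- round x"] by (simp add: nint_def)
  from this[of x] this[of "- x"] show ?thesis by simp
qed

lemma nint_mult_nat_le: "nint (of_nat n * x) \<le> of_nat n * nint x"
proof (induction n)
  case (Suc n)
  have "nint (of_nat (Suc n) * x) = nint (x + of_nat n * x)" by (simp add: distrib_right)
  also have "\<dots> \<le> nint x + nint (of_nat n * x)" by (rule nint_add_le)
  finally show ?case using Suc by (simp add: distrib_right)
qed (simp add: nint_def)

lemma nint_mult_int_le: "nint (of_int n * x) \<le> \<bar>of_int n\<bar> * nint x"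
proof (cases "n \<ge> 0")
  case True then show ?thesis using nint_mult_nat_le[of "nat n" x] by simp
next
  case False then show ?thesis using nint_mult_nat_le[of "nat (- n)" x]
    by (simp add: nint_minus[of "of_int n * x", symmetric] del: nint_minus)
qed

lemma nint_add_int [simp]: "nint (x + of_int k) = nint x"
proof -
  have "nint (x + of_int k) \<le> nint x" for x k
    using nint_le[of "x + of_int k" "round x + k"] by (simp add: nint_def)
  from this[of x k] this[of "x + of_int k" "- k"] show ?thesis by simp
qed

lemma eexp_minus_1_le_nint: "cmod (eexp x - 1) \<le> 2 * pi * nint x"
proof -
  have "eexp x = eexp (x - of_int (round x))"
    using eexp_add[of "x - of_int (round x)" "of_int (round x)"] by simp
  then show ?thesis using eexp_minus_1_le[of "x - of_int (round x)"] by (simp add: nint_def)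
qed

text \<open>The modulus is 2 |sin (pi y)| with |y| = \<open>nint x\<close>. The constant 3 is what
  survives the crude cubic Maclaurin bound |sin z| \<ge> |z|/2, valid for |z| \<le> 1.6, together
  with pi > 3.1.\<close>

lemma eexp_minus_1_ge: "cmod (eexp x - 1) \<ge> 3 * nint x"
proof -
  define y where "y = x - of_int (round x)"
  define z where "z = pi * y"
  have eq: "eexp x = eexp y"
    using eexp_add[of y "of_int (round x)"] by (simp add: y_def)
  have y: "\<bar>y\<bar> \<le> 1/2" "nint x = \<bar>y\<bar>"
    using nint_le_half[of x] by (auto simp: y_def nint_def)
  have pi2: "pi < 3.2" using pi_approx by simp
  have pi3: "pi > 3.1" using pi_approx by simp
  have zle: "\<bar>z\<bar> \<le> 1.6"
  proof -
    have "\<bar>z\<bar> = pi * \<bar>y\<bar>" by (simp add: z_def abs_mult)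
    also have "\<dots> \<le> 3.2 * (1/2)" using pi2 y by (intro mult_mono) auto
    finally show ?thesis by simp
  qed
  have "\<bar>sin z - z\<bar> \<le> inverse (fact 3) * \<bar>z\<bar> ^ 3"
    using Maclaurin_sin_bound[of z 3] by (simp add: numeral_3_eq_3 sin_coeff_def)
  also have "\<dots> = \<bar>z\<bar> * (\<bar>z\<bar>^2 / 6)" by (simp add: fact_numeral power3_eq_cube power2_eq_square field_simps)
  also have "\<dots> \<le> \<bar>z\<bar> * (1.6^2/6)"
    using zle by (intro mult_left_mono divide_right_mono power_mono) auto
  also have "\<dots> \<le> \<bar>z\<bar> * (1/2)"
    by (intro mult_left_mono) (auto simp: power2_eq_square)
  finally have s: "\<bar>sin z\<bar> \<ge> \<bar>z\<bar> * (1/2)" by linarith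
  have "(cmod (eexp y - 1))\<^sup>2 = (2 * sin z)\<^sup>2"
  proof -
    have "(cmod (eexp y - 1))\<^sup>2 = (cos (2*z) - 1)^2 + (sin (2*z))^2"
      by (simp add: cmod_power2 eexp_def z_def mult_ac)
    also have "\<dots> = 2 - 2 * cos (2 * z)"
      using sin_cos_squared_add[of "2*z"] by (simp add: power2_eq_square algebra_simps)
    also have "\<dots> = (2 * sin z)\<^sup>2" by (simp add: cos_double_sin power_mult_distrib)
    finally show ?thesis .
  qed
  then have "cmod (eexp y - 1) = \<bar>2 * sin z\<bar>"
    by (metis abs_of_nonneg norm_ge_zero real_sqrt_abs)
  also have "\<dots> \<ge> \<bar>z\<bar>" using s by simp
  also have "\<bar>z\<bar> = pi * \<bar>y\<bar>" by (simp add: z_def abs_mult)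
  also have "\<dots> \<ge> 3 * \<bar>y\<bar>" using pi3 by (intro mult_right_mono) auto
  finally show ?thesis using eq y by simp
qed

text \<open>Multiplying by \<open>eexp x - 1\<close> telescopes to a quantity of modulus at most 2.
  The product form avoids a separate treatment of \<open>nint x = 0\<close>.\<close>

lemma geometric_eexp: "cmod (\<Sum>t<n. eexp (of_nat t * x)) * nint x \<le> 1"
proof -
  have "(eexp x - 1) * (\<Sum>t<n. eexp (of_nat t * x)) = eexp x ^ n - 1"
    by (simp add: eexp_nat_mult power_diff_1_eq)
  then have "cmod (eexp x - 1) * cmod (\<Sum>t<n. eexp (of_nat t * x)) = cmod (eexp x ^ n - 1)"
    by (metis norm_mult)
  also have "\<dots> \<le> 2"
    using norm_triangle_ineq4[of "eexp x ^ n" 1] by (simp add: norm_power)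
  finally have *: "cmod (eexp x - 1) * cmod (\<Sum>t<n. eexp (of_nat t * x)) \<le> 2" .
  have "3 * nint x * cmod (\<Sum>t<n. eexp (of_nat t * x)) \<le> cmod (eexp x - 1) * cmod (\<Sum>t<n. eexp (of_nat t * x))"
    by (intro mult_right_mono eexp_minus_1_ge) auto
  with * have "3 * (nint x * cmod (\<Sum>t<n. eexp (of_nat t * x))) \<le> 2" by simp
  then show ?thesis by (simp add: mult.commute)
qed

section \<open>Additive characters modulo m, orthogonality and Parseval\<close>

definition ef :: "nat \<Rightarrow> int \<Rightarrow> complex" where
  "ef m j = eexp (of_int j / of_nat m)"

lemma norm_ef [simp]: "cmod (ef m j) = 1"
  by (simp add: ef_def)

lemma ef_0 [simp]: "ef m 0 = 1" by (simp add: ef_def)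

lemma ef_add: "ef m (j + k) = ef m j * ef m k"
  by (simp add: ef_def eexp_add add_divide_distrib)

lemma cnj_ef: "cnj (ef m j) = ef m (- j)"
  by (simp add: ef_def cnj_eexp)

lemma ef_diff: "ef m (j - k) = ef m j * cnj (ef m k)"
  by (simp add: cnj_ef flip: ef_add)

lemma ef_dvd: "m > 0 \<Longrightarrow> int m dvd j \<Longrightarrow> ef m j = 1"
proof -
  assume "m > 0" "int m dvd j"
  then obtain c where "j = int m * c" by (auto simp: dvd_def)
  then have "of_int j / real m = real_of_int c" using \<open>m > 0\<close> by simp
  then show ?thesis unfolding ef_def by simp
qed

lemma ef_cong: "m > 0 \<Longrightarrow> int m dvd j - k \<Longrightarrow> ef m j = ef m k"
  using ef_add[of m "j - k" k] ef_dvd[of m "j - k"] by simp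

lemma sum_int_nat: "(\<Sum>a\<in>{0..<int m}. f a) = (\<Sum>a<m. f (int a))"
  by (rule sum.reindex_bij_witness[of _ int nat]) auto

lemma sum_ef:
  assumes "m > 0"
  shows "(\<Sum>a\<in>{0..<int m}. ef m (a * k)) = (if int m dvd k then of_nat m else 0)"
proof (cases "int m dvd k")
  case True
  then have "ef m (a * k) = 1" for a using assms by (intro ef_dvd) auto
  then show ?thesis using True by simp
next
  case False
  define x where "x = real_of_int k / real m"
  have eq: "(\<Sum>a\<in>{0..<int m}. ef m (a * k)) = (\<Sum>a<m. eexp (of_nat a * x))"
    by (simp add: sum_int_nat ef_def x_def)
  have ne: "eexp x \<noteq> 1"
  proof
    assume "eexp x = 1"
    then have "nint x = 0" using eexp_minus_1_ge[of x] nint_nonneg[of x] by simp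
    then have "x = of_int (round x)" by (simp add: nint_def)
    then have "real_of_int k = real_of_int (int m * round x)" using assms by (simp add: x_def field_simps)
    then have "k = int m * round x" by linarith
    then show False using False by simp
  qed
  have "(eexp x - 1) * (\<Sum>t<m. eexp (of_nat t * x)) = eexp x ^ m - 1"
    by (simp add: eexp_nat_mult power_diff_1_eq)
  also have "eexp x ^ m = eexp (of_int k)" using assms by (simp add: x_def flip: eexp_nat_mult)
  finally show ?thesis using ne False eq by simp
qed

text \<open>Expanding the square and summing over a leaves the pairs of congruent frequencies, each
  with a coefficient of modulus at most 1. Repeated frequencies are allowed, since in the fourth
  moment I consists of pairs and k is a sum of two values.\<close>

lemma parseval_le:
  fixes k :: "'i \<Rightarrow> int"
  assumes m: "m > 0" and fin: "finite I" and c: "\<And>i. i \<in> I \<Longrightarrow> cmod (c i) \<le> 1"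
  shows "(\<Sum>a\<in>{0..<int m}. (cmod (\<Sum>i\<in>I. c i * ef m (a * k i)))\<^sup>2)
     \<le> m * card {(i, j). i \<in> I \<and> j \<in> I \<and> int m dvd k i - k j}"
proof -
  define X where "X = {(i, j). i \<in> I \<and> j \<in> I \<and> int m dvd k i - k j}"
  have X: "X \<subseteq> I \<times> I" by (auto simp: X_def)
  have "complex_of_real (\<Sum>a\<in>{0..<int m}. (cmod (\<Sum>i\<in>I. c i * ef m (a * k i)))\<^sup>2)
    = (\<Sum>a\<in>{0..<int m}. (\<Sum>i\<in>I. c i * ef m (a * k i)) * cnj (\<Sum>i\<in>I. c i * ef m (a * k i)))"
    by (simp only: of_real_sum complex_norm_square)
  also have "\<dots> = (\<Sum>a\<in>{0..<int m}. \<Sum>p\<in>I \<times> I. c (fst p) * cnj (c (snd p)) * ef m (a * (k (fst p) - k (snd p))))"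
    by (intro sum.cong refl) (simp add: sum_product sum.cartesian_product case_prod_unfold right_diff_distrib ef_diff mult_ac)
  also have "\<dots> = (\<Sum>p\<in>I \<times> I. c (fst p) * cnj (c (snd p)) * (if int m dvd k (fst p) - k (snd p) then of_nat m else 0))"
    by (subst sum.swap) (simp only: sum_ef[OF m] flip: sum_distrib_left)
  also have "\<dots> = (\<Sum>p\<in>X. c (fst p) * cnj (c (snd p)) * of_nat m)"
    by (rule sum.mono_neutral_cong_right) (use fin in \<open>auto simp: X_def\<close>)
  finally have "\<bar>\<Sum>a\<in>{0..<int m}. (cmod (\<Sum>i\<in>I. c i * ef m (a * k i)))\<^sup>2\<bar> = cmod (\<Sum>p\<in>X. c (fst p) * cnj (c (snd p)) * of_nat m)"
    by (subst norm_of_real[symmetric], rule arg_cong[where f = cmod])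
  also have "\<dots> \<le> (\<Sum>p\<in>X. real m)"
  proof (rule sum_norm_le)
    fix p assume "p \<in> X"
    then have "cmod (c (fst p)) \<le> 1" "cmod (c (snd p)) \<le> 1" using c X by (auto simp: subset_eq)
    then have "cmod (c (fst p)) * cmod (c (snd p)) \<le> 1" by (intro mult_le_one) auto
    then show "cmod (c (fst p) * cnj (c (snd p)) * of_nat m) \<le> real m"
      by (simp add: norm_mult mult_left_le_one_le)
  qed
  finally show ?thesis by (simp add: X_def mult.commute)
qed

lemma parseval:
  assumes m: "m > 0" and S: "S \<subseteq> {0..<int m}"
  shows "(\<Sum>n\<in>{0..<int m}. (cmod (\<Sum>a\<in>S. ef m (n * a)))\<^sup>2) \<le> m * card S"
proof -
  have fin: "finite S" using S finite_subset by blast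
  have "{(i, j). i \<in> S \<and> j \<in> S \<and> int m dvd i - j} = (\<lambda>i. (i, i)) ` S"
  proof -
    have "i = j" if "i \<in> S" "j \<in> S" "int m dvd i - j" for i j
    proof -
      have "i \<in> {0..<int m}" "j \<in> {0..<int m}" using that(1,2) S by blast+
      then have "\<bar>i - j\<bar> < int m" by auto
      then show ?thesis using that(3) dvd_imp_le_int[of "i - j" "int m"] by fastforce
    qed
    then show ?thesis by auto
  qed
  then have "card {(i, j). i \<in> S \<and> j \<in> S \<and> int m dvd i - j} = card S"
    by (simp add: card_image inj_on_def)
  with parseval_le[OF m fin, of "\<lambda>_. 1" "\<lambda>a. a"] show ?thesis by simp
qed

text \<open>Interchange the sums, apply Cauchy-Schwarz in t, replace |c t|^2 by its majorant
  \<open>w t / w0\<close>, and expand the square. The weight is constant in the restriction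
  estimate; in the energy bound it is \<open>qdiff\<close>, which makes the sums at a - b small off
  the diagonal.\<close>

lemma duality:
  fixes P :: "nat \<Rightarrow> int" and f c :: "_"
  assumes fin: "finite S" and c: "\<And>t. t < L \<Longrightarrow> cmod (c t) \<le> 1" and w: "\<And>t. t < L \<Longrightarrow> w t > (0::real)"
    and cw: "\<And>t. t < L \<Longrightarrow> c t \<noteq> 0 \<Longrightarrow> w t \<ge> w0" and w0: "w0 > 0"
  shows "w0 * (cmod (\<Sum>a\<in>S. \<omega> a * (\<Sum>t<L. c t * ef m (a * P t))))\<^sup>2
    \<le> L * (\<Sum>a\<in>S. \<Sum>b\<in>S. cmod (\<omega> a) * cmod (\<omega> b) * cmod (\<Sum>t<L. w t * ef m ((a - b) * P t)))"
proof -
  define h where "h t = (\<Sum>a\<in>S. \<omega> a * ef m (a * P t))" for t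
  have "(\<Sum>a\<in>S. \<omega> a * (\<Sum>t<L. c t * ef m (a * P t))) = (\<Sum>t<L. c t * h t)"
    unfolding h_def sum_distrib_left by (subst sum.swap) (simp add: mult_ac)
  then have "cmod (\<Sum>a\<in>S. \<omega> a * (\<Sum>t<L. c t * ef m (a * P t))) \<le> (\<Sum>t<L. cmod (c t) * cmod (h t))"
    by (simp add: sum_norm_le norm_mult)
  also have "\<dots> = (\<Sum>t<L. 1 * (cmod (c t) * cmod (h t)))" by simp
  finally have "(cmod (\<Sum>a\<in>S. \<omega> a * (\<Sum>t<L. c t * ef m (a * P t))))\<^sup>2 \<le> (\<Sum>t<L. 1 * (cmod (c t) * cmod (h t)))\<^sup>2"
    by (intro power_mono) auto
  also have "\<dots> \<le> (\<Sum>t<L. 1\<^sup>2) * (\<Sum>t<L. (cmod (c t) * cmod (h t))\<^sup>2)"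
    by (rule Cauchy_Schwarz_ineq_sum)
  finally have "w0 * (cmod (\<Sum>a\<in>S. \<omega> a * (\<Sum>t<L. c t * ef m (a * P t))))\<^sup>2 \<le> w0 * (L * (\<Sum>t<L. (cmod (c t) * cmod (h t))\<^sup>2))"
    using w0 by simp
  also have "\<dots> = L * (\<Sum>t<L. w0 * (cmod (c t) * cmod (h t))\<^sup>2)" by (simp add: sum_distrib_left mult_ac)
  also have "\<dots> \<le> L * (\<Sum>t<L. w t * (cmod (h t))\<^sup>2)"
  proof (intro mult_left_mono sum_mono)
    fix t assume t: "t \<in> {..<L}"
    show "w0 * (cmod (c t) * cmod (h t))\<^sup>2 \<le> w t * (cmod (h t))\<^sup>2"
    proof (cases "c t = 0")
      case True then show ?thesis using w t by (simp add: less_imp_le)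
    next
      case False
      have "(cmod (c t))^2 \<le> 1" using c t by (simp add: power_le_one)
      then have "w0 * (cmod (c t))^2 \<le> w t * 1" using cw[of t] False t w0 by (intro mult_mono) auto
      then have "w0 * (cmod (c t))^2 * (cmod (h t))^2 \<le> w t * (cmod (h t))^2" by (intro mult_right_mono) auto
      then show ?thesis by (simp add: power_mult_distrib)
    qed
  qed auto
  also have "(\<Sum>t<L. w t * (cmod (h t))\<^sup>2) \<le> (\<Sum>a\<in>S. \<Sum>b\<in>S. cmod (\<omega> a) * cmod (\<omega> b) * cmod (\<Sum>t<L. w t * ef m ((a - b) * P t)))"
  proof -
    have "complex_of_real (\<Sum>t<L. w t * (cmod (h t))\<^sup>2) = (\<Sum>t<L. w t * (h t * cnj (h t)))"
      by (simp add: complex_norm_square del: of_real_power)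
    also have "\<dots> = (\<Sum>t<L. \<Sum>a\<in>S. \<Sum>b\<in>S. \<omega> a * cnj (\<omega> b) * (w t * ef m ((a - b) * P t)))"
      unfolding h_def cnj_sum sum_product unfolding sum_distrib_left
      by (intro sum.cong refl) (simp add: left_diff_distrib right_diff_distrib ef_diff mult_ac)
    also have "\<dots> = (\<Sum>a\<in>S. \<Sum>b\<in>S. \<omega> a * cnj (\<omega> b) * (\<Sum>t<L. w t * ef m ((a - b) * P t)))"
      by (simp add: sum_distrib_left) (subst sum.swap, rule sum.cong[OF refl], rule sum.swap)
    finally have "\<bar>\<Sum>t<L. w t * (cmod (h t))\<^sup>2\<bar> = cmod (\<Sum>a\<in>S. \<Sum>b\<in>S. \<omega> a * cnj (\<omega> b) * (\<Sum>t<L. w t * ef m ((a - b) * P t)))"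
      by (subst norm_of_real[symmetric], rule arg_cong[where f = cmod])
    also have "\<dots> \<le> (\<Sum>a\<in>S. \<Sum>b\<in>S. cmod (\<omega> a) * cmod (\<omega> b) * cmod (\<Sum>t<L. w t * ef m ((a - b) * P t)))"
      by (intro sum_norm_le) (simp add: norm_mult)
    finally show ?thesis by linarith
  qed
  finally show ?thesis by (simp add: mult_left_mono)
qed

section \<open>Van der Corput differencing\<close>

lemma square_norm_sum_unimodular:
  fixes n :: nat and z :: "nat \<Rightarrow> complex"
  assumes "\<And>t. t < n \<Longrightarrow> cmod (z t) = 1"
  shows "(cmod (\<Sum>t<n. z t))\<^sup>2 = n + 2 * Re (\<Sum>s<n. \<Sum>t<s. z s * cnj (z t))"
  using assms
proof (induction n)
  case (Suc n)
  have "(cmod (S + w))\<^sup>2 = (cmod S)\<^sup>2 + (cmod w)\<^sup>2 + 2 * Re (w * cnj S)" for S w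
    unfolding cmod_power2 by (simp add: power2_eq_square algebra_simps)
  from this[of "\<Sum>t<n. z t" "z n"]
  have "(cmod (\<Sum>t<Suc n. z t))\<^sup>2 = (cmod (\<Sum>t<n. z t))\<^sup>2 + (cmod (z n))\<^sup>2 + 2 * Re (z n * cnj (\<Sum>t<n. z t))"
    by (simp only: sum.lessThan_Suc)
  then show ?case using Suc by (simp add: sum_distrib_left)
qed simp

lemma sum_triangle_reindex:
  "(\<Sum>s<n. \<Sum>t<s. f s t) = (\<Sum>h\<in>{1..<n}. \<Sum>t<n - h. f (t + h) t)" for n :: nat
  unfolding sum.Sigma[OF finite_lessThan ballI[OF finite_lessThan]]
    sum.Sigma[OF finite_atLeastLessThan ballI[OF finite_lessThan]]
  by (rule sum.reindex_bij_witness[of _ "\<lambda>(h, t). (t + h, t)" "\<lambda>(s, t). (s - t, t)"]) auto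

text \<open>The terms with s > t are collected by their difference h = s - t; those with s < t are
  their conjugates, whence the factor 2.\<close>

lemma van_der_corput:
  fixes n :: nat and z :: "nat \<Rightarrow> complex"
  assumes "\<And>t. t < n \<Longrightarrow> cmod (z t) = 1"
  shows "(cmod (\<Sum>t<n. z t))\<^sup>2 \<le> n + 2 * (\<Sum>h\<in>{1..<n}. cmod (\<Sum>t<n - h. z (t + h) * cnj (z t)))"
proof -
  have "Re (\<Sum>s<n. \<Sum>t<s. z s * cnj (z t)) = Re (\<Sum>h\<in>{1..<n}. \<Sum>t<n - h. z (t + h) * cnj (z t))"
    by (subst sum_triangle_reindex) simp
  also have "\<dots> \<le> cmod (\<Sum>h\<in>{1..<n}. \<Sum>t<n - h. z (t + h) * cnj (z t))" by (rule complex_Re_le_cmod)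
  also have "\<dots> \<le> (\<Sum>h\<in>{1..<n}. cmod (\<Sum>t<n - h. z (t + h) * cnj (z t)))" by (rule norm_sum)
  finally show ?thesis using square_norm_sum_unimodular[OF assms] by simp
qed

section \<open>Weyl sums of quadratics\<close>

definition quad :: "int \<Rightarrow> int \<Rightarrow> nat \<Rightarrow> int" where
  "quad u v t = u * int t + v * (int t)\<^sup>2"

definition weyl_sum :: "int \<Rightarrow> int \<Rightarrow> nat \<Rightarrow> real \<Rightarrow> complex" where
  "weyl_sum u v n \<theta> = (\<Sum>t<n. eexp (\<theta> * of_int (quad u v t)))"

text \<open>For x \<ge> 0 this is min (L, 1/x). The test is phrased as a product because 1/0 = 0
  would give the wrong value at x = 0, where it must be L.\<close>

definition rmin :: "real \<Rightarrow> real \<Rightarrow> real" where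
  "rmin L x = (if L * x \<le> 1 then L else 1 / x)"

lemma rmin_upper: "y \<le> L \<Longrightarrow> y * x \<le> 1 \<Longrightarrow> 0 \<le> x \<Longrightarrow> y \<le> rmin L x"
  by (cases "x = 0") (auto simp: rmin_def field_simps)

lemma rmin_le: "L \<ge> 0 \<Longrightarrow> x \<ge> 0 \<Longrightarrow> rmin L x \<le> L"
  by (cases "x = 0") (auto simp: rmin_def field_simps)

lemma rmin_le_inverse: "x > 0 \<Longrightarrow> rmin L x \<le> 1 / x"
  by (auto simp: rmin_def field_simps)

lemma rmin_nonneg: "L \<ge> 0 \<Longrightarrow> x \<ge> 0 \<Longrightarrow> rmin L x \<ge> 0"
  by (auto simp: rmin_def)

text \<open>Differencing by h leaves a phase linear in t with slope 2 v h \<theta>, so the inner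
  sums are geometric, and u only enters through a unimodular factor. Uniformity in n \<le> L is kept
  for the later summation by parts.\<close>

lemma weyl_sum_square:
  fixes n L :: nat and u v :: int and \<theta> :: real
  shows "n \<le> L \<Longrightarrow> (cmod (weyl_sum u v n \<theta>))\<^sup>2 \<le> L + 2 * (\<Sum>h\<in>{1..<L}. rmin L (nint (h * (2 * v * \<theta>))))"
proof -
  assume nL: "n \<le> L"
  define z where "z t = eexp (\<theta> * of_int (quad u v t))" for t
  have eq: "z (t + h) * cnj (z t) = eexp (\<theta> * (u * h + v * h\<^sup>2)) * eexp (of_nat t * (h * (2 * v * \<theta>)))" for t h :: nat
  proof -
    have "z (t + h) * cnj (z t) = eexp (\<theta> * of_int (quad u v (t + h)) + - (\<theta> * of_int (quad u v t)))"
      by (simp only: z_def cnj_eexp eexp_add)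
    also have "\<theta> * of_int (quad u v (t + h)) + - (\<theta> * of_int (quad u v t)) =
      \<theta> * (u * h + v * h\<^sup>2) + of_nat t * (h * (2 * v * \<theta>))"
      by (simp add: quad_def power2_eq_square algebra_simps)
    finally show ?thesis by (simp only: eexp_add)
  qed
  have "(cmod (weyl_sum u v n \<theta>))\<^sup>2 \<le> n + 2 * (\<Sum>h\<in>{1..<n}. cmod (\<Sum>t<n - h. z (t + h) * cnj (z t)))"
    unfolding weyl_sum_def z_def by (rule van_der_corput) simp
  also have "\<dots> \<le> n + 2 * (\<Sum>h\<in>{1..<n}. rmin L (nint (h * (2 * v * \<theta>))))"
  proof (intro add_left_mono mult_left_mono sum_mono)
    fix h assume h: "h \<in> {1..<n}"
    have "cmod (\<Sum>t<n - h. z (t + h) * cnj (z t)) = cmod (\<Sum>t<n - h. eexp (of_nat t * (h * (2 * v * \<theta>))))"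
      by (simp add: eq norm_mult flip: sum_distrib_left)
    also have "\<dots> \<le> rmin L (nint (h * (2 * v * \<theta>)))"
    proof (rule rmin_upper)
      have "cmod (\<Sum>t<n - h. eexp (of_nat t * (h * (2 * v * \<theta>)))) \<le> of_nat (card {..<n - h}) * 1"
        by (rule sum_norm_bound) simp
      then show "cmod (\<Sum>t<n - h. eexp (of_nat t * (h * (2 * v * \<theta>)))) \<le> L" using nL by simp
    qed (use geometric_eexp in auto)
    finally show "cmod (\<Sum>t<n - h. z (t + h) * cnj (z t)) \<le> rmin L (nint (h * (2 * v * \<theta>)))" .
  qed simp
  also have "\<dots> \<le> L + 2 * (\<Sum>h\<in>{1..<L}. rmin L (nint (h * (2 * v * \<theta>))))"
    using nL by (intro add_mono mult_left_mono sum_mono2) (auto intro: rmin_nonneg)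
  finally show ?thesis .
qed

text \<open>The true order is log n. The square root is good enough: it leads to the error L^(3/4)
  in \<open>weyl_bound\<close>, which only has to stay below L^(99/100).\<close>

lemma sum_inverse_le_sqrt: "(\<Sum>c\<in>{1..n}. 1 / real c) \<le> 2 * sqrt n"
proof (induction n)
  case (Suc n)
  have "1 / real (Suc n) \<le> 2 * (sqrt (Suc n) - sqrt n)"
  proof -
    have "(sqrt (Suc n) - sqrt n) * (sqrt (Suc n) + sqrt n) = 1"
      by (simp add: algebra_simps)
    moreover have "sqrt (Suc n) + sqrt n > 0" by (simp add: add_pos_nonneg)
    ultimately have "sqrt (Suc n) - sqrt n = 1 / (sqrt (Suc n) + sqrt n)" by (simp add: field_simps)
    moreover have "sqrt (Suc n) + sqrt n \<le> 2 * real (Suc n)"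
    proof -
      have "sqrt (Suc n) \<le> real (Suc n)" by (rule real_le_lsqrt) (auto simp: power2_eq_square)
      then have "sqrt (Suc n) + sqrt (Suc n) \<le> 2 * real (Suc n)" by (simp del: of_nat_Suc)
      moreover have "sqrt n \<le> sqrt (Suc n)" by simp
      ultimately show ?thesis by (meson add_left_mono order.trans)
    qed
    ultimately have "1 / (2 * real (Suc n)) \<le> sqrt (Suc n) - sqrt n"
      using frac_le[of 1 1 "sqrt (Suc n) + sqrt n" "2 * real (Suc n)"] \<open>sqrt (Suc n) + sqrt n > 0\<close> by (simp only: order_refl zero_le_one simp_thms)
    moreover have "1 / real (Suc n) = 2 * (1 / (2 * real (Suc n)))" by (simp del: of_nat_Suc)
    ultimately show ?thesis by (simp only: mult_le_cancel_left_pos zero_less_numeral)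
  qed
  with Suc show ?case by (simp del: of_nat_Suc)
qed simp

text \<open>Comparison with an integral, done without integrals: y^s - (y-1)^s \<ge> s y^(s-1),
  because (1 - 1/y)^s \<le> 1 - s/y by the weighted inequality between the means.\<close>

lemma sum_powr_le:
  assumes "0 < s" "s < 1"
  shows "(\<Sum>j\<in>{1..n}. real j powr (s - 1)) \<le> (1 / s) * real n powr s"
proof (induction n)
  case (Suc n)
  define y where "y = real (Suc n)"
  have y: "y \<ge> 1" by (simp add: y_def)
  have "s * y powr (s - 1) \<le> y powr s - (y - 1) powr s"
  proof (cases "y = 1")
    case True then show ?thesis using assms by simp
  next
    case False
    then have y1: "y > 1" using y by simp
    have "((y - 1) / y) powr s * 1 powr (1 - s) \<le> s * ((y - 1) / y) + (1 - s) * 1"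
      using assms y1 by (intro Youngs_inequality_0) auto
    then have "(y - 1) powr s / y powr s \<le> 1 - s / y"
      using y1 by (simp add: powr_divide field_simps)
    then have "(y - 1) powr s \<le> y powr s - s * (y powr s / y)"
      using y1 by (simp add: field_simps)
    moreover have "y powr s / y = y powr (s - 1)" using y1 by (simp add: powr_diff)
    ultimately show ?thesis by simp
  qed
  then have "y powr (s - 1) \<le> (1 / s) * (y powr s - (y - 1) powr s)"
    using assms by (simp add: field_simps)
  then show ?case using Suc by (simp add: y_def algebra_simps)
qed simp

lemma nint_eq_abs: "\<bar>y\<bar> < 1 / 2 \<Longrightarrow> nint y = \<bar>y\<bar>"
proof -
  assume "\<bar>y\<bar> < 1 / 2"
  then have "round y = 0" by (intro round_unique') auto
  then show ?thesis by (simp add: nint_def)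
qed

lemma nint_fraction_ge:
  assumes "0 < c" "c < q"
  shows "nint (real c / real q) \<ge> min (real c) (real q - real c) / q"
proof -
  define k where "k = round (real c / real q)"
  have q: "real q > 0" using assms by simp
  have "real q * nint (real c / real q) = \<bar>real c - real q * of_int k\<bar>"
  proof -
    have "real q * nint (real c / real q) = \<bar>real q * (real c / real q - of_int k)\<bar>"
      by (simp add: nint_def k_def abs_mult)
    then show ?thesis using q by (simp add: right_diff_distrib)
  qed
  also have "\<dots> \<ge> min (real c) (real q - real c)"
  proof (cases "k \<le> 0")
    case True
    then have "real q * of_int k \<le> 0" by (simp add: mult_nonneg_nonpos)
    then show ?thesis by linarith
  next
    case False
    then have "real q * of_int k \<ge> real q * 1" by (intro mult_left_mono) auto
    then show ?thesis by linarith
  qed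
  finally show ?thesis using q by (simp add: field_simps)
qed

lemma sum_inverse_nint:
  fixes q :: nat
  assumes "q \<ge> 1"
  shows "(\<Sum>c<q. 1 / nint (real c / real q)) \<le> 4 * real q * sqrt q"
proof -
  have q: "real q > 0" using assms by simp
  have "(\<Sum>c<q. 1 / nint (real c / real q)) = (\<Sum>c\<in>{1..<q}. 1 / nint (real c / real q))"
    by (rule sum.mono_neutral_right) (auto simp: nint_def not_le)
  also have "\<dots> \<le> (\<Sum>c\<in>{1..<q}. real q * (1 / real c) + real q * (1 / (real q - real c)))"
  proof (rule sum_mono)
    fix c assume c: "c \<in> {1..<q}"
    then have "min (real c) (real q - real c) / q > 0" by auto
    then have "1 / nint (real c / real q) \<le> 1 / (min (real c) (real q - real c) / q)"
      using nint_fraction_ge[of c q] c by (intro frac_le) auto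
    also have "\<dots> \<le> real q * (1 / real c) + real q * (1 / (real q - real c))"
      using c by (auto simp: min_def)
    finally show "1 / nint (real c / real q) \<le> real q * (1 / real c) + real q * (1 / (real q - real c))" .
  qed
  also have "\<dots> = real q * (\<Sum>c\<in>{1..<q}. 1 / real c) + real q * (\<Sum>c\<in>{1..<q}. 1 / (real q - real c))"
    by (simp only: sum.distrib sum_distrib_left)
  also have "(\<Sum>c\<in>{1..<q}. 1 / (real q - real c)) = (\<Sum>c\<in>{1..<q}. 1 / real c)"
    by (rule sum.reindex_bij_witness[of _ "\<lambda>c. q - c" "\<lambda>c. q - c"]) (auto simp: of_nat_diff)
  also have "real q * (\<Sum>c\<in>{1..<q}. 1 / real c) + real q * (\<Sum>c\<in>{1..<q}. 1 / real c) \<le> real q * (2 * sqrt q) + real q * (2 * sqrt q)"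
  proof -
    have "(\<Sum>c\<in>{1..<q}. 1 / real c) \<le> (\<Sum>c\<in>{1..q}. 1 / real c)" by (rule sum_mono2) auto
    also have "\<dots> \<le> 2 * sqrt q" by (rule sum_inverse_le_sqrt)
    finally have "real q * (\<Sum>c\<in>{1..<q}. 1 / real c) \<le> real q * (2 * sqrt q)" by (intro mult_left_mono) auto
    then show ?thesis by linarith
  qed
  finally show ?thesis by simp
qed

lemma sum_coprime_permute:
  fixes q :: nat and a :: int and g :: "int \<Rightarrow> real"
  assumes q: "q \<ge> 1" and cop: "coprime a (int q)" and per: "\<And>c. g (c mod int q) = g c"
  shows "(\<Sum>j<q. g (int j * a)) = (\<Sum>c<q. g (int c))"
proof -
  have "(\<Sum>j<q. g (int j * a)) = (\<Sum>j\<in>{0..<int q}. g (j * a mod int q))"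
    by (simp add: sum_int_nat per)
  also have "\<dots> = (\<Sum>c\<in>{0..<int q}. g c)"
  proof (rule sum.reindex_bij_betw[of "\<lambda>j. j * a mod int q"])
    have inj: "inj_on (\<lambda>j. j * a mod int q) {0..<int q}"
    proof (rule inj_onI)
      fix x y assume xy: "x \<in> {0..<int q}" "y \<in> {0..<int q}" "x * a mod int q = y * a mod int q"
      then have "int q dvd (x - y) * a" by (simp add: mod_eq_dvd_iff left_diff_distrib)
      then have "int q dvd x - y" using cop by (simp add: coprime_dvd_mult_left_iff coprime_commute)
      then have "x mod int q = y mod int q" by (simp add: mod_eq_dvd_iff)
      then show "x = y" using xy by simp
    qed
    have "(\<lambda>j. j * a mod int q) ` {0..<int q} = {0..<int q}"
      by (rule endo_inj_surj) (use inj q in auto)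
    with inj show "bij_betw (\<lambda>j. j * a mod int q) {0..<int q} {0..<int q}" by (simp add: bij_betw_def)
  qed
  finally show ?thesis by (simp add: sum_int_nat)
qed

text \<open>The range is covered by blocks of length q, on each of which h a runs through all
  residues modulo q. Multiples of q contribute nothing because of 1/0 = 0, so only the other h are
  really controlled here; multiples are the business of \<open>sum_rmin_multiples\<close>.\<close>

lemma sum_inverse_nint_multiples:
  fixes q L :: nat and a :: int
  assumes q: "q \<ge> 1" and cop: "coprime a (int q)" and L: "q \<le> 4 * L" "L \<ge> 1"
  shows "(\<Sum>h<L. 1 / nint (h * (of_int a / real q))) \<le> 40 * L powr (3/2)"
proof -
  define g where "g c = 1 / nint (of_int c / real q)" for c
  have per: "g (c mod int q) = g c" for c
  proof -
    have "of_int c / real q = of_int (c mod int q) / real q + of_int (c div int q)"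
    proof -
      have "real_of_int c = of_int (c mod int q + int q * (c div int q))" by (simp only: mod_mult_div_eq)
      also have "\<dots> = of_int (c mod int q) + real q * of_int (c div int q)"
        by (simp only: of_int_add of_int_mult of_int_of_nat_eq)
      finally show ?thesis using q by (simp add: field_simps)
    qed
    then show ?thesis by (simp add: g_def)
  qed
  have g: "g c \<ge> 0" for c by (simp add: g_def)
  have "(\<Sum>h<L. 1 / nint (h * (of_int a / real q))) = (\<Sum>h<L. g (int h * a))"
    by (simp add: g_def)
  also have "\<dots> \<le> (\<Sum>h<(L div q + 1) * q. g (int h * a))"
  proof (rule sum_mono2)
    have "L mod q + q * (L div q) = L" by (rule mod_mult_div_eq)
    moreover have "L mod q < q" using q by simp
    moreover have "(L div q + 1) * q = q * (L div q) + q" by (simp add: algebra_simps)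
    ultimately have "L \<le> (L div q + 1) * q" by linarith
    then show "{..<L} \<subseteq> {..<(L div q + 1) * q}" by auto
  qed (use g in auto)
  also have "\<dots> = (\<Sum>i<L div q + 1. \<Sum>h\<in>{i*q..<i*q+q}. g (int h * a))"
    by (rule sum.nat_group[symmetric])
  also have "\<dots> = (\<Sum>i<L div q + 1. \<Sum>c<q. g (int c))"
  proof (rule sum.cong[OF refl])
    fix i
    have "(\<Sum>h\<in>{i*q..<i*q+q}. g (int h * a)) = (\<Sum>j<q. g (int (i*q + j) * a))"
      by (rule sum.reindex_bij_witness[of _ "\<lambda>j. i*q + j" "\<lambda>h. h - i*q"]) auto
    also have "\<dots> = (\<Sum>j<q. g (int j * a))"
    proof (rule sum.cong[OF refl])
      fix j
      have "int (i*q + j) * a mod int q = int j * a mod int q"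
        by (simp add: mod_eq_dvd_iff algebra_simps)
      then show "g (int (i*q + j) * a) = g (int j * a)" using per by metis
    qed
    also have "\<dots> = (\<Sum>c<q. g (int c))" by (rule sum_coprime_permute[OF q cop, of g, OF per])
    finally show "(\<Sum>h\<in>{i*q..<i*q+q}. g (int h * a)) = (\<Sum>c<q. g (int c))" .
  qed
  also have "\<dots> = real (L div q + 1) * (\<Sum>c<q. 1 / nint (real c / real q))" by (simp add: g_def)
  also have "\<dots> \<le> (real L / q + 1) * (4 * real q * sqrt q)"
  proof (intro mult_mono sum_inverse_nint q)
    show "real (L div q + 1) \<le> real L / real q + 1" by (simp add: of_nat_div_le_of_nat)
  qed (auto intro!: sum_nonneg)
  also have "\<dots> = 4 * (real L + real q) * sqrt q" using q by (simp add: field_simps)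
  also have "\<dots> \<le> 4 * (5 * real L) * (2 * sqrt L)"
  proof -
    have "sqrt q \<le> sqrt (4 * real L)" using L by (intro real_sqrt_le_mono) linarith
    then have "sqrt q \<le> 2 * sqrt L" by (simp add: real_sqrt_mult)
    moreover have "real q \<le> 4 * real L" using L by linarith
    ultimately show ?thesis by (intro mult_mono) auto
  qed
  also have "\<dots> = 40 * (real L powr 1 * real L powr (1/2))" using L by (simp add: powr_half_sqrt)
  also have "real L powr 1 * real L powr (1/2) = real L powr (3/2)" by (subst powr_add[symmetric]) simp
  finally show ?thesis .
qed

text \<open>Merges a trivial bound, relevant for x \<le> 1, and a decay bound, relevant for x > 1,
  into one expression.\<close>

lemma powr_1_plus_bound:
  fixes x s y z :: real
  assumes "x \<ge> 0" "0 \<le> s" "s \<le> 1" "y \<le> z" "x > 1 \<Longrightarrow> y \<le> z * x powr (-s)" "z \<ge> 0"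
  shows "y \<le> 2 * z * (1 + x) powr (-s)"
proof (cases "x > 1")
  case False
  have "(1 + x) powr s \<le> 2 powr 1" using assms False by (intro order.trans[OF powr_mono2[of s "1+x" 2] powr_mono]) auto
  then have "1 \<le> 2 * (1 + x) powr (-s)" using assms by (simp add: powr_minus field_simps)
  then have "z * 1 \<le> z * (2 * (1 + x) powr (-s))" using assms by (intro mult_left_mono) auto
  then show ?thesis using assms by (simp add: mult_ac)
next
  case True
  have "((1 + x) / x) powr s \<le> 2 powr 1" using assms True by (intro order.trans[OF powr_mono2[of s "(1+x)/x" 2] powr_mono]) (auto simp: field_simps)
  then have "(1 + x) powr s \<le> 2 * x powr s" using True by (simp add: powr_divide field_simps)
  then have "x powr (-s) \<le> 2 * (1 + x) powr (-s)" using True by (simp add: powr_minus field_simps)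
  then have "z * x powr (-s) \<le> z * (2 * (1 + x) powr (-s))" using assms by (intro mult_left_mono) auto
  then show ?thesis using assms(5)[OF True] by (simp add: mult_ac)
qed

text \<open>For h = q j the distance of h \<xi> to the integers is exactly q j |\<beta>|, as |h
  \<beta>| < 1/2. Bounding min (L, 1/x) by L^(1/25) x^(-24/25) instead of 1/x turns the sum over j
  into a power instead of a logarithm; this is the origin of 24/25.\<close>

lemma sum_rmin_multiples:
  fixes q L :: nat and a :: int
  assumes q: "q \<ge> 1" and L: "L \<ge> 1" and b: "\<bar>\<xi> - of_int a / real q\<bar> \<le> 1 / (4 * real L * real q)"
  shows "(\<Sum>h\<in>{h\<in>{1..<L}. q dvd h}. rmin L (nint (h * \<xi>)))
    \<le> 50 * ((real L)\<^sup>2 / q) * (1 + (real L)\<^sup>2 * \<bar>\<xi> - of_int a / real q\<bar>) powr (-24/25)"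
proof -
  define \<beta> where "\<beta> = \<xi> - of_int a / real q"
  define J where "J = (L - 1) div q"
  define Y where "Y = (\<Sum>h\<in>{h\<in>{1..<L}. q dvd h}. rmin L (nint (h * \<xi>)))"
  have qp: "real q > 0" and Lp: "real L > 0" using q L by auto
  have JL: "real J \<le> L / q"
  proof -
    have "real J \<le> real (L - 1) / q" unfolding J_def by (rule of_nat_div_le_of_nat)
    also have "\<dots> \<le> L / q" by (intro divide_right_mono) auto
    finally show ?thesis .
  qed
  have Y: "Y = (\<Sum>j\<in>{1..J}. rmin L (nint ((q * j) * \<xi>)))"
    unfolding Y_def
  proof (rule sum.reindex_bij_witness[of _ "\<lambda>j. q * j" "\<lambda>h. h div q"])
    fix h assume "h \<in> {h\<in>{1..<L}. q dvd h}"
    then obtain k where k: "h = q * k" "1 \<le> h" "h < L" by auto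
    then have "k * q \<le> L - 1" by (simp add: mult.commute)
    then have "k \<le> J" using q by (simp add: J_def less_eq_div_iff_mult_less_eq)
    moreover have "k \<noteq> 0" using k by auto
    ultimately show "h div q \<in> {1..J}" "q * (h div q) = h" using k q by auto
    show "rmin L (nint (real (q * (h div q)) * \<xi>)) = rmin L (nint (real h * \<xi>))" using k q by simp
  next
    fix j assume j: "j \<in> {1..J}"
    then have "j * q \<le> L - 1" using q by (simp add: J_def less_eq_div_iff_mult_less_eq)
    then show "q * j \<in> {h\<in>{1..<L}. q dvd h}" using j q L by (auto simp: mult.commute)
    show "q * j div q = j" using q by simp
  qed
  have nt: "nint ((q * j) * \<xi>) = q * j * \<bar>\<beta>\<bar>" if "j \<in> {1..J}" for j
  proof -
    have "(q * j) * \<xi> = (q * j) * \<beta> + of_int (int j * a)" using qp by (simp add: \<beta>_def algebra_simps)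
    then have eq: "nint ((q * j) * \<xi>) = nint ((q * j) * \<beta>)" by (simp only: nint_add_int)
    have "\<bar>(q * j) * \<beta>\<bar> \<le> L * (1 / (4 * real L * real q))"
    proof -
      have "real (q * j) \<le> real L"
      proof -
        have "q * j \<le> q * J" using that by simp
        also have "\<dots> \<le> L - 1" by (simp add: J_def)
        finally have "q * j \<le> L" by simp
        then show ?thesis by (simp only: of_nat_le_iff)
      qed
      then show ?thesis unfolding abs_mult using b by (intro mult_mono) (auto simp: \<beta>_def)
    qed
    moreover have "L * (1 / (4 * real L * real q)) < 1/2"
      using Lp q by (simp add: field_simps)
    ultimately have "\<bar>(q * j) * \<beta>\<bar> < 1/2" by (rule le_less_trans)
    then have "nint ((q * j) * \<beta>) = \<bar>(q * j) * \<beta>\<bar>" by (rule nint_eq_abs)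
    with eq have "nint ((q * j) * \<xi>) = \<bar>(q * j) * \<beta>\<bar>" by (simp only:)
    then show ?thesis by (simp add: abs_mult)
  qed
  have t1: "Y \<le> 25 * ((real L)\<^sup>2 / q)"
  proof -
    have "Y \<le> (\<Sum>j\<in>{1..J}. real L)" unfolding Y by (intro sum_mono rmin_le) auto
    also have "\<dots> = J * L" by simp
    also have "\<dots> \<le> (L / q) * L" unfolding of_nat_mult using JL by (intro mult_right_mono) auto
    also have "\<dots> \<le> 25 * ((real L)\<^sup>2 / q)" using qp by (simp add: power2_eq_square divide_right_mono)
    finally show ?thesis .
  qed
  have t2: "Y \<le> 25 * ((real L)\<^sup>2 / q) * ((real L)\<^sup>2 * \<bar>\<beta>\<bar>) powr (-(24/25))" if "(real L)\<^sup>2 * \<bar>\<beta>\<bar> > 1"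
  proof -
    have bp: "\<bar>\<beta>\<bar> > 0" using that by (cases "\<beta> = 0") auto
    have "Y \<le> (\<Sum>j\<in>{1..J}. L powr (1/25) * (q * \<bar>\<beta>\<bar>) powr (-24/25) * real j powr (1/25 - 1))"
      unfolding Y
    proof (rule sum_mono)
      fix j assume j: "j \<in> {1..J}"
      define x where "x = q * j * \<bar>\<beta>\<bar>"
      have x: "x > 0" using j bp qp by (auto simp: x_def)
      have "rmin L x = rmin L x powr (1/25) * rmin L x powr (24/25)"
        using rmin_nonneg[of L x] x by (cases "rmin L x = 0") (auto simp flip: powr_add)
      also have "\<dots> \<le> L powr (1/25) * (1 / x) powr (24/25)"
        using x by (intro mult_mono powr_mono2 rmin_le rmin_le_inverse rmin_nonneg) auto
      also have "(1 / x) powr (24/25) = x powr (-24/25)" using x by (simp add: powr_divide powr_minus_divide)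
      also have "x powr (-24/25) = (q * \<bar>\<beta>\<bar>) powr (-24/25) * real j powr (1/25 - 1)"
        unfolding x_def using j bp qp by (simp add: powr_mult[symmetric] mult_ac)
      finally show "rmin L (nint ((q * j) * \<xi>)) \<le> L powr (1/25) * (q * \<bar>\<beta>\<bar>) powr (-24/25) * real j powr (1/25 - 1)"
        using nt[OF j] by (simp add: x_def mult_ac)
    qed
    also have "\<dots> = L powr (1/25) * (q * \<bar>\<beta>\<bar>) powr (-24/25) * (\<Sum>j\<in>{1..J}. real j powr (1/25 - 1))"
      by (simp only: sum_distrib_left)
    also have "\<dots> \<le> L powr (1/25) * (q * \<bar>\<beta>\<bar>) powr (-24/25) * (25 * (L / q) powr (1/25))"
    proof (intro mult_left_mono)
      have "(\<Sum>j\<in>{1..J}. real j powr (1/25 - 1)) \<le> (1/(1/25)) * real J powr (1/25)"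
        by (rule sum_powr_le) auto
      also have "\<dots> \<le> 25 * (L / q) powr (1/25)" using JL by (simp add: powr_mono2)
      finally show "(\<Sum>j\<in>{1..J}. real j powr (1/25 - 1)) \<le> 25 * (L / q) powr (1/25)" .
    qed auto
    also have "\<dots> = 25 * ((real L)\<^sup>2 / q) * ((real L)\<^sup>2 * \<bar>\<beta>\<bar>) powr (-24/25)"
    proof -
      have a1: "(q * \<bar>\<beta>\<bar>) powr (-24/25) = q powr (-24/25) * \<bar>\<beta>\<bar> powr (-24/25)"
        using bp qp by (simp add: powr_mult)
      have a2: "(L / q) powr (1/25) = L powr (1/25) * q powr (-1/25)"
        using Lp qp by (simp add: powr_divide powr_minus_divide)
      have a3: "((real L)\<^sup>2 * \<bar>\<beta>\<bar>) powr (-24/25) = L powr (-48/25) * \<bar>\<beta>\<bar> powr (-24/25)"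
      proof -
        have "((real L)\<^sup>2) powr (-24/25) = L powr (-48/25)"
          using Lp by (simp add: powr_powr flip: powr_numeral)
        then show ?thesis using bp Lp by (simp add: powr_mult)
      qed
      have a4: "real L powr (1/25) * real L powr (1/25) = (real L)\<^sup>2 * L powr (-48/25)"
        using Lp by (simp add: powr_add[symmetric] flip: powr_numeral)
      have a5: "real q powr (-24/25) * q powr (-1/25) = 1 / q"
        using qp by (simp add: powr_add[symmetric] powr_minus_divide)
      show ?thesis unfolding a1 a2 a3
        using arg_cong2[OF a4 a5, of "\<lambda>x y. 25 * \<bar>\<beta>\<bar> powr (-24/25) * x * y"] by (simp add: mult_ac)
    qed
    finally show ?thesis by simp
  qed
  have "Y \<le> 2 * (25 * ((real L)\<^sup>2 / q)) * (1 + (real L)\<^sup>2 * \<bar>\<beta>\<bar>) powr (-(24/25))"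
    by (rule powr_1_plus_bound) (use t1 t2 in auto)
  then show ?thesis by (simp add: Y_def \<beta>_def)
qed

text \<open>Here h a/q is at distance at least 1/q from the integers, while passing from a/q to
  \<xi> moves the point by at most 1/(4q); so the distance is at most halved and the rational case
  applies.\<close>

lemma sum_rmin_nonmultiples:
  fixes q L :: nat and a :: int
  assumes q: "q \<ge> 1" and L: "L \<ge> 1" "q \<le> 4 * L" and b: "\<bar>\<xi> - of_int a / real q\<bar> \<le> 1 / (4 * real L * real q)"
    and cop: "coprime a (int q)"
  shows "(\<Sum>h\<in>{h\<in>{1..<L}. \<not> q dvd h}. rmin L (nint (h * \<xi>))) \<le> 80 * L powr (3/2)"
proof -
  have qp: "real q > 0" and Lp: "real L > 0" using q L by auto
  have "(\<Sum>h\<in>{h\<in>{1..<L}. \<not> q dvd h}. rmin L (nint (h * \<xi>))) \<le> (\<Sum>h\<in>{h\<in>{1..<L}. \<not> q dvd h}. 2 * (1 / nint (h * (of_int a / real q))))"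
  proof (rule sum_mono)
    fix h assume "h \<in> {h\<in>{1..<L}. \<not> q dvd h}"
    then have h: "1 \<le> h" "h < L" "\<not> q dvd h" by auto
    define y where "y = nint (h * (of_int a / real q))"
    define z where "z = 1 / real q"
    have y: "y \<ge> z"
    proof -
      define k where "k = round (h * (of_int a / real q))"
      have "real q * y = \<bar>real_of_int (int h * a - int q * k)\<bar>"
      proof -
        have "real q * y = \<bar>real q * (h * (of_int a / real q) - of_int k)\<bar>"
          by (simp add: y_def nint_def k_def abs_mult)
        then show ?thesis using qp by (simp add: right_diff_distrib)
      qed
      moreover have "int h * a - int q * k \<noteq> 0"
      proof
        assume "int h * a - int q * k = 0"
        then have "int q dvd int h * a" by simp
        then have "int q dvd int h" using cop by (simp add: coprime_dvd_mult_left_iff coprime_commute)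
        then show False using h by simp
      qed
      then have "\<bar>real_of_int (int h * a - int q * k)\<bar> \<ge> 1" by linarith
      ultimately show ?thesis using qp by (simp add: z_def field_simps)
    qed
    have "y = nint (h * \<xi> + - (h * (\<xi> - of_int a / real q)))" by (simp add: y_def algebra_simps)
    also have y1: "\<dots> \<le> nint (h * \<xi>) + \<bar>h * (\<xi> - of_int a / real q)\<bar>"
      using nint_add_le[of "h * \<xi>" "- (h * (\<xi> - of_int a / real q))"] nint_le_abs[of "h * (\<xi> - of_int a / real q)"]
      by (simp only: nint_minus)
    finally have y1: "y \<le> nint (h * \<xi>) + \<bar>h * (\<xi> - of_int a / real q)\<bar>" .
    have "\<bar>h * (\<xi> - of_int a / real q)\<bar> \<le> L * (1 / (4 * real L * real q))"
      unfolding abs_mult using b h by (intro mult_mono) auto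
    also have "L * (1 / (4 * real L * real q)) = z / 4" using Lp by (simp add: z_def)
    finally have y2: "\<bar>h * (\<xi> - of_int a / real q)\<bar> \<le> z / 4" .
    have "y' / 2 \<le> n" if "y' \<le> n + d" "d \<le> z / 4" "z \<le> y'" "0 \<le> y'" for y' n d :: real
      using that by linarith
    from this[OF y1 y2 y] have "nint (h * \<xi>) \<ge> y / 2" by (simp add: y_def)
    moreover have "y > 0" using y qp by (simp add: z_def less_le_trans[OF _ y])
    ultimately have "rmin L (nint (h * \<xi>)) \<le> 1 / nint (h * \<xi>)" "1 / nint (h * \<xi>) \<le> 1 / (y / 2)"
      using rmin_le_inverse[of "nint (h * \<xi>)" L] frac_le[of 1 1 "y/2" "nint (h * \<xi>)"] by linarith+
    then show "rmin L (nint (h * \<xi>)) \<le> 2 * (1 / nint (h * (of_int a / real q)))" by (simp add: y_def)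
  qed
  also have "\<dots> \<le> (\<Sum>h<L. 2 * (1 / nint (h * (of_int a / real q))))" by (rule sum_mono2) auto
  also have "\<dots> = 2 * (\<Sum>h<L. 1 / nint (h * (of_int a / real q)))" by (simp only: sum_distrib_left)
  also have "\<dots> \<le> 2 * (40 * L powr (3/2))" using sum_inverse_nint_multiples[OF q cop L(2,1)] by simp
  finally show ?thesis by simp
qed

text \<open>Dirichlet's theorem with denominators up to 4 L is applied to 2 v \<theta>, the slope
  after differencing; the final square root turns 24/25 into 12/25. The approximation is chosen
  before n, so sums of all lengths up to L are bounded simultaneously.\<close>

theorem weyl_bound:
  fixes \<theta> :: real and L :: nat and u v :: int
  assumes L: "L \<ge> 1"
  obtains q :: nat and a :: int where "q \<ge> 1" "q \<le> 4 * L" "coprime a (int q)"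
    "\<bar>2 * of_int v * \<theta> - of_int a / real q\<bar> \<le> 1 / (4 * real L * real q)"
    "\<forall>n\<le>L. cmod (weyl_sum u v n \<theta>)
      \<le> 10 * real L * (q * (1 + (real L)\<^sup>2 * \<bar>2 * of_int v * \<theta> - of_int a / real q\<bar>)) powr (-12/25) + 13 * L powr (3/4)"
proof -
  define \<xi> where "\<xi> = 2 * of_int v * \<theta>"
  obtain a k where k: "coprime a k" "0 < k" "k \<le> int (4 * L)" "\<bar>of_int k * \<xi> - of_int a\<bar> < 1 / real (4 * L)"
    using Dirichlet_approx_coprime[of "4 * L" \<xi>] L by auto
  define q where "q = nat k"
  have q: "q \<ge> 1" "q \<le> 4 * L" "coprime a (int q)" "k = int q" using k by (auto simp: q_def)
  have qp: "real q > 0" and Lp: "real L > 0" using q L by auto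
  have b: "\<bar>\<xi> - of_int a / real q\<bar> \<le> 1 / (4 * real L * real q)"
  proof -
    have "real q * \<bar>\<xi> - of_int a / real q\<bar> = \<bar>real q * (\<xi> - of_int a / real q)\<bar>" by (simp add: abs_mult)
    also have "\<dots> = \<bar>of_int k * \<xi> - of_int a\<bar>" using qp by (simp add: right_diff_distrib q(4))
    also have "\<dots> \<le> 1 / real (4 * L)" using k by simp
    finally show ?thesis using qp by (simp add: field_simps)
  qed
  define x where "x = (real L)\<^sup>2 * \<bar>\<xi> - of_int a / real q\<bar>"
  have x: "x \<ge> 0" by (simp add: x_def)
  define E where "E = (q * (1 + x)) powr (-12/25)"
  have E: "E\<^sup>2 = (q * (1 + x)) powr (-24/25)" using x qp by (simp add: E_def powr_powr flip: powr_numeral)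
  have "(\<Sum>h\<in>{1..<L}. rmin L (nint (h * \<xi>))) =
    (\<Sum>h\<in>{h\<in>{1..<L}. q dvd h}. rmin L (nint (h * \<xi>))) + (\<Sum>h\<in>{h\<in>{1..<L}. \<not> q dvd h}. rmin L (nint (h * \<xi>)))"
    by (subst sum.union_disjoint[symmetric]) (auto intro!: sum.cong)
  also have "\<dots> \<le> 50 * ((real L)\<^sup>2 / q) * (1 + x) powr (-24/25) + 80 * L powr (3/2)"
    using sum_rmin_multiples[OF q(1) L b] sum_rmin_nonmultiples[OF q(1) L q(2) b q(3)] by (simp add: x_def)
  \<comment> \<open>The factor 1/q is weakened to q^(-24/25), so that denominator and distance enter
    through the single product q (1 + x).\<close>
  also have "50 * ((real L)\<^sup>2 / q) * (1 + x) powr (-24/25) \<le> 50 * (real L)\<^sup>2 * E\<^sup>2"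
  proof -
    have "1 / real q = q powr (-1)" using qp by (simp add: powr_minus_divide)
    also have "\<dots> \<le> q powr (-24/25)" using q by (intro powr_mono) auto
    finally have "1 / real q \<le> q powr (-24/25)" .
    then have "1 / real q * (1 + x) powr (-24/25) \<le> E\<^sup>2"
      using mult_right_mono[OF \<open>1 / real q \<le> q powr (-24/25)\<close>, of "(1 + x) powr (-24/25)"] qp x by (simp add: E powr_mult)
    then have "50 * (real L)\<^sup>2 * (1 / real q * (1 + x) powr (-24/25)) \<le> 50 * (real L)\<^sup>2 * E\<^sup>2" by (intro mult_left_mono) auto
    then show ?thesis by simp
  qed
  finally have sm: "(\<Sum>h\<in>{1..<L}. rmin L (nint (h * \<xi>))) \<le> 50 * (real L)\<^sup>2 * E\<^sup>2 + 80 * L powr (3/2)" by simp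
  have "cmod (weyl_sum u v n \<theta>) \<le> 10 * real L * E + 13 * L powr (3/4)" if n: "n \<le> L" for n
  proof -
    have "(cmod (weyl_sum u v n \<theta>))\<^sup>2 \<le> L + 2 * (50 * (real L)\<^sup>2 * E\<^sup>2 + 80 * L powr (3/2))"
      using weyl_sum_square[OF n, of u v \<theta>] sm by (simp add: \<xi>_def)
    also have "real L + 2 * (50 * (real L)\<^sup>2 * E\<^sup>2 + 80 * L powr (3/2)) \<le> L powr (3/2) + 2 * (50 * (real L)\<^sup>2 * E\<^sup>2 + 80 * L powr (3/2))"
      using powr_mono[of 1 "3/2" "real L"] L by simp
    also have "L powr (3/2) + 2 * (50 * (real L)\<^sup>2 * E\<^sup>2 + 80 * L powr (3/2)) \<le> (10 * real L * E)\<^sup>2 + (13 * L powr (3/4))\<^sup>2"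
    proof -
      have "(L powr (3/4))\<^sup>2 = L powr (3/2)" using Lp by (simp add: powr_powr flip: powr_numeral)
      then show ?thesis by (simp add: power_mult_distrib)
    qed
    also have "\<dots> \<le> (10 * real L * E + 13 * L powr (3/4))\<^sup>2"
    proof -
      have "E \<ge> 0" by (simp add: E_def)
      then show ?thesis by (simp add: power2_sum)
    qed
    finally show ?thesis by (rule power2_le_imp_le) (simp add: E_def)
  qed
  with q b show ?thesis by (intro that[of q a]) (auto simp: \<xi>_def E_def x_def)
qed

section \<open>Moments of divisor sums\<close>

text \<open>Arises in the restriction estimate when the weights q^(-1-\<kappa>), each multiplied by
  q, are summed over the q that divide a frequency n; there \<kappa> = 1/125. For such small
  \<kappa> it is unbounded, and its moments take the place of a pointwise bound.\<close>

definition divisor_weight :: "real \<Rightarrow> nat \<Rightarrow> real" where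
  "divisor_weight \<kappa> n = (\<Sum>q | q dvd n. real q powr (- \<kappa>))"

lemma divisor_weight_nonneg [simp]: "divisor_weight \<kappa> n \<ge> 0"
  by (simp add: divisor_weight_def sum_nonneg)

lemma card_divisors_prime_power:
  fixes p k m :: nat
  assumes p: "prime p" and m: "m > 0"
  shows "card {d. d dvd p ^ k * m} \<le> (k + 1) * card {d. d dvd m}"
proof -
  have "{d. d dvd p ^ k * m} \<subseteq> (\<lambda>(i, d). p ^ i * d) ` ({..k} \<times> {d. d dvd m})"
  proof
    fix d assume "d \<in> {d. d dvd p ^ k * m}"
    then obtain b c where "d = b * c" "b dvd p ^ k" "c dvd m"
      by (auto elim: dvd_productE)
    moreover then obtain i where "i \<le> k" "b = p ^ i" using p by (auto simp: divides_primepow_nat)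
    ultimately show "d \<in> (\<lambda>(i, d). p ^ i * d) ` ({..k} \<times> {d. d dvd m})" by force
  qed
  then have "card {d. d dvd p ^ k * m} \<le> card ({..k} \<times> {d. d dvd m})"
    using m by (intro order.trans[OF card_mono card_image_le]) auto
  then show ?thesis by (simp add: card_cartesian_product)
qed

text \<open>One prime power is removed at a time. For p \<ge> 2^(1/\<epsilon>) one has k + 1 \<le>
  2^k \<le> p^(k \<epsilon>) without loss; each of the boundedly many smaller primes costs a factor
  c.\<close>

lemma divisor_bound:
  assumes e: "\<epsilon> > 0"
  obtains C :: real where "C > 0" "\<And>n. n \<ge> 1 \<Longrightarrow> real (card {d. d dvd n}) \<le> C * real n powr \<epsilon>"
proof -
  \<comment> \<open>With this value k + 1 \<le> c (1 + k \<epsilon>/2), and 1 + k \<epsilon>/2 \<le>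
    2^(k \<epsilon>) because ln 2 \<ge> 1/2.\<close>
  define c where "c = 1 + 2 / \<epsilon>"
  define P where "P = nat \<lceil>2 powr (1 / \<epsilon>)\<rceil>"
  define S where "S n = {p. prime p \<and> p dvd n \<and> p < P}" for n
  have c: "c \<ge> 1" using e by (simp add: c_def)
  have small: "real k + 1 \<le> c * real p powr (k * \<epsilon>)" if "p \<ge> 2" for p k :: nat
  proof -
    have "1 + k * \<epsilon> * ln 2 \<le> exp (k * \<epsilon> * ln 2)" by (rule exp_ge_add_one_self)
    also have "\<dots> = 2 powr (k * \<epsilon>)" by (simp add: powr_def)
    also have "\<dots> \<le> real p powr (k * \<epsilon>)" using that e by (intro powr_mono2) auto
    finally have "1 + k * \<epsilon> * ln 2 \<le> real p powr (k * \<epsilon>)" .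
    moreover have "k * \<epsilon> * (1/2) \<le> k * \<epsilon> * ln 2"
      using ln2_ge_two_thirds e by (intro mult_left_mono) auto
    ultimately have "1 + k * \<epsilon> * (1/2) \<le> real p powr (k * \<epsilon>)" by linarith
    then have "c * (1 + k * \<epsilon> * (1/2)) \<le> c * real p powr (k * \<epsilon>)" using c by (intro mult_left_mono) auto
    moreover have "real k + 1 \<le> c * (1 + k * \<epsilon> * (1/2))"
      using e by (simp add: c_def field_simps)
    ultimately show ?thesis by linarith
  qed
  have large: "real k + 1 \<le> real p powr (k * \<epsilon>)" if "p \<ge> P" for p k :: nat
  proof -
    have "2 powr (1 / \<epsilon>) \<le> real p" using that by (simp add: P_def ceiling_le_iff nat_le_iff)
    then have "(2 powr (1 / \<epsilon>)) powr (k * \<epsilon>) \<le> real p powr (k * \<epsilon>)" using e by (intro powr_mono2) auto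
    moreover have "(2 powr (1 / \<epsilon>)) powr (k * \<epsilon>) = 2 ^ k" using e by (simp add: powr_powr powr_realpow)
    moreover have "real (k + 1) \<le> real (2 ^ k)" by (simp only: of_nat_le_iff) (simp add: Suc_leI)
    ultimately show ?thesis by simp
  qed
  have main: "real (card {d. d dvd n}) \<le> c ^ card (S n) * real n powr \<epsilon>" if "n \<ge> 1" for n
    using that
  proof (induction n rule: less_induct)
    case (less n)
    show ?case
    proof (cases "n = 1")
      case True then show ?thesis using c by simp
    next
      case False
      then obtain p where p: "prime p" "p dvd n" using prime_factor_nat by blast
      define k where "k = multiplicity p n"
      obtain m where m: "n = p ^ k * m" "\<not> p dvd m"
      proof (rule multiplicity_decompose'[of n p])
        show "n \<noteq> 0" "\<not> is_unit p" using less.prems prime_gt_1_nat[OF p(1)] by auto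
      qed (auto simp: k_def)
      have k: "k \<ge> 1" using m p by (cases k) auto
      have m0: "m > 0" using m less.prems by (cases "m = 0") auto
      have p2: "p \<ge> 2" using p prime_ge_2_nat by blast
      have mn: "m < n"
      proof -
        have "p ^ k > 1" using one_less_power[of p k] p2 k by simp
        then show ?thesis using m m0 by simp
      qed
      have finS: "finite (S n)" for n by (simp add: S_def)
      have np: "real n powr \<epsilon> = real p powr (k * \<epsilon>) * real m powr \<epsilon>"
        using p2 m0 by (simp add: m powr_mult powr_powr flip: powr_realpow)
      have "card {d. d dvd n} \<le> (k + 1) * card {d. d dvd m}"
        using card_divisors_prime_power[OF p(1) m0, of k] by (simp only: m(1)[symmetric])
      then have "real (card {d. d dvd n}) \<le> real ((k + 1) * card {d. d dvd m})" by (simp only: of_nat_le_iff)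
      then have "real (card {d. d dvd n}) \<le> (real k + 1) * real (card {d. d dvd m})" by (simp add: algebra_simps)
      also have "(real k + 1) * real (card {d. d dvd m}) \<le> (real k + 1) * (c ^ card (S m) * real m powr \<epsilon>)"
        using less.IH[OF mn] m0 by (intro mult_left_mono) auto
      also have "\<dots> \<le> c ^ card (S n) * (real p powr (k * \<epsilon>) * real m powr \<epsilon>)"
      proof (cases "p < P")
        case True
        have "insert p (S m) \<subseteq> S n" using True p m by (auto simp: S_def)
        moreover have "p \<notin> S m" using m by (simp add: S_def)
        ultimately have "Suc (card (S m)) \<le> card (S n)"
          using card_mono[OF finS, of "insert p (S m)" n] finS[of m] by simp
        then have "c ^ Suc (card (S m)) \<le> c ^ card (S n)" using c by (intro power_increasing) auto
        moreover have "(real k + 1) * c ^ card (S m) \<le> (c * real p powr (k * \<epsilon>)) * c ^ card (S m)"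
          using small[OF p2, of k] c by (intro mult_right_mono) auto
        ultimately have "(real k + 1) * c ^ card (S m) \<le> c ^ card (S n) * real p powr (k * \<epsilon>)"
          by (smt (verit) mult.commute mult.left_commute mult_right_mono power_Suc powr_ge_zero)
        then have "(real k + 1) * c ^ card (S m) * real m powr \<epsilon> \<le> c ^ card (S n) * real p powr (k * \<epsilon>) * real m powr \<epsilon>"
          by (intro mult_right_mono) auto
        then show ?thesis by (simp add: mult_ac)
      next
        case False
        have "card (S m) \<le> card (S n)" using m by (intro card_mono finS) (auto simp: S_def)
        then have "c ^ card (S m) \<le> c ^ card (S n)" using c by (intro power_increasing) auto
        moreover have "real k + 1 \<le> real p powr (k * \<epsilon>)" using large[of p k] False by simp
        ultimately have "(real k + 1) * c ^ card (S m) \<le> real p powr (k * \<epsilon>) * c ^ card (S n)"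
          using c by (intro mult_mono) auto
        then have "(real k + 1) * c ^ card (S m) * real m powr \<epsilon> \<le> real p powr (k * \<epsilon>) * c ^ card (S n) * real m powr \<epsilon>"
          by (intro mult_right_mono) auto
        then show ?thesis by (simp add: mult_ac)
      qed
      finally show ?thesis by (simp add: np)
    qed
  qed
  show ?thesis
  proof (rule that[of "c ^ P"])
    show "c ^ P > 0" using c by simp
    fix n :: nat assume n: "n \<ge> 1"
    have "card (S n) \<le> card {..<P}" by (intro card_mono) (auto simp: S_def)
    then have "c ^ card (S n) \<le> c ^ P" using c by (intro power_increasing) auto
    then have "c ^ card (S n) * real n powr \<epsilon> \<le> c ^ P * real n powr \<epsilon>" by (intro mult_right_mono) auto
    with main[OF n] show "real (card {d. d dvd n}) \<le> c ^ P * real n powr \<epsilon>" by linarith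
  qed
qed

text \<open>Pairs of divisors are grouped by their least common multiple l. As l is at most the
  product, a pair weighs at most l^(-\<kappa>), and there are at most O(l^(\<kappa>/2)) pairs for
  each l; hence the divisor bound with exponent \<kappa>/4.\<close>

lemma divisor_weight_square:
  assumes k: "\<kappa> > 0"
  obtains C where "C > 0" "\<And>n. n \<ge> 1 \<Longrightarrow> (divisor_weight \<kappa> n)\<^sup>2 \<le> C * divisor_weight (\<kappa> / 2) n"
proof -
  obtain C where C: "C > 0" "\<And>n. n \<ge> 1 \<Longrightarrow> real (card {d. d dvd n}) \<le> C * real n powr (\<kappa> / 4)"
    using divisor_bound[of "\<kappa> / 4"] k by auto
  show ?thesis
  proof (rule that[of "C\<^sup>2"])
    show "C\<^sup>2 > 0" using C by simp
    fix n :: nat assume n: "n \<ge> 1"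
    define D where "D = {d. d dvd n}"
    have D: "finite D" using n by (simp add: D_def)
    have pos: "q \<ge> 1" if "q \<in> D" for q
      using that n by (cases "q = 0") (auto simp: D_def)
    have "(divisor_weight \<kappa> n)\<^sup>2 = (\<Sum>x\<in>D \<times> D. real (fst x) powr (- \<kappa>) * real (snd x) powr (- \<kappa>))"
      by (simp add: divisor_weight_def D_def[symmetric] power2_eq_square sum_product sum.cartesian_product case_prod_unfold)
    also have "\<dots> \<le> (\<Sum>x\<in>D \<times> D. real (lcm (fst x) (snd x)) powr (- \<kappa>))"
    proof (rule sum_mono)
      fix x assume x: "x \<in> D \<times> D"
      then have p: "fst x \<ge> 1" "snd x \<ge> 1" using pos by auto
      have "lcm (fst x) (snd x) dvd fst x * snd x" by simp
      then have "lcm (fst x) (snd x) \<le> fst x * snd x" using p by (intro dvd_imp_le) auto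
      then have "real (lcm (fst x) (snd x)) \<le> real (fst x) * real (snd x)"
        by (simp only: of_nat_mult[symmetric] of_nat_le_iff)
      moreover have "lcm (fst x) (snd x) > 0" using p by (simp add: lcm_pos_nat)
      ultimately have "(real (fst x) * real (snd x)) powr (- \<kappa>) \<le> real (lcm (fst x) (snd x)) powr (- \<kappa>)"
        using k p by (intro powr_mono2') auto
      then show "real (fst x) powr (- \<kappa>) * real (snd x) powr (- \<kappa>) \<le> real (lcm (fst x) (snd x)) powr (- \<kappa>)"
        using p by (simp add: powr_mult)
    qed
    also have "\<dots> = (\<Sum>l\<in>D. \<Sum>x\<in>{x\<in>D \<times> D. lcm (fst x) (snd x) = l}. real (lcm (fst x) (snd x)) powr (- \<kappa>))"
      by (rule sum.group[symmetric]) (use D in \<open>auto simp: D_def\<close>)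
    also have "\<dots> \<le> (\<Sum>l\<in>D. C\<^sup>2 * real l powr (- (\<kappa> / 2)))"
    proof (rule sum_mono)
      fix l assume l: "l \<in> D"
      have "{x\<in>D \<times> D. lcm (fst x) (snd x) = l} \<subseteq> {d. d dvd l} \<times> {d. d dvd l}" by auto
      then have "card {x\<in>D \<times> D. lcm (fst x) (snd x) = l} \<le> card ({d. d dvd l} \<times> {d. d dvd l})"
        using pos[OF l] by (intro card_mono) auto
      then have "card {x\<in>D \<times> D. lcm (fst x) (snd x) = l} \<le> (card {d. d dvd l})\<^sup>2"
        by (simp add: card_cartesian_product power2_eq_square)
      then have "real (card {x\<in>D \<times> D. lcm (fst x) (snd x) = l}) \<le> (real (card {d. d dvd l}))\<^sup>2"
        by (simp only: of_nat_power[symmetric] of_nat_le_iff)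
      also have "\<dots> \<le> (C * real l powr (\<kappa> / 4))\<^sup>2" using C(2) pos[OF l] by (intro power_mono) auto
      also have "\<dots> = C\<^sup>2 * real l powr (\<kappa> / 2)"
        using pos[OF l] by (simp add: power_mult_distrib powr_powr flip: powr_numeral)
      finally have "real (card {x\<in>D \<times> D. lcm (fst x) (snd x) = l}) * real l powr (- \<kappa>) \<le> C\<^sup>2 * real l powr (\<kappa> / 2) * real l powr (- \<kappa>)"
        by (intro mult_right_mono) auto
      also have "\<dots> = C\<^sup>2 * real l powr (- (\<kappa> / 2))" using pos[OF l] by (simp add: powr_add[symmetric])
      finally show "(\<Sum>x\<in>{x\<in>D \<times> D. lcm (fst x) (snd x) = l}. real (lcm (fst x) (snd x)) powr (- \<kappa>)) \<le> C\<^sup>2 * real l powr (- (\<kappa> / 2))"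
        by simp
    qed
    also have "\<dots> = C\<^sup>2 * divisor_weight (\<kappa> / 2) n" by (simp add: divisor_weight_def D_def sum_distrib_left)
    finally show "(divisor_weight \<kappa> n)\<^sup>2 \<le> C\<^sup>2 * divisor_weight (\<kappa> / 2) n" .
  qed
qed

text \<open>Each squaring halves \<kappa>, which is harmless as long as \<kappa> stays positive.
  This is why the moments have order 2^j; order 8 is used later.\<close>

lemma divisor_weight_power:
  assumes "\<kappa> > 0"
  shows "\<exists>C>0. \<forall>n\<ge>1. divisor_weight \<kappa> n ^ (2 ^ j) \<le> C * divisor_weight (\<kappa> / 2 ^ j) n"
  using assms
proof (induction j)
  case 0 then show ?case by (intro exI[of _ 1]) auto
next
  case (Suc j)
  then obtain C where C: "C > 0" "\<And>n. n \<ge> 1 \<Longrightarrow> divisor_weight \<kappa> n ^ (2 ^ j) \<le> C * divisor_weight (\<kappa> / 2 ^ j) n" by auto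
  obtain C' where C': "C' > 0" "\<And>n. n \<ge> 1 \<Longrightarrow> (divisor_weight (\<kappa> / 2 ^ j) n)\<^sup>2 \<le> C' * divisor_weight (\<kappa> / 2 ^ j / 2) n"
    using divisor_weight_square[of "\<kappa> / 2 ^ j"] Suc by auto
  have "divisor_weight \<kappa> n ^ (2 ^ Suc j) \<le> C\<^sup>2 * C' * divisor_weight (\<kappa> / 2 ^ Suc j) n" if n: "n \<ge> 1" for n
  proof -
    have "divisor_weight \<kappa> n ^ (2 ^ Suc j) = (divisor_weight \<kappa> n ^ (2 ^ j))\<^sup>2" by (simp add: mult.commute flip: power_mult)
    also have "\<dots> \<le> (C * divisor_weight (\<kappa> / 2 ^ j) n)\<^sup>2" using C(2)[OF n] by (intro power_mono) auto
    also have "\<dots> = C\<^sup>2 * (divisor_weight (\<kappa> / 2 ^ j) n)\<^sup>2" by (simp add: power_mult_distrib)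
    also have "\<dots> \<le> C\<^sup>2 * (C' * divisor_weight (\<kappa> / 2 ^ j / 2) n)" using C'(2)[OF n] by (intro mult_left_mono) auto
    finally show ?thesis by (simp add: mult_ac)
  qed
  then show ?case using C C' by (intro exI[of _ "C\<^sup>2 * C'"]) auto
qed

text \<open>Interchange of summation: a divisor q occurs for at most X/q values of n, and \<kappa> >
  0 makes the resulting series over q converge.\<close>

lemma divisor_weight_mean:
  assumes k: "\<kappa> > 0"
  shows "(\<Sum>n\<in>{1..X}. divisor_weight \<kappa> n) \<le> real X * (\<Sum>q. real q powr (- 1 - \<kappa>))"
proof -
  have "(\<Sum>n\<in>{1..X}. divisor_weight \<kappa> n) = (\<Sum>n\<in>{1..X}. \<Sum>q\<in>{q\<in>{1..X}. q dvd n}. real q powr (- \<kappa>))"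
    unfolding divisor_weight_def
    by (intro sum.cong refl) (auto dest: dvd_imp_le simp: Suc_le_eq intro: Nat.gr0I)
  also have "\<dots> = (\<Sum>q\<in>{1..X}. \<Sum>n\<in>{n\<in>{1..X}. q dvd n}. real q powr (- \<kappa>))"
    by (rule sum.swap_restrict) auto
  also have "\<dots> \<le> (\<Sum>q\<in>{1..X}. real X * real q powr (- 1 - \<kappa>))"
  proof (rule sum_mono)
    fix q assume q: "q \<in> {1..X}"
    have "{n\<in>{1..X}. q dvd n} \<subseteq> (\<lambda>k. q * k) ` {1..X div q}"
    proof
      fix n assume "n \<in> {n\<in>{1..X}. q dvd n}"
      then obtain k where "n = q * k" "1 \<le> n" "n \<le> X" by auto
      moreover then have "k \<ge> 1" by (cases k) auto
      moreover have "k \<le> X div q" using \<open>n = q * k\<close> \<open>n \<le> X\<close> q by (simp add: less_eq_div_iff_mult_less_eq mult.commute)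
      ultimately show "n \<in> (\<lambda>k. q * k) ` {1..X div q}" by auto
    qed
    then have "card {n\<in>{1..X}. q dvd n} \<le> card {1..X div q}"
      by (intro order.trans[OF card_mono card_image_le]) auto
    then have "real (card {n\<in>{1..X}. q dvd n}) \<le> real (X div q)" by simp
    also have "\<dots> \<le> real X / real q" by (rule of_nat_div_le_of_nat)
    finally have "real (card {n\<in>{1..X}. q dvd n}) * real q powr (- \<kappa>) \<le> real X / real q * real q powr (- \<kappa>)"
      by (intro mult_right_mono) auto
    also have "\<dots> = real X * (real q powr (-1) * real q powr (- \<kappa>))"
      using q by (simp add: powr_minus_divide)
    also have "real q powr (-1) * real q powr (- \<kappa>) = real q powr (- 1 - \<kappa>)"
      by (subst powr_add[symmetric]) simp
    finally show "(\<Sum>n\<in>{n\<in>{1..X}. q dvd n}. real q powr (- \<kappa>)) \<le> real X * real q powr (- 1 - \<kappa>)" by simp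
  qed
  also have "\<dots> = real X * (\<Sum>q\<in>{1..X}. real q powr (- 1 - \<kappa>))" by (simp add: sum_distrib_left)
  also have "\<dots> \<le> real X * (\<Sum>q. real q powr (- 1 - \<kappa>))"
  proof (intro mult_left_mono sum_le_suminf)
    show "summable (\<lambda>q. real q powr (- 1 - \<kappa>))" using k by (simp add: summable_real_powr_iff)
  qed auto
  finally show ?thesis .
qed

lemma divisor_weight_moment:
  assumes k: "\<kappa> > 0"
  obtains C where "C > 0" "\<And>X. (\<Sum>n\<in>{1..X}. divisor_weight \<kappa> n ^ (2 ^ j)) \<le> C * real X"
proof -
  obtain C where C: "C > 0" "\<And>n. n \<ge> 1 \<Longrightarrow> divisor_weight \<kappa> n ^ (2 ^ j) \<le> C * divisor_weight (\<kappa> / 2 ^ j) n"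
    using divisor_weight_power[OF k, of j] by auto
  define Z where "Z = (\<Sum>q. real q powr (- 1 - \<kappa> / 2 ^ j))"
  have Z: "Z \<ge> 0" unfolding Z_def
    by (intro suminf_nonneg) (use k in \<open>auto simp: summable_real_powr_iff\<close>)
  show ?thesis
  proof (rule that[of "C * (Z + 1)"])
    show "C * (Z + 1) > 0" using C Z by simp
    fix X
    have "(\<Sum>n\<in>{1..X}. divisor_weight \<kappa> n ^ (2 ^ j)) \<le> (\<Sum>n\<in>{1..X}. C * divisor_weight (\<kappa> / 2 ^ j) n)"
      by (intro sum_mono C) auto
    also have "\<dots> = C * (\<Sum>n\<in>{1..X}. divisor_weight (\<kappa> / 2 ^ j) n)" by (simp add: sum_distrib_left)
    also have "\<dots> \<le> C * (real X * Z)"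
      using divisor_weight_mean[of "\<kappa> / 2 ^ j" X] k C by (intro mult_left_mono) (auto simp: Z_def)
    also have "\<dots> \<le> C * (Z + 1) * real X" using C by (simp add: algebra_simps)
    finally show "(\<Sum>n\<in>{1..X}. divisor_weight \<kappa> n ^ (2 ^ j)) \<le> C * (Z + 1) * real X" .
  qed
qed

section \<open>A restriction estimate\<close>

definition exp_sum_over :: "nat \<Rightarrow> int set \<Rightarrow> int \<Rightarrow> complex" where
  "exp_sum_over m S n = (\<Sum>a\<in>S. ef m (n * a))"

lemma exp_sum_over_uminus: "cmod (exp_sum_over m S (- n)) = cmod (exp_sum_over m S n)"
proof -
  have "exp_sum_over m S (- n) = cnj (exp_sum_over m S n)"
    by (simp add: exp_sum_over_def cnj_ef)
  then show ?thesis by simp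
qed

lemma exp_sum_over_le: "cmod (exp_sum_over m S n) \<le> card S"
  using norm_sum[of "\<lambda>a. ef m (n * a)" S] by (simp add: exp_sum_over_def)

text \<open>After expanding the square, the sums over a and b factor into
  |\<open>exp_sum_over\<close>|^2 at n1 - n2, the sum over the fractions j/q keeps only differences
  divisible by q, and the translation by k contributes a unimodular factor that absolute values
  remove.\<close>

lemma sum_fejer_pairs:
  fixes S :: "int set" and q H m :: nat and k :: int
  assumes fin: "finite S" and q: "q \<ge> 1" and m: "m \<ge> 1"
  shows "(\<Sum>a\<in>S. \<Sum>b\<in>S. \<Sum>j\<in>{0..<int q}. (cmod (\<Sum>n<H. eexp (real n * (of_int (a - b - k) / real m - of_int j / real q))))\<^sup>2)
    \<le> (\<Sum>n1<H. \<Sum>n2<H. if int q dvd int n1 - int n2 then q * (cmod (exp_sum_over m S (int n1 - int n2)))\<^sup>2 else 0)"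
    (is "?X \<le> ?Y")
proof -
  define z where "z a b j = of_int (a - b - k) / real m - of_int j / real q" for a b j
  define T where "T = exp_sum_over m S"
  have prod: "eexp (real n1 * z a b j) * cnj (eexp (real n2 * z a b j)) =
      ef m (- (int n1 - int n2) * k) * (ef m ((int n1 - int n2) * a) * cnj (ef m ((int n1 - int n2) * b))) * ef q (j * (- (int n1 - int n2)))"
    for n1 n2 a b j
  proof -
    have "eexp (real n1 * z a b j) * cnj (eexp (real n2 * z a b j)) = eexp (real n1 * z a b j + - (real n2 * z a b j))"
      by (simp only: cnj_eexp eexp_add)
    also have "real n1 * z a b j + - (real n2 * z a b j) =
       of_int (- (int n1 - int n2) * k) / real m + (of_int ((int n1 - int n2) * a) / real m + (- (of_int ((int n1 - int n2) * b) / real m)))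
        + of_int (j * (- (int n1 - int n2))) / real q"
      using q m by (simp add: z_def field_simps)
    finally show ?thesis by (simp only: eexp_add cnj_eexp ef_def)
  qed
  have "complex_of_real ?X = (\<Sum>a\<in>S. \<Sum>b\<in>S. \<Sum>j\<in>{0..<int q}. \<Sum>n1<H. \<Sum>n2<H. eexp (real n1 * z a b j) * cnj (eexp (real n2 * z a b j)))"
    by (simp only: of_real_sum complex_norm_square z_def[symmetric] cnj_sum sum_product)
  also have "\<dots> = (\<Sum>a\<in>S. \<Sum>b\<in>S. \<Sum>n1<H. \<Sum>n2<H. \<Sum>j\<in>{0..<int q}. eexp (real n1 * z a b j) * cnj (eexp (real n2 * z a b j)))"
    by (intro sum.cong refl) (subst sum.swap, intro sum.cong refl, rule sum.swap)
  also have "\<dots> = (\<Sum>a\<in>S. \<Sum>n1<H. \<Sum>n2<H. \<Sum>b\<in>S. \<Sum>j\<in>{0..<int q}. eexp (real n1 * z a b j) * cnj (eexp (real n2 * z a b j)))"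
    by (intro sum.cong refl) (subst sum.swap, intro sum.cong refl, rule sum.swap)
  also have "\<dots> = (\<Sum>n1<H. \<Sum>n2<H. \<Sum>a\<in>S. \<Sum>b\<in>S. \<Sum>j\<in>{0..<int q}. eexp (real n1 * z a b j) * cnj (eexp (real n2 * z a b j)))"
    by (subst sum.swap, intro sum.cong refl, rule sum.swap)
  also have "\<dots> = (\<Sum>n1<H. \<Sum>n2<H. ef m (- (int n1 - int n2) * k) * (T (int n1 - int n2) * cnj (T (int n1 - int n2)))
      * (\<Sum>j\<in>{0..<int q}. ef q (j * (- (int n1 - int n2)))))"
    by (simp only: prod sum_distrib_left[symmetric] sum_distrib_right[symmetric] T_def exp_sum_over_def cnj_sum)
  finally have "\<bar>?X\<bar> = cmod (\<Sum>n1<H. \<Sum>n2<H. ef m (- (int n1 - int n2) * k) * (T (int n1 - int n2) * cnj (T (int n1 - int n2)))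
      * (\<Sum>j\<in>{0..<int q}. ef q (j * (- (int n1 - int n2)))))"
    by (subst norm_of_real[symmetric], rule arg_cong[where f = cmod])
  also have "\<dots> \<le> ?Y"
  proof (intro sum_norm_le)
    fix n1 n2
    have dv: "(int q dvd - (int n1 - int n2)) = (int q dvd int n1 - int n2)" by (rule dvd_minus_iff)
    have "(\<Sum>j\<in>{0..<int q}. ef q (j * (- (int n1 - int n2)))) = (if int q dvd int n1 - int n2 then of_nat q else 0)"
      using sum_ef[of q "- (int n1 - int n2)"] q unfolding dv by simp
    then show "cmod (ef m (- (int n1 - int n2) * k) * (T (int n1 - int n2) * cnj (T (int n1 - int n2)))
      * (\<Sum>j\<in>{0..<int q}. ef q (j * (- (int n1 - int n2)))))
      \<le> (if int q dvd int n1 - int n2 then q * (cmod (exp_sum_over m S (int n1 - int n2)))\<^sup>2 else 0)"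
      by (simp add: norm_mult power2_eq_square T_def)
  qed
  finally show ?thesis by linarith
qed

text \<open>Each difference occurs at most H times, and n and -n contribute equally.\<close>

lemma sum_differences_le:
  fixes F :: "int \<Rightarrow> real"
  assumes F: "\<And>n. F n \<ge> 0" "\<And>n. F (- n) = F n"
  shows "(\<Sum>n1<H. \<Sum>n2<H. F (int n1 - int n2)) \<le> H * (F 0 + 2 * (\<Sum>n\<in>{1..<H}. F (int n)))"
proof (induction H)
  case (Suc H)
  have r1: "(\<Sum>n<H. F (int H - int n)) = (\<Sum>n\<in>{1..<Suc H}. F (int n))"
    by (rule sum.reindex_bij_witness[of _ "\<lambda>n. H - n" "\<lambda>n. H - n"]) (auto simp: of_nat_diff)
  have r2: "(\<Sum>n<H. F (int n - int H)) = (\<Sum>n<H. F (int H - int n))"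
    using F(2) by (intro sum.cong refl) (metis minus_diff_eq)
  have "(\<Sum>n1<Suc H. \<Sum>n2<Suc H. F (int n1 - int n2)) = (\<Sum>n1<H. \<Sum>n2<H. F (int n1 - int n2)) + 2 * (\<Sum>n\<in>{1..<Suc H}. F (int n)) + F 0"
    by (simp add: sum.distrib r1 r2)
  also have "\<dots> \<le> H * (F 0 + 2 * (\<Sum>n\<in>{1..<H}. F (int n))) + 2 * (\<Sum>n\<in>{1..<Suc H}. F (int n)) + F 0"
    using Suc by simp
  also have "\<dots> \<le> H * (F 0 + 2 * (\<Sum>n\<in>{1..<Suc H}. F (int n))) + 2 * (\<Sum>n\<in>{1..<Suc H}. F (int n)) + F 0"
    using F by (intro add_right_mono mult_left_mono add_left_mono sum_mono2) auto
  also have "\<dots> = Suc H * (F 0 + 2 * (\<Sum>n\<in>{1..<Suc H}. F (int n)))" by (simp add: algebra_simps)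
  finally show ?case .
qed simp

text \<open>With at most m/8 terms and x within 1/(2m) of an integer, every summand lies within 1/2
  of 1. This dictates the length \<open>m div 8\<close> of the kernel.\<close>

lemma fejer_lower:
  assumes H: "8 * H \<le> m" and m: "m \<ge> 1" and x: "\<bar>x - of_int i\<bar> \<le> 1 / (2 * real m)"
  shows "(cmod (\<Sum>n<H. eexp (real n * x)))\<^sup>2 \<ge> (real H)\<^sup>2 / 4"
proof -
  define y where "y = x - of_int i"
  have eq: "eexp (real n * x) = eexp (real n * y)" for n
  proof -
    have "real n * x = real n * y + of_int (int n * i)" by (simp add: y_def algebra_simps)
    then show ?thesis by (simp only: eexp_add eexp_int mult_1_right)
  qed
  have "cmod ((\<Sum>n<H. eexp (real n * y)) - of_nat H) = cmod (\<Sum>n<H. eexp (real n * y) - 1)"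
    by (simp add: sum_subtractf)
  also have "\<dots> \<le> (\<Sum>n<H. 1/2)"
  proof (rule sum_norm_le)
    fix n assume n: "n \<in> {..<H}"
    have "cmod (eexp (real n * y) - 1) \<le> 2 * pi * \<bar>real n * y\<bar>" by (rule eexp_minus_1_le)
    also have "\<dots> \<le> 2 * 4 * (m / 8 * (1 / (2 * real m)))"
      unfolding abs_mult using n H x pi_less_4 by (intro mult_mono) (auto simp: y_def)
    also have "\<dots> = 1/2" using m by simp
    finally show "cmod (eexp (real n * y) - 1) \<le> 1/2" .
  qed
  finally have "cmod ((\<Sum>n<H. eexp (real n * y)) - of_nat H) \<le> H / 2" by simp
  then have "cmod (\<Sum>n<H. eexp (real n * y)) \<ge> H / 2"
    using norm_triangle_ineq2[of "of_nat H" "of_nat H - (\<Sum>n<H. eexp (real n * y))"]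
    by (simp add: norm_minus_commute)
  then have "(cmod (\<Sum>n<H. eexp (real n * y)))\<^sup>2 \<ge> (H / 2)\<^sup>2" by (intro power_mono) auto
  then show ?thesis by (simp add: eq power_divide)
qed

text \<open>Up to normalisation, a majorant of (r (1 + m |a/m - b/r|))^(-126/125) for all admissible
  fractions b/r at once: nonnegative kernels concentrated near j/q, translated by k/m, with weights
  decaying in q and k. The exponent is 12/25 times 21/10, and being above 1 it makes the weights in
  k summable uniformly in m.\<close>

definition major_arc_kernel :: "nat \<Rightarrow> nat \<Rightarrow> int \<Rightarrow> real" where
  "major_arc_kernel m Q a = (\<Sum>k\<in>{- int m..int m}. (1 + \<bar>real_of_int k\<bar>) powr (- 126/125) *
     (\<Sum>q\<in>{1..Q}. real q powr (- 126/125) *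
       (\<Sum>j\<in>{0..<int q}. (cmod (\<Sum>n<m div 8. eexp (real n * (of_int (a - k) / real m - of_int j / real q))))\<^sup>2)))"

text \<open>All terms are nonnegative, so a single one suffices: q = r, j the residue of b, and k
  the integer nearest to m (a/m - b/r), which puts the argument within 1/(2m) of an integer. The
  assumption |a/m - b/r| \<le> 1 keeps k in range, and the factor 4 on the right pays for
  rounding.\<close>

lemma major_arc_kernel_lower:
  fixes r Q m :: nat and b a :: int
  assumes r: "1 \<le> r" "r \<le> Q" and m: "m \<ge> 1" and b: "\<bar>of_int a / real m - of_int b / real r\<bar> \<le> 1"
  shows "(real (m div 8))\<^sup>2 / 4 * (r * (1 + m * \<bar>of_int a / real m - of_int b / real r\<bar>)) powr (- 126/125)
    \<le> 4 * major_arc_kernel m Q a"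
proof -
  define \<beta> where "\<beta> = of_int a / real m - of_int b / real r"
  define k where "k = round (m * \<beta>)"
  have mp: "real m > 0" and rp: "real r > 0" using m r by auto
  have kr: "\<bar>of_int k - m * \<beta>\<bar> \<le> 1/2" using of_int_round_abs_le[of "m * \<beta>"] by (simp add: k_def)
  have mb: "\<bar>m * \<beta>\<bar> \<le> m" using b mp by (simp add: abs_mult \<beta>_def[symmetric] mult_left_le)
  have k: "k \<in> {- int m..int m}" using kr mb by (simp, linarith)
  define j where "j = b mod int r"
  have j: "j \<in> {0..<int r}" using r by (simp add: j_def)
  have near: "\<bar>(of_int (a - k) / real m - of_int j / real r) - of_int (b div int r)\<bar> \<le> 1 / (2 * real m)"
  proof -
    have "real_of_int b = of_int (j + int r * (b div int r))" unfolding j_def by (simp only: mod_mult_div_eq)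
    then have bj: "real_of_int b = of_int j + real r * of_int (b div int r)" by (simp only: of_int_add of_int_mult of_int_of_nat_eq)
    have "(of_int (a - k) / real m - of_int j / real r) - of_int (b div int r) = - ((of_int k - m * \<beta>) / m)"
      using mp rp bj by (simp add: \<beta>_def field_simps)
    then have "\<bar>(of_int (a - k) / real m - of_int j / real r) - of_int (b div int r)\<bar> = \<bar>of_int k - m * \<beta>\<bar> / m"
      using mp by simp
    also have "\<dots> \<le> (1/2) / m" using kr mp by (intro divide_right_mono) auto
    finally show ?thesis by simp
  qed
  define \<Phi> where "\<Phi> k q j = (cmod (\<Sum>n<m div 8. eexp (real n * (of_int (a - k) / real m - of_int j / real q))))\<^sup>2" for k j :: int and q :: nat
  have "(real (m div 8))\<^sup>2 / 4 \<le> \<Phi> k r j"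
    unfolding \<Phi>_def by (rule fejer_lower[OF _ m near]) simp
  also have "\<dots> \<le> (\<Sum>j\<in>{0..<int r}. \<Phi> k r j)"
    using j by (intro member_le_sum) (auto simp: \<Phi>_def)
  finally have s1: "(real (m div 8))\<^sup>2 / 4 \<le> (\<Sum>j\<in>{0..<int r}. \<Phi> k r j)" .
  have "real r powr (- 126/125) * ((real (m div 8))\<^sup>2 / 4) \<le> real r powr (- 126/125) * (\<Sum>j\<in>{0..<int r}. \<Phi> k r j)"
    using s1 by (intro mult_left_mono) auto
  also have "\<dots> \<le> (\<Sum>q\<in>{1..Q}. real q powr (- 126/125) * (\<Sum>j\<in>{0..<int q}. \<Phi> k q j))"
    using r by (intro member_le_sum) (auto intro!: mult_nonneg_nonneg sum_nonneg simp: \<Phi>_def)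
  finally have s2: "real r powr (- 126/125) * ((real (m div 8))\<^sup>2 / 4) \<le> (\<Sum>q\<in>{1..Q}. real q powr (- 126/125) * (\<Sum>j\<in>{0..<int q}. \<Phi> k q j))" .
  have "(1 + \<bar>real_of_int k\<bar>) powr (- 126/125) * (real r powr (- 126/125) * ((real (m div 8))\<^sup>2 / 4))
    \<le> (1 + \<bar>real_of_int k\<bar>) powr (- 126/125) * (\<Sum>q\<in>{1..Q}. real q powr (- 126/125) * (\<Sum>j\<in>{0..<int q}. \<Phi> k q j))"
    using s2 by (intro mult_left_mono) auto
  also have "\<dots> \<le> major_arc_kernel m Q a"
    unfolding major_arc_kernel_def \<Phi>_def
    using k by (intro member_le_sum[where f = "\<lambda>k. (1 + \<bar>real_of_int k\<bar>) powr (- 126/125) * (\<Sum>q\<in>{1..Q}. real q powr (- 126/125) *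
       (\<Sum>j\<in>{0..<int q}. (cmod (\<Sum>n<m div 8. eexp (real n * (of_int (a - k) / real m - of_int j / real q))))\<^sup>2))"])
      (auto intro!: mult_nonneg_nonneg sum_nonneg)
  finally have s3: "(1 + \<bar>real_of_int k\<bar>) powr (- 126/125) * (real r powr (- 126/125) * ((real (m div 8))\<^sup>2 / 4)) \<le> major_arc_kernel m Q a" .
  have s4: "(1 + m * \<bar>\<beta>\<bar>) powr (- 126/125) \<le> 4 * (1 + \<bar>real_of_int k\<bar>) powr (- 126/125)"
  proof -
    have "1 + \<bar>real_of_int k\<bar> \<le> 2 * (1 + m * \<bar>\<beta>\<bar>)"
    proof -
      have "\<bar>real_of_int k\<bar> \<le> \<bar>m * \<beta>\<bar> + 1/2" using kr by linarith
      then show ?thesis using mp by (simp add: abs_mult)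
    qed
    then have "(2 * (1 + m * \<bar>\<beta>\<bar>)) powr (- 126/125) \<le> (1 + \<bar>real_of_int k\<bar>) powr (- 126/125)"
      by (intro powr_mono2') auto
    moreover have "(2 * (1 + m * \<bar>\<beta>\<bar>)) powr (- 126/125) = 2 powr (-126/125) * (1 + m * \<bar>\<beta>\<bar>) powr (- 126/125)"
      by (rule powr_mult)
    moreover have "2 powr (-126/125) \<ge> 2 powr (-2::real)" by (rule powr_mono) auto
    moreover have "2 powr (-2::real) = 1/4" by (simp add: powr_minus)
    ultimately have "1/4 * (1 + m * \<bar>\<beta>\<bar>) powr (- 126/125) \<le> (1 + \<bar>real_of_int k\<bar>) powr (- 126/125)"
      by (smt (verit) mult_right_mono powr_ge_zero)
    then show ?thesis by simp
  qed
  have "(real (m div 8))\<^sup>2 / 4 * (r * (1 + m * \<bar>\<beta>\<bar>)) powr (- 126/125)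
    = (real (m div 8))\<^sup>2 / 4 * real r powr (- 126/125) * (1 + m * \<bar>\<beta>\<bar>) powr (- 126/125)"
    by (simp add: powr_mult)
  also have "\<dots> \<le> (real (m div 8))\<^sup>2 / 4 * real r powr (- 126/125) * (4 * (1 + \<bar>real_of_int k\<bar>) powr (- 126/125))"
    using s4 by (intro mult_left_mono) auto
  also have "\<dots> \<le> 4 * major_arc_kernel m Q a" using s3 by (simp add: mult_ac)
  finally show ?thesis by (simp add: \<beta>_def)
qed

lemma sum_int_abs_powr_le:
  "(\<Sum>k\<in>{- int m..int m}. (1 + \<bar>real_of_int k\<bar>) powr (- 126/125)) \<le> 2 * (\<Sum>q. real q powr (- 126/125))"
proof -
  have sm: "summable (\<lambda>q. real q powr (- 126/125))" by (simp add: summable_real_powr_iff)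
  have "(\<Sum>k\<in>{- int m..int m}. (1 + \<bar>real_of_int k\<bar>) powr (- 126/125)) \<le>
    (\<Sum>k\<in>{0..int m}. (1 + \<bar>real_of_int k\<bar>) powr (- 126/125)) + (\<Sum>k\<in>uminus ` {0..int m}. (1 + \<bar>real_of_int k\<bar>) powr (- 126/125))"
  proof -
    have "{- int m..int m} \<subseteq> {0..int m} \<union> uminus ` {0..int m}"
      by (auto simp: image_iff)
    then have "(\<Sum>k\<in>{- int m..int m}. (1 + \<bar>real_of_int k\<bar>) powr (- 126/125)) \<le> (\<Sum>k\<in>{0..int m} \<union> uminus ` {0..int m}. (1 + \<bar>real_of_int k\<bar>) powr (- 126/125))"
      by (intro sum_mono2) auto
    also have "\<dots> \<le> (\<Sum>k\<in>{0..int m}. (1 + \<bar>real_of_int k\<bar>) powr (- 126/125)) + (\<Sum>k\<in>uminus ` {0..int m}. (1 + \<bar>real_of_int k\<bar>) powr (- 126/125))"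
      by (subst sum.union_inter[symmetric]) (auto intro!: sum_nonneg)
    finally show ?thesis .
  qed
  also have "(\<Sum>k\<in>uminus ` {0..int m}. (1 + \<bar>real_of_int k\<bar>) powr (- 126/125)) = (\<Sum>k\<in>{0..int m}. (1 + \<bar>real_of_int k\<bar>) powr (- 126/125))"
    by (subst sum.reindex) (auto simp: inj_on_def)
  also have "(\<Sum>k\<in>{0..int m}. (1 + \<bar>real_of_int k\<bar>) powr (- 126/125)) = (\<Sum>q\<in>{1..Suc m}. real q powr (- 126/125))"
    by (rule sum.reindex_bij_witness[of _ "\<lambda>q. int q - 1" "\<lambda>k. nat k + 1"]) auto
  also have "(\<Sum>q\<in>{1..Suc m}. real q powr (- 126/125)) \<le> (\<Sum>q. real q powr (- 126/125))"
    by (intro sum_le_suminf sm) auto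
  finally show ?thesis by simp
qed

text \<open>Apart from common factors, the difference 0 contributes at most |S|^2 for each q, since
  q times q^(-126/125) is at most 1. For n \<noteq> 0 only the q dividing n survive, and their
  weights add up to the divisor weight.\<close>

lemma sum_major_arc_kernel:
  fixes S :: "int set" and m Q :: nat
  assumes fin: "finite S" and m: "m \<ge> 1"
  defines "H \<equiv> m div 8"
  shows "(\<Sum>a\<in>S. \<Sum>b\<in>S. major_arc_kernel m Q (a - b)) \<le>
    2 * (\<Sum>q. real q powr (- 126/125)) * (H * (real Q * (real (card S))\<^sup>2
      + 2 * (\<Sum>n\<in>{1..<H}. (cmod (exp_sum_over m S (int n)))\<^sup>2 * divisor_weight (1/125) n)))"
proof -
  define G where "G k q = (\<Sum>a\<in>S. \<Sum>b\<in>S. \<Sum>j\<in>{0..<int q}. (cmod (\<Sum>n<H. eexp (real n * (of_int (a - b - k) / real m - of_int j / real q))))\<^sup>2)"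
    for k :: int and q :: nat
  define T where "T n = (cmod (exp_sum_over m S n))\<^sup>2" for n
  define F where "F q n = (if int q dvd n then q * T n else 0)" for q :: nat and n :: int
  define W where "W = H * (real Q * (real (card S))\<^sup>2 + 2 * (\<Sum>n\<in>{1..<H}. T (int n) * divisor_weight (1/125) n))"
  have T0: "T n \<ge> 0" "T (- n) = T n" for n by (auto simp: T_def exp_sum_over_uminus)
  have W0: "W \<ge> 0" unfolding W_def using T0 by (intro mult_nonneg_nonneg add_nonneg_nonneg sum_nonneg) auto
  have GF: "G k q \<le> H * (F q 0 + 2 * (\<Sum>n\<in>{1..<H}. F q (int n)))" if "q \<ge> 1" for k q
  proof -
    have "G k q \<le> (\<Sum>n1<H. \<Sum>n2<H. F q (int n1 - int n2))"
      unfolding G_def F_def T_def by (rule sum_fejer_pairs[OF fin that m])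
    also have "\<dots> \<le> H * (F q 0 + 2 * (\<Sum>n\<in>{1..<H}. F q (int n)))"
      by (rule sum_differences_le) (auto simp: F_def T0)
    finally show ?thesis .
  qed
  have qp: "real q powr (- 126/125) * q = real q powr (- (1/125))" if "q \<ge> 1" for q :: nat
  proof -
    have "real q powr (- 126/125) * q = real q powr (- 126/125) * real q powr 1" using that by simp
    also have "\<dots> = real q powr (- (1/125))" by (subst powr_add[symmetric]) simp
    finally show ?thesis .
  qed
  have inner: "(\<Sum>q\<in>{1..Q}. real q powr (- 126/125) * G k q) \<le> W" for k
  proof -
    have "(\<Sum>q\<in>{1..Q}. real q powr (- 126/125) * G k q) \<le> (\<Sum>q\<in>{1..Q}. real q powr (- 126/125) * (H * (F q 0 + 2 * (\<Sum>n\<in>{1..<H}. F q (int n)))))"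
      using GF by (intro sum_mono mult_left_mono) auto
    also have "\<dots> = H * ((\<Sum>q\<in>{1..Q}. real q powr (- 126/125) * F q 0) + 2 * (\<Sum>n\<in>{1..<H}. \<Sum>q\<in>{1..Q}. real q powr (- 126/125) * F q (int n)))"
    proof -
      have "(\<Sum>n\<in>{1..<H}. \<Sum>q\<in>{1..Q}. real q powr (- 126/125) * F q (int n)) = (\<Sum>q\<in>{1..Q}. real q powr (- 126/125) * (\<Sum>n\<in>{1..<H}. F q (int n)))"
        unfolding sum_distrib_left by (rule sum.swap)
      moreover have "(\<Sum>q\<in>{1..Q}. w q * (H * (x q + 2 * y q))) = H * ((\<Sum>q\<in>{1..Q}. w q * x q) + 2 * (\<Sum>q\<in>{1..Q}. w q * y q))"
        for w x y :: "nat \<Rightarrow> real"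
        by (simp add: sum.distrib sum_distrib_left algebra_simps)
      ultimately show ?thesis by simp
    qed
    also have "\<dots> \<le> W" unfolding W_def
    proof (intro mult_left_mono add_mono sum_mono)
      have "(\<Sum>q\<in>{1..Q}. real q powr (- 126/125) * F q 0) \<le> (\<Sum>q\<in>{1..Q}. (real (card S))\<^sup>2)"
      proof (rule sum_mono)
        fix q assume q: "q \<in> {1..Q}"
        have "real q powr (- 126/125) * F q 0 = real q powr (- (1/125)) * T 0"
          using qp[of q] q by (simp add: F_def mult.assoc[symmetric])
        also have "\<dots> \<le> 1 * (real (card S))\<^sup>2"
        proof (intro mult_mono)
          have "real q powr (- (1/125)) \<le> real q powr 0" using q by (intro powr_mono) auto
          then show "real q powr (- (1/125)) \<le> 1" using q by simp
          show "T 0 \<le> (real (card S))\<^sup>2" unfolding T_def by (intro power_mono exp_sum_over_le) auto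
        qed (auto simp: T0)
        finally show "real q powr (- 126/125) * F q 0 \<le> (real (card S))\<^sup>2" by simp
      qed
      then show "(\<Sum>q\<in>{1..Q}. real q powr (- 126/125) * F q 0) \<le> real Q * (real (card S))\<^sup>2" by simp
      fix n assume n: "n \<in> {1..<H}"
      have "(\<Sum>q\<in>{1..Q}. real q powr (- 126/125) * F q (int n)) = (\<Sum>q\<in>{q\<in>{1..Q}. q dvd n}. real q powr (- (1/125)) * T (int n))"
        unfolding sum.inter_filter[OF finite_atLeastAtMost]
        using qp by (intro sum.cong refl) (simp add: F_def mult.assoc[symmetric])
      also have "\<dots> \<le> (\<Sum>q | q dvd n. real q powr (- (1/125)) * T (int n))"
        using n T0 by (intro sum_mono2) auto
      also have "\<dots> = T (int n) * divisor_weight (1/125) n" by (simp add: divisor_weight_def sum_distrib_left mult.commute)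
      finally show "(\<Sum>q\<in>{1..Q}. real q powr (- 126/125) * F q (int n)) \<le> T (int n) * divisor_weight (1/125) n" .
    qed auto
    finally show ?thesis .
  qed
  have "(\<Sum>a\<in>S. \<Sum>b\<in>S. major_arc_kernel m Q (a - b)) =
    (\<Sum>k\<in>{- int m..int m}. (1 + \<bar>real_of_int k\<bar>) powr (- 126/125) * (\<Sum>q\<in>{1..Q}. real q powr (- 126/125) * G k q))"
  proof -
    have "(\<Sum>a\<in>S. \<Sum>b\<in>S. major_arc_kernel m Q (a - b)) = (\<Sum>x\<in>S \<times> S. major_arc_kernel m Q (fst x - snd x))"
      by (simp add: sum.cartesian_product case_prod_unfold)
    also have "\<dots> = (\<Sum>k\<in>{- int m..int m}. (1 + \<bar>real_of_int k\<bar>) powr (- 126/125) * (\<Sum>q\<in>{1..Q}. real q powr (- 126/125) *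
      (\<Sum>x\<in>S \<times> S. \<Sum>j\<in>{0..<int q}. (cmod (\<Sum>n<H. eexp (real n * (of_int (fst x - snd x - k) / real m - of_int j / real q))))\<^sup>2)))"
      unfolding major_arc_kernel_def H_def[symmetric]
      apply (subst sum.swap)
      apply (intro sum.cong refl)
      apply (subst sum_distrib_left[symmetric])
      apply (rule arg_cong[where f = "\<lambda>x. _ * x"])
      apply (subst sum.swap)
      apply (intro sum.cong refl)
      apply (subst sum_distrib_left[symmetric])
      apply (rule refl)
      done
    finally have "(\<Sum>a\<in>S. \<Sum>b\<in>S. major_arc_kernel m Q (a - b)) = (\<Sum>k\<in>{- int m..int m}. (1 + \<bar>real_of_int k\<bar>) powr (- 126/125) * (\<Sum>q\<in>{1..Q}. real q powr (- 126/125) *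
      (\<Sum>x\<in>S \<times> S. \<Sum>j\<in>{0..<int q}. (cmod (\<Sum>n<H. eexp (real n * (of_int (fst x - snd x - k) / real m - of_int j / real q))))\<^sup>2)))" .
    moreover have "G k q = (\<Sum>x\<in>S \<times> S. \<Sum>j\<in>{0..<int q}. (cmod (\<Sum>n<H. eexp (real n * (of_int (fst x - snd x - k) / real m - of_int j / real q))))\<^sup>2)" for k q
      unfolding G_def by (subst sum.cartesian_product, simp only: case_prod_unfold)
    ultimately show ?thesis by (simp only:)
  qed
  also have "\<dots> \<le> (\<Sum>k\<in>{- int m..int m}. (1 + \<bar>real_of_int k\<bar>) powr (- 126/125) * W)"
    using inner by (intro sum_mono mult_left_mono) auto
  also have "\<dots> = (\<Sum>k\<in>{- int m..int m}. (1 + \<bar>real_of_int k\<bar>) powr (- 126/125)) * W"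
    by (rule sum_distrib_right[symmetric])
  also have "\<dots> \<le> 2 * (\<Sum>q. real q powr (- 126/125)) * W"
    using sum_int_abs_powr_le W0 by (intro mult_right_mono)
  finally show ?thesis by (simp add: W_def T_def)
qed

text \<open>The only information on the phase that the restriction estimate uses. The fraction b/r
  need not be reduced, and r may reach 8 L because denominators are doubled in the case of
  squares.\<close>

definition major_arc_bounded :: "real \<Rightarrow> nat \<Rightarrow> nat \<Rightarrow> (nat \<Rightarrow> int) \<Rightarrow> bool" where
  "major_arc_bounded C L m \<phi> \<longleftrightarrow> (\<forall>a. \<exists>(r::nat) (b::int). 1 \<le> r \<and> r \<le> 8 * L \<and>
     \<bar>of_int a / real m - of_int b / real r\<bar> \<le> 1 \<and>
     cmod (\<Sum>t<L. ef m (a * \<phi> t)) \<le>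
       C * L * (r * (1 + m * \<bar>of_int a / real m - of_int b / real r\<bar>)) powr (- 12/25) + L powr (99/100))"

text \<open>The convex function h^g lies above its tangent at x. Summed over all pairs of
  frequencies, with x a lower bound for the mean, this serves as Jensen's inequality.\<close>

lemma powr_tangent:
  fixes g x h :: real
  assumes "g > 1" "x > 0" "h \<ge> 0"
  shows "g * x powr (g - 1) * h \<le> h powr g + (g - 1) * x powr g"
proof -
  have "h * x powr (g - 1) \<le> h powr g / g + (x powr (g - 1)) powr (g / (g - 1)) / (g / (g - 1))"
    using assms by (intro Youngs_inequality) (auto simp: field_simps)
  also have "(x powr (g - 1)) powr (g / (g - 1)) = x powr g" using assms by (simp add: powr_powr)
  also have "h powr g / g + x powr g / (g / (g - 1)) = (h powr g + (g - 1) * x powr g) / g"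
    using assms by (simp add: field_simps)
  finally show ?thesis using assms by (simp add: field_simps)
qed

lemma powr_ge_const:
  assumes "e > 0" "K \<ge> 0" "x \<ge> K powr (1 / e)" "x > 0"
  shows "x powr e \<ge> (K :: real)"
proof (cases "K = 0")
  case False
  have "K = (K powr (1 / e)) powr e" using assms False by (simp add: powr_powr)
  also have "\<dots> \<le> x powr e" using assms by (intro powr_mono2) auto
  finally show ?thesis .
qed simp

text \<open>Bourgain's argument: by duality the level set \<open>S\<close> forces many large values of the Weyl sum on
  \<open>S - S\<close>. Each of them is majorised by the kernel of a rational approximation, and the
  kernels are summed by Hoelder's inequality and the moments of the divisor weight.\<close>

theorem restriction_levels:
  assumes C: "C \<ge> 1"
  shows "\<exists>C'>0. \<exists>L0::nat. \<forall>L m \<phi> c \<eta> S. L \<ge> L0 \<longrightarrow> L\<^sup>2 \<le> m \<longrightarrow> major_arc_bounded C L m \<phi> \<longrightarrow> (\<forall>t<L. cmod (c t) \<le> 1)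
      \<longrightarrow> S \<subseteq> {0..<int m} \<longrightarrow> \<eta> \<ge> real L powr (- 1/1000)
      \<longrightarrow> (\<forall>a\<in>S. cmod (\<Sum>t<L. c t * ef m (a * \<phi> t)) \<ge> \<eta> * L)
      \<longrightarrow> card S \<le> C' * \<eta> powr (- 24/5)"
proof -
  define Z where "Z = (\<Sum>q. real q powr (- 126/125))"
  obtain C8 where C8: "C8 > 0" "\<And>X. (\<Sum>n\<in>{1..X}. divisor_weight (1/125) n ^ (2 ^ 3)) \<le> C8 * real X"
    by (rule divisor_weight_moment[of "1/125" 3]) auto
  have Z: "Z \<ge> 1"
  proof -
    have "(\<Sum>q\<in>{1}. real q powr (- 126/125)) \<le> Z"
      unfolding Z_def by (intro sum_le_suminf) (auto simp: summable_real_powr_iff)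
    then show ?thesis by simp
  qed
  \<comment> \<open>\<open>K1\<close> makes the contribution of the difference 0 at most a quarter
    of the main term. In \<open>L0\<close>, the summand 2^125 gives L^(1/125) \<ge> 2, which absorbs
    the error L^(99/100), and 8 gives m \<ge> 64.\<close>
  define K1 where "K1 = 16384 * Z * (2 * C) powr (21/10)"
  define L0 where "L0 = nat \<lceil>K1 powr 2\<rceil> + 2 ^ 125 + 8"
  define C' where "C' = 2048 * Z * (4096 * Z * C8) powr (1/7) * (2 * C) powr (24/10)"
  show ?thesis
  proof (intro exI[of _ C'] conjI exI[of _ L0] allI impI)
    show "C' > 0" using Z C8 C by (simp add: C'_def)
    fix L m \<phi> c \<eta> S
    assume L: "L \<ge> L0" and m: "L\<^sup>2 \<le> m" and mab: "major_arc_bounded C L m \<phi>"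
      and c': "\<forall>t<L. cmod (c t) \<le> 1" and S: "S \<subseteq> {0..<int m}" and lam: "\<eta> \<ge> real L powr (- 1/1000)"
      and big: "\<forall>a\<in>S. cmod (\<Sum>t<L. c t * ef m (a * \<phi> t)) \<ge> \<eta> * L"
    have c: "\<And>t. t < L \<Longrightarrow> cmod (c t) \<le> 1" using c' by blast
    have "C' > 0" using Z C8 C by (simp add: C'_def)
    have L8: "L \<ge> 8" "L \<ge> 2 ^ 125" using L by (auto simp: L0_def)
    have Lp: "real L > 0" using L8 by simp
    have "real L powr (- 1/1000) > 0" using Lp by simp
    then have lp: "\<eta> > 0" using lam by linarith
    have fin: "finite S" using S finite_subset by blast
    define R where "R = real (card S)"
    show "card S \<le> C' * \<eta> powr (- 24/5)"
    proof (cases "S = {}")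
      case True then show ?thesis using \<open>C' > 0\<close> by simp
    next
      case False
      then have R: "R > 0" using fin by (simp add: R_def card_gt_0_iff)
      define f where "f a = (\<Sum>t<L. c t * ef m (a * \<phi> t))" for a
      define D where "D a = (\<Sum>t<L. ef m (a * \<phi> t))" for a
      obtain r b where rb: "\<And>a. 1 \<le> r a" "\<And>a. r a \<le> 8 * L" "\<And>a. \<bar>of_int a / real m - of_int (b a) / real (r a)\<bar> \<le> 1"
        "\<And>a. cmod (D a) \<le> C * L * (r a * (1 + m * \<bar>of_int a / real m - of_int (b a) / real (r a)\<bar>)) powr (- 12/25) + L powr (99/100)"
        using mab unfolding major_arc_bounded_def D_def by metis
      define h where "h a = (r a * (1 + m * \<bar>of_int a / real m - of_int (b a) / real (r a)\<bar>)) powr (- 12/25)" for a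
      have h0: "h a \<ge> 0" for a by (simp add: h_def)
      \<comment> \<open>Phases that turn the sum of |f a| into a linear form; where f a = 0 the
        quotient is 0.\<close>
      define \<omega> where "\<omega> a = cnj (f a) / cmod (f a)" for a
      have w1: "cmod (\<omega> a) \<le> 1" for a by (cases "f a = 0") (auto simp: \<omega>_def norm_divide)
      have wf: "\<omega> a * f a = cmod (f a)" for a
        by (cases "f a = 0") (auto simp: \<omega>_def complex_norm_square[symmetric] power2_eq_square mult.commute)
      have s1: "R * (\<eta> * L) \<le> cmod (\<Sum>a\<in>S. \<omega> a * f a)"
      proof -
        have "R * (\<eta> * L) = (\<Sum>a\<in>S. \<eta> * L)" by (simp add: R_def)
        also have "\<dots> \<le> (\<Sum>a\<in>S. cmod (f a))" using big by (intro sum_mono) (auto simp: f_def)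
        also have "\<dots> = cmod (complex_of_real (\<Sum>a\<in>S. cmod (f a)))" by (simp add: sum_nonneg del: of_real_sum)
        also have "\<dots> = cmod (\<Sum>a\<in>S. \<omega> a * f a)" by (simp add: wf)
        finally show ?thesis .
      qed
      have s2: "(cmod (\<Sum>a\<in>S. \<omega> a * f a))\<^sup>2 \<le> L * (\<Sum>a\<in>S. \<Sum>b\<in>S. cmod (D (a - b)))"
      proof -
        have "1 * (cmod (\<Sum>a\<in>S. \<omega> a * (\<Sum>t<L. c t * ef m (a * \<phi> t))))\<^sup>2
          \<le> L * (\<Sum>a\<in>S. \<Sum>b\<in>S. cmod (\<omega> a) * cmod (\<omega> b) * cmod (\<Sum>t<L. (1::real) * ef m ((a - b) * \<phi> t)))"
          using duality[OF fin, where w = "\<lambda>_. 1" and ?w0.0 = 1 and c = c and L = L and m = m and P = \<phi> and \<omega> = \<omega>] c by simp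
        also have "\<dots> \<le> L * (\<Sum>a\<in>S. \<Sum>b\<in>S. 1 * 1 * cmod (D (a - b)))"
          using w1 by (intro mult_left_mono sum_mono mult_mono) (auto simp: D_def)
        finally show ?thesis by (simp add: f_def)
      qed
      have s3: "R\<^sup>2 * (\<eta>\<^sup>2 * L) \<le> (\<Sum>a\<in>S. \<Sum>b\<in>S. cmod (D (a - b)))"
      proof -
        have "(R * (\<eta> * L))\<^sup>2 \<le> (cmod (\<Sum>a\<in>S. \<omega> a * f a))\<^sup>2"
          using s1 R lp Lp by (intro power_mono) auto
        with s2 have "(R * (\<eta> * L))\<^sup>2 \<le> L * (\<Sum>a\<in>S. \<Sum>b\<in>S. cmod (D (a - b)))" by linarith
        then have "L * (R\<^sup>2 * (\<eta>\<^sup>2 * L)) \<le> L * (\<Sum>a\<in>S. \<Sum>b\<in>S. cmod (D (a - b)))"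
          by (simp add: power2_eq_square mult_ac)
        then show ?thesis using Lp by simp
      qed
      \<comment> \<open>The lower bound on \<eta> gives \<eta>^2 L \<ge> L^(998/1000), which is
        larger than L^(99/100) by the factor L^(1/125) \<ge> 2.\<close>
      have err: "L powr (99/100) \<le> \<eta>\<^sup>2 * L / 2"
      proof -
        have "real L powr (1/125) \<ge> 2"
        proof (rule powr_ge_const)
          have "(2::real) powr (1 / (1/125)) = 2 ^ 125" by (simp flip: powr_realpow)
          also have "\<dots> = real (2 ^ 125)" by simp
          also have "\<dots> \<le> real L" using L8 by (simp only: of_nat_le_iff)
          finally show "(2::real) powr (1 / (1/125)) \<le> real L" .
        qed (use Lp in auto)
        then have "2 * L powr (99/100) \<le> L powr (1/125) * L powr (99/100)" by (intro mult_right_mono) auto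
        also have "\<dots> = (L powr (- 1/1000))\<^sup>2 * L powr 1"
          by (simp only: power2_eq_square powr_add[symmetric]) simp
        also have "\<dots> \<le> \<eta>\<^sup>2 * L powr 1" using lam by (intro mult_right_mono power_mono) auto
        finally show ?thesis by simp
      qed
      define \<mu> where "\<mu> = \<eta>\<^sup>2 / (2 * C)"
      have mu: "\<mu> > 0" using lp C by (simp add: \<mu>_def)
      have s4: "\<mu> * R\<^sup>2 \<le> (\<Sum>a\<in>S. \<Sum>b\<in>S. h (a - b))"
      proof -
        have "R\<^sup>2 * (\<eta>\<^sup>2 * L) \<le> (\<Sum>a\<in>S. \<Sum>b\<in>S. C * L * h (a - b) + \<eta>\<^sup>2 * L / 2)"
          using rb(4) err by (intro order.trans[OF s3] sum_mono) (smt (verit) h_def)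
        also have "\<dots> = C * L * (\<Sum>a\<in>S. \<Sum>b\<in>S. h (a - b)) + R\<^sup>2 * (\<eta>\<^sup>2 * L / 2)"
          by (simp add: sum.distrib sum_distrib_left R_def power2_eq_square)
        finally have "L * (R\<^sup>2 * \<eta>\<^sup>2) \<le> L * (2 * C * (\<Sum>a\<in>S. \<Sum>b\<in>S. h (a - b)))" by (simp add: algebra_simps)
        then have "R\<^sup>2 * \<eta>\<^sup>2 \<le> 2 * C * (\<Sum>a\<in>S. \<Sum>b\<in>S. h (a - b))" using Lp by simp
        then show ?thesis using C by (simp add: \<mu>_def field_simps)
      qed
      define X where "X = \<mu> powr (21/10)"
      have X: "X > 0" using mu by (simp add: X_def)
      \<comment> \<open>The power 21/10 lifts the decay exponent from 12/25 to 126/125, beyond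
        1.\<close>
      have s5: "X * R\<^sup>2 \<le> (\<Sum>a\<in>S. \<Sum>b\<in>S. h (a - b) powr (21/10))"
      proof -
        have "(21/10) * \<mu> powr (21/10 - 1) * (\<Sum>a\<in>S. \<Sum>b\<in>S. h (a - b)) = (\<Sum>a\<in>S. \<Sum>b\<in>S. (21/10) * \<mu> powr (21/10 - 1) * h (a - b))"
          by (simp only: sum_distrib_left)
        also have "\<dots> \<le> (\<Sum>a\<in>S. \<Sum>b\<in>S. h (a - b) powr (21/10) + (21/10 - 1) * \<mu> powr (21/10))"
          using mu h0 by (intro sum_mono powr_tangent) auto
        also have "\<dots> = (\<Sum>a\<in>S. \<Sum>b\<in>S. h (a - b) powr (21/10)) + R\<^sup>2 * (11/10 * X)"
          by (simp add: sum.distrib R_def power2_eq_square X_def)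
        finally have a1: "(21/10) * \<mu> powr (21/10 - 1) * (\<Sum>a\<in>S. \<Sum>b\<in>S. h (a - b)) \<le> (\<Sum>a\<in>S. \<Sum>b\<in>S. h (a - b) powr (21/10)) + R\<^sup>2 * (11/10 * X)" .
        have a2: "(21/10) * \<mu> powr (21/10 - 1) * (\<mu> * R\<^sup>2) \<le> (21/10) * \<mu> powr (21/10 - 1) * (\<Sum>a\<in>S. \<Sum>b\<in>S. h (a - b))"
          using s4 by (intro mult_left_mono) auto
        have "\<mu> powr (21/10 - 1) * \<mu> = X"
        proof -
          have "\<mu> powr (21/10 - 1) * \<mu> = \<mu> powr (21/10 - 1) * \<mu> powr 1" using mu by simp
          also have "\<dots> = X" unfolding X_def by (subst powr_add[symmetric]) simp
          finally show ?thesis .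
        qed
        then have a3: "(21/10) * \<mu> powr (21/10 - 1) * (\<mu> * R\<^sup>2) = 21/10 * (X * R\<^sup>2)"
          by (metis mult.assoc)
        have "R\<^sup>2 * (11/10 * X) = 11/10 * (X * R\<^sup>2)" by simp
        then show ?thesis using a1 a2 a3 by linarith
      qed
      define H where "H = m div 8"
      have m8: "real m \<ge> (real L)\<^sup>2" using m by (metis of_nat_le_iff of_nat_power)
      have m64: "real m \<ge> 64" 
      proof -
        have "(64::real) \<le> (real L)\<^sup>2" using L8(1) power_mono[of 8 "real L" 2] by simp
        then show ?thesis using m8 by linarith
      qed
      have mp: "real m > 0" "m \<ge> 1" using m64 by auto
      have Hm: "real H \<ge> m / 16"
      proof -
        have "m \<le> 8 * H + 7" unfolding H_def by presburger
        then show ?thesis using m64 by linarith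
      qed
      have Hp: "real H > 0" using Hm mp by linarith
      define T where "T n = (cmod (exp_sum_over m S (int n)))\<^sup>2" for n
      define W where "W = (\<Sum>n\<in>{1..<H}. T n * divisor_weight (1/125) n)"
      have W0: "W \<ge> 0" by (auto simp: W_def T_def intro!: sum_nonneg)
      have s6: "(\<Sum>a\<in>S. \<Sum>b\<in>S. h (a - b) powr (21/10)) \<le> 4096 * Z * (R\<^sup>2 / L) + 1024 * Z * (W / m)"
      proof -
        have "(real H)\<^sup>2 / 4 * (\<Sum>a\<in>S. \<Sum>b\<in>S. h (a - b) powr (21/10)) = (\<Sum>a\<in>S. \<Sum>b\<in>S. (real H)\<^sup>2 / 4 * h (a - b) powr (21/10))"
          by (simp only: sum_distrib_left)
        also have "\<dots> \<le> (\<Sum>a\<in>S. \<Sum>b\<in>S. 4 * major_arc_kernel m (8 * L) (a - b))"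
        proof (intro sum_mono)
          fix a b'
          have "h (a - b') powr (21/10) = (r (a - b') * (1 + m * \<bar>of_int (a - b') / real m - of_int (b (a - b')) / real (r (a - b'))\<bar>)) powr (- 126/125)"
            by (simp add: h_def powr_powr)
          then show "(real H)\<^sup>2 / 4 * h (a - b') powr (21/10) \<le> 4 * major_arc_kernel m (8 * L) (a - b')"
            using major_arc_kernel_lower[OF rb(1) rb(2) mp(2) rb(3), of "a - b'"] by (simp only: H_def)
        qed
        also have "\<dots> = 4 * (\<Sum>a\<in>S. \<Sum>b\<in>S. major_arc_kernel m (8 * L) (a - b))" by (simp add: sum_distrib_left)
        also have "\<dots> \<le> 4 * (2 * Z * (H * (real (8 * L) * R\<^sup>2 + 2 * W)))"
        proof (rule mult_left_mono)
          show "(\<Sum>a\<in>S. \<Sum>b\<in>S. major_arc_kernel m (8 * L) (a - b)) \<le> 2 * Z * (H * (real (8 * L) * R\<^sup>2 + 2 * W))"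
            unfolding Z_def H_def R_def W_def T_def by (rule sum_major_arc_kernel[OF fin mp(2)])
        qed simp
        also have "\<dots> = (real H)\<^sup>2 / 4 * (32 * Z * (8 * L * R\<^sup>2 + 2 * W) / H)"
          using Hp by (simp add: power2_eq_square field_simps)
        finally have "(\<Sum>a\<in>S. \<Sum>b\<in>S. h (a - b) powr (21/10)) \<le> 32 * Z * (8 * L * R\<^sup>2 + 2 * W) / H"
          using Hp by (simp only: mult_le_cancel_left_pos zero_less_divide_iff zero_less_power zero_less_numeral simp_thms)
        also have "\<dots> \<le> 32 * Z * (8 * L * R\<^sup>2 + 2 * W) / (m / 16)"
          using Hm mp Z W0 by (intro divide_left_mono mult_nonneg_nonneg add_nonneg_nonneg mult_pos_pos) auto
        also have "\<dots> = 4096 * Z * (L * R\<^sup>2 / m) + 1024 * Z * (W / m)" using mp by (simp add: field_simps)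
        also have "L * R\<^sup>2 / m \<le> L * R\<^sup>2 / (real L)\<^sup>2"
          using m8 Lp mp by (intro divide_left_mono) auto
        also have "L * R\<^sup>2 / (real L)\<^sup>2 = R\<^sup>2 / L" using Lp by (simp add: power2_eq_square)
        finally show ?thesis using Z by simp
      qed
      \<comment> \<open>The divisor weight is split at height \<open>Kc\<close>: below it Parseval
        is used, above it the trivial bound R^2 for \<open>T n\<close> and the eighth moment. The
        value is chosen so that the second part amounts to X R^2 / 4.\<close>
      define Kc where "Kc = (4096 * Z * C8 / X) powr (1/7)"
      have Kc: "Kc > 0" using Z C8 X by (simp add: Kc_def)
      have Kc7: "Kc ^ 7 = 4096 * Z * C8 / X"
        unfolding Kc_def using Z C8 X by (simp add: powr_powr flip: powr_realpow)
      have s7: "W \<le> Kc * (m * R) + R\<^sup>2 / Kc ^ 7 * (C8 * m)"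
      proof -
        have "W \<le> (\<Sum>n\<in>{1..<H}. Kc * T n + R\<^sup>2 / Kc ^ 7 * divisor_weight (1/125) n ^ 8)"
          unfolding W_def
        proof (rule sum_mono)
          fix n
          have T: "0 \<le> T n" "T n \<le> R\<^sup>2"
            unfolding T_def R_def by (auto intro!: power_mono exp_sum_over_le)
          show "T n * divisor_weight (1/125) n \<le> Kc * T n + R\<^sup>2 / Kc ^ 7 * divisor_weight (1/125) n ^ 8"
          proof (cases "divisor_weight (1/125) n \<le> Kc")
            case True
            then have "T n * divisor_weight (1/125) n \<le> T n * Kc" using T by (intro mult_left_mono) auto
            moreover have "R\<^sup>2 / Kc ^ 7 * divisor_weight (1/125) n ^ 8 \<ge> 0" using Kc by simp
            ultimately show ?thesis by (simp add: mult.commute)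
          next
            case False
            define d where "d = divisor_weight (1/125) n"
            have d: "d > Kc" using False by (simp add: d_def)
            have "Kc ^ 7 \<le> d ^ 7" using d Kc by (intro power_mono) auto
            then have "T n * d * Kc ^ 7 \<le> R\<^sup>2 * d * d ^ 7"
              using T d Kc by (intro mult_mono) auto
            then have "T n * d \<le> R\<^sup>2 / Kc ^ 7 * d ^ 8" using Kc by (simp add: field_simps eval_nat_numeral)
            moreover have "Kc * T n \<ge> 0" using T Kc by simp
            ultimately show ?thesis by (simp add: d_def)
          qed
        qed
        also have "\<dots> = Kc * (\<Sum>n\<in>{1..<H}. T n) + R\<^sup>2 / Kc ^ 7 * (\<Sum>n\<in>{1..<H}. divisor_weight (1/125) n ^ 8)"
          by (simp only: sum.distrib sum_distrib_left)
        also have "\<dots> \<le> Kc * (m * R) + R\<^sup>2 / Kc ^ 7 * (C8 * m)"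
        proof (intro add_mono mult_left_mono)
          have "(\<Sum>n\<in>{1..<H}. T n) \<le> (\<Sum>n<m. T n)"
            by (intro sum_mono2) (auto simp: H_def T_def)
          also have "\<dots> = (\<Sum>n\<in>{0..<int m}. (cmod (\<Sum>a\<in>S. ef m (n * a)))\<^sup>2)"
            by (simp add: sum_int_nat T_def exp_sum_over_def)
          also have "\<dots> \<le> m * R" using parseval[of m S] mp(2) S by (simp add: R_def)
          finally show "(\<Sum>n\<in>{1..<H}. T n) \<le> m * R" .
          have "(\<Sum>n\<in>{1..<H}. divisor_weight (1/125) n ^ 8) \<le> (\<Sum>n\<in>{1..m}. divisor_weight (1/125) n ^ (2 ^ 3))"
            by (simp, intro sum_mono2) (auto simp: H_def)
          also have "\<dots> \<le> C8 * m" by (rule C8)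
          finally show "(\<Sum>n\<in>{1..<H}. divisor_weight (1/125) n ^ 8) \<le> C8 * m" .
        qed (use Kc in auto)
        finally show ?thesis .
      qed
      have s8: "1024 * Z * (W / m) \<le> 1024 * Z * Kc * R + X / 4 * R\<^sup>2"
      proof -
        have "W / m \<le> (Kc * (m * R) + R\<^sup>2 / Kc ^ 7 * (C8 * m)) / m" using s7 mp by (intro divide_right_mono) auto
        also have "\<dots> = Kc * R + R\<^sup>2 * (C8 / Kc ^ 7)" using mp by (simp add: field_simps)
        also have "C8 / Kc ^ 7 = X / (4096 * Z)" unfolding Kc7 using X C8 Z by (simp add: field_simps)
        finally have "1024 * Z * (W / m) \<le> 1024 * Z * (Kc * R + R\<^sup>2 * (X / (4096 * Z)))" using Z by (intro mult_left_mono) auto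
        also have "\<dots> = 1024 * Z * Kc * R + X / 4 * R\<^sup>2" using Z by (simp add: field_simps)
        finally show ?thesis .
      qed
      have s9: "4096 * Z * (R\<^sup>2 / L) \<le> X / 4 * R\<^sup>2"
      proof -
        have "K1 \<le> L powr (1/2)"
        proof (rule powr_ge_const)
          have "K1 powr 2 \<le> real L0" unfolding L0_def by linarith
          also have "\<dots> \<le> real L" using L by simp
          finally show "K1 powr (1 / (1/2)) \<le> real L" by simp
          show "0 \<le> K1" using Z C by (simp add: K1_def)
        qed (use Lp in auto)
        also have "\<dots> \<le> L powr (1 - 21/5000)" using L8 by (intro powr_mono) auto
        finally have k1: "16384 * Z * (2 * C) powr (21/10) \<le> L powr (1 - 21/5000)" by (simp add: K1_def)
        have "(L powr (-1/1000))\<^sup>2 / (2 * C) \<le> \<mu>" unfolding \<mu>_def using lam C by (intro divide_right_mono power_mono) auto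
        then have "((L powr (-1/1000))\<^sup>2 / (2 * C)) powr (21/10) \<le> X" unfolding X_def using C by (intro powr_mono2) auto
        moreover have "((L powr (-1/1000))\<^sup>2 / (2 * C)) powr (21/10) = L powr (- 21/5000) / (2 * C) powr (21/10)"
          using Lp C by (simp add: powr_divide powr_powr flip: powr_numeral)
        ultimately have "L powr (- 21/5000) / (2 * C) powr (21/10) \<le> X" by (simp only:)
        moreover have "(2 * C) powr (21/10) > 0" using C by simp
        ultimately have "L powr (- 21/5000) \<le> X * (2 * C) powr (21/10)" by (simp only: pos_divide_le_eq)
        then have "16384 * Z * L powr (- 21/5000) \<le> 16384 * Z * (X * (2 * C) powr (21/10))" using Z by (intro mult_left_mono) auto
        also have "\<dots> = X * (16384 * Z * (2 * C) powr (21/10))" by simp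
        also have "\<dots> \<le> X * L powr (1 - 21/5000)" using k1 X by (intro mult_left_mono) auto
        also have "L powr (1 - 21/5000) = L * L powr (- 21/5000)"
        proof -
          have "L * L powr (- 21/5000) = L powr 1 * L powr (- 21/5000)" by simp
          also have "\<dots> = L powr (1 - 21/5000)" by (subst powr_add[symmetric]) simp
          finally show ?thesis by simp
        qed
        finally have "16384 * Z * L powr (- 21/5000) \<le> X * L * L powr (- 21/5000)" by (simp add: mult_ac)
        then have "16384 * Z \<le> X * L" using Lp by (simp only: mult_le_cancel_right_pos powr_gt_zero less_imp_neq[symmetric] simp_thms)
        then have "4096 * Z / L \<le> X / 4" using Lp by (simp add: field_simps)
        then have "4096 * Z / L * R\<^sup>2 \<le> X / 4 * R\<^sup>2" by (intro mult_right_mono) auto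
        then show ?thesis by simp
      qed
      \<comment> \<open>Two quarters are absorbed on the left, leaving R = O(Kc / X) = O(X^(-8/7)).
        As X is a constant times \<eta>^(21/5), the exponent of \<eta> is -24/5.\<close>
      have "X * R\<^sup>2 \<le> X / 4 * R\<^sup>2 + 1024 * Z * Kc * R + X / 4 * R\<^sup>2"
        using s5 s6 s8 s9 by linarith
      then have "X * R * R \<le> 2048 * Z * Kc * R" by (simp add: power2_eq_square algebra_simps)
      then have "X * R \<le> 2048 * Z * Kc" using R by simp
      then have "R \<le> 2048 * Z * (Kc / X)" using X by (simp add: field_simps)
      also have "Kc / X = (4096 * Z * C8) powr (1/7) * X powr (- 8/7)"
      proof -
        have "Kc = (4096 * Z * C8) powr (1/7) * X powr (- 1/7)"
          unfolding Kc_def using Z C8 X by (simp add: powr_divide powr_minus_divide)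
        moreover have "1 / X = X powr (-1)" using X by (simp add: powr_minus_divide)
        moreover have "X powr (- 1/7) * X powr (-1) = X powr (- 8/7)" by (subst powr_add[symmetric]) simp
        ultimately show ?thesis by (metis mult.assoc mult.right_neutral times_divide_eq_right)
      qed
      also have "X powr (- 8/7) = \<eta> powr (- 24/5) * (2 * C) powr (24/10)"
      proof -
        have "X powr (- 8/7) = (\<eta> powr 2 / (2 * C)) powr (- 24/10)" using lp by (simp add: X_def \<mu>_def powr_powr)
        also have "\<dots> = (\<eta> powr 2) powr (- 24/10) / (2 * C) powr (- 24/10)"
          using C by (subst powr_divide) auto
        also have "\<dots> = \<eta> powr (- 24/5) * (2 * C) powr (24/10)" using C by (simp add: powr_powr powr_minus_divide)
        finally show ?thesis .
      qed
      finally show ?thesis by (simp add: R_def C'_def mult_ac)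
    qed
  qed
qed

section \<open>From level sets to a moment of order 49/10\<close>

lemma dyadic_level:
  fixes x :: real
  assumes "0 < x" "x \<le> 1"
  obtains j where "(1/2) ^ Suc j \<le> x" "x \<le> (1/2) ^ j"
proof -
  obtain n where n: "(1/2) ^ n < x" using real_arch_pow_inv[of x "1/2"] assms by auto
  define k where "k = (LEAST n. (1/2) ^ n \<le> x)"
  have k: "(1/2) ^ k \<le> x" unfolding k_def by (rule LeastI[of _ n]) (use n in simp)
  show ?thesis
  proof (cases k)
    case 0
    then show ?thesis using k assms by (intro that[of 0]) auto
  next
    case (Suc j)
    have "\<not> (1/2) ^ j \<le> x" using not_less_Least[of j "\<lambda>n. (1/2) ^ n \<le> x"] Suc by (simp add: k_def)
    then show ?thesis using k Suc by (intro that[of j]) auto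
  qed
qed

text \<open>The level 2^(-j) contributes O(2^(24j/5 - 49j/10)) = O(2^(-j/10)), a convergent series.
  Below L^(-1/1000) the level sets are not controlled; there the surplus 9/10 over the fourth power
  gains L^(-9/10000), more than the loss L^(1/5000) in the fourth moment.\<close>

theorem restriction_Lp:
  assumes C: "C \<ge> 1"
  shows "\<exists>C'>0. \<exists>L0::nat. \<forall>L m \<phi> c. L \<ge> L0 \<longrightarrow> L\<^sup>2 \<le> m \<longrightarrow> major_arc_bounded C L m \<phi> \<longrightarrow> (\<forall>t<L. cmod (c t) \<le> 1)
      \<longrightarrow> (\<Sum>a\<in>{0..<int m}. (cmod (\<Sum>t<L. c t * ef m (a * \<phi> t))) ^ 4) \<le> real L powr (4 + 1/5000)
      \<longrightarrow> (\<Sum>a\<in>{0..<int m}. (cmod (\<Sum>t<L. c t * ef m (a * \<phi> t)) / L) powr (49/10)) \<le> C'"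
proof -
  obtain C1 and L1 :: nat where C1: "C1 > 0" and L1:
    "\<forall>L m \<phi> c \<eta> S. L \<ge> L1 \<longrightarrow> L\<^sup>2 \<le> m \<longrightarrow> major_arc_bounded C L m \<phi> \<longrightarrow> (\<forall>t<L. cmod (c t) \<le> 1)
      \<longrightarrow> S \<subseteq> {0..<int m} \<longrightarrow> \<eta> \<ge> real L powr (- 1/1000)
      \<longrightarrow> (\<forall>a\<in>S. cmod (\<Sum>t<L. c t * ef m (a * \<phi> t)) \<ge> \<eta> * L)
      \<longrightarrow> card S \<le> C1 * \<eta> powr (- 24/5)"
    using restriction_levels[OF C] by (elim exE conjE)
  define \<rho> where "\<rho> = (1/2::real) powr (1/10)"
  have rho: "0 < \<rho>" "\<rho> < 1" using powr_less_mono'[of "1/2::real" 0 "1/10"] by (auto simp: \<rho>_def)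
  define C' where "C' = C1 * 32 * (1 / (1 - \<rho>)) + 1"
  show ?thesis
  proof (intro exI[of _ C'] conjI exI[of _ "L1 + 1"] allI impI)
    show "C' > 0" using C1 rho by (simp add: C'_def add_pos_pos)
    fix L m \<phi> c
    assume L: "L \<ge> L1 + 1" and m: "L\<^sup>2 \<le> m" and mab: "major_arc_bounded C L m \<phi>"
      and c: "\<forall>t<L. cmod (c t) \<le> 1"
      and four: "(\<Sum>a\<in>{0..<int m}. (cmod (\<Sum>t<L. c t * ef m (a * \<phi> t))) ^ 4) \<le> real L powr (4 + 1/5000)"
    define \<alpha> where "\<alpha> a = cmod (\<Sum>t<L. c t * ef m (a * \<phi> t)) / L" for a
    have Lp: "real L > 0" using L by simp
    have a1: "\<alpha> a \<le> 1" for a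
    proof -
      have "cmod (\<Sum>t<L. c t * ef m (a * \<phi> t)) \<le> (\<Sum>t<L. 1)"
        by (rule sum_norm_le) (use c in \<open>simp add: norm_mult\<close>)
      then show ?thesis using Lp by (simp add: \<alpha>_def)
    qed
    have a0: "\<alpha> a \<ge> 0" for a by (simp add: \<alpha>_def)
    define T where "T = real L powr (- 1/1000)"
    have T: "T > 0" using Lp by (simp add: T_def)
    obtain J where J: "(1/2) ^ J < T" using real_arch_pow_inv[of T "1/2"] T by auto
    \<comment> \<open>Levels are cut off at T, where the estimate for level sets ceases to hold; J
      levels reach down to T.\<close>
    define lam where "lam j = max T ((1/2) ^ Suc j)" for j
    define S where "S j = {a\<in>{0..<int m}. \<alpha> a \<ge> lam j}" for j
    have cS: "real (card (S j)) \<le> C1 * 32 * ((1/2) ^ j) powr (- 24/5)" for j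
    proof -
      have "real (card (S j)) \<le> C1 * lam j powr (- 24/5)"
      proof (rule L1[rule_format, OF _ m mab c[rule_format]])
        show "L \<ge> L1" using L by simp
        show "S j \<subseteq> {0..<int m}" by (auto simp: S_def)
        show "lam j \<ge> real L powr (- 1/1000)" by (simp add: lam_def T_def)
        show "lam j * real L \<le> cmod (\<Sum>t<L. c t * ef m (a * \<phi> t))" if "a \<in> S j" for a
          using that Lp by (simp add: S_def \<alpha>_def field_simps)
      qed
      also have "lam j powr (- 24/5) \<le> ((1/2) ^ Suc j) powr (- 24/5)"
        by (intro powr_mono2') (auto simp: lam_def)
      also have "((1/2) ^ Suc j) powr (- 24/5) = (1/2) powr (- 24/5) * ((1/2::real) ^ j) powr (- 24/5)"
        by (simp only: power_Suc powr_mult)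
      also have "(1/2::real) powr (- 24/5) \<le> (1/2) powr (- 5)" by (rule powr_mono') auto
      also have "(1/2::real) powr (- 5) = 32" by (simp add: powr_minus power_divide)
      finally show ?thesis using C1 by (simp add: mult_ac)
    qed
    have point: "\<alpha> a powr (49/10) \<le> (\<Sum>j<J. if \<alpha> a \<ge> lam j then ((1/2::real) ^ j) powr (49/10) else 0) + T powr (9/10) * \<alpha> a ^ 4" for a
    proof (cases "\<alpha> a \<ge> T")
      case True
      then obtain j where j: "(1/2) ^ Suc j \<le> \<alpha> a" "\<alpha> a \<le> (1/2) ^ j"
        using dyadic_level[of "\<alpha> a"] T a1[of a] by (metis less_le_trans)
      have "j < J"
      proof (rule ccontr)
        assume "\<not> j < J"
        then have "(1/2::real) ^ j \<le> (1/2) ^ J" by (intro power_decreasing) auto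
        then show False using J True j by linarith
      qed
      have "\<alpha> a powr (49/10) \<le> (if \<alpha> a \<ge> lam j then ((1/2::real) ^ j) powr (49/10) else 0)"
        using j True a0 by (auto simp: lam_def intro!: powr_mono2)
      also have "\<dots> \<le> (\<Sum>j<J. if \<alpha> a \<ge> lam j then ((1/2::real) ^ j) powr (49/10) else 0)"
        using \<open>j < J\<close> by (intro member_le_sum[where f = "\<lambda>j. if \<alpha> a \<ge> lam j then ((1/2::real) ^ j) powr (49/10) else 0"]) auto
      finally show ?thesis using a0[of a] by (smt (verit) mult_nonneg_nonneg powr_ge_zero zero_le_power)
    next
      case False
      have "\<alpha> a powr (49/10) \<le> T powr (9/10) * \<alpha> a ^ 4"
      proof (cases "\<alpha> a = 0")
        case False
        have "\<alpha> a powr (49/10) = \<alpha> a powr (9/10) * \<alpha> a powr 4" by (subst powr_add[symmetric]) simp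
        also have "\<alpha> a powr 4 = \<alpha> a ^ 4" using False a0[of a] by simp
        also have "\<alpha> a powr (9/10) * \<alpha> a ^ 4 \<le> T powr (9/10) * \<alpha> a ^ 4"
          using \<open>\<not> \<alpha> a \<ge> T\<close> a0[of a] by (intro mult_right_mono powr_mono2) auto
        finally show ?thesis .
      qed simp
      moreover have "(\<Sum>j<J. if \<alpha> a \<ge> lam j then ((1/2::real) ^ j) powr (49/10) else 0) \<ge> 0" by (intro sum_nonneg) auto
      ultimately show ?thesis by linarith
    qed
    have "(\<Sum>a\<in>{0..<int m}. \<alpha> a powr (49/10)) \<le> (\<Sum>a\<in>{0..<int m}. (\<Sum>j<J. if \<alpha> a \<ge> lam j then ((1/2::real) ^ j) powr (49/10) else 0) + T powr (9/10) * \<alpha> a ^ 4)"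
      by (intro sum_mono point)
    also have "\<dots> = (\<Sum>j<J. \<Sum>a\<in>{0..<int m}. if \<alpha> a \<ge> lam j then ((1/2::real) ^ j) powr (49/10) else 0) + T powr (9/10) * (\<Sum>a\<in>{0..<int m}. \<alpha> a ^ 4)"
      by (simp only: sum.distrib sum_distrib_left) (subst sum.swap, rule refl)
    also have "\<dots> \<le> C1 * 32 * (1 / (1 - \<rho>)) + 1"
    proof (intro add_mono)
      have "(\<Sum>j<J. \<Sum>a\<in>{0..<int m}. if \<alpha> a \<ge> lam j then ((1/2::real) ^ j) powr (49/10) else 0) = (\<Sum>j<J. real (card (S j)) * ((1/2::real) ^ j) powr (49/10))"
        by (intro sum.cong refl) (simp add: S_def sum.inter_filter[symmetric])
      also have "\<dots> \<le> (\<Sum>j<J. C1 * 32 * ((1/2) ^ j) powr (- 24/5) * ((1/2::real) ^ j) powr (49/10))"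
        by (intro sum_mono mult_right_mono cS) auto
      also have "\<dots> = (\<Sum>j<J. C1 * 32 * \<rho> ^ j)"
      proof (intro sum.cong refl)
        fix j
        have "((1/2) ^ j) powr (- 24/5) * ((1/2::real) ^ j) powr (49/10) = ((1/2::real) ^ j) powr (1/10)"
          by (subst powr_add[symmetric]) simp
        also have "\<dots> = \<rho> ^ j" by (simp add: \<rho>_def powr_power powr_realpow[symmetric] powr_powr)
        finally show "C1 * 32 * ((1/2) ^ j) powr (- 24/5) * ((1/2::real) ^ j) powr (49/10) = C1 * 32 * \<rho> ^ j" by (simp only: mult.assoc)
      qed
      also have "\<dots> = C1 * 32 * ((1 - \<rho> ^ J) / (1 - \<rho>))"
        using rho by (simp add: sum_gp_strict flip: sum_distrib_left)
      also have "\<dots> \<le> C1 * 32 * (1 / (1 - \<rho>))"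
        using C1 rho by (intro mult_left_mono divide_right_mono) auto
      finally show "(\<Sum>j<J. \<Sum>a\<in>{0..<int m}. if \<alpha> a \<ge> lam j then ((1/2::real) ^ j) powr (49/10) else 0) \<le> C1 * 32 * (1 / (1 - \<rho>))" .
      have "(\<Sum>a\<in>{0..<int m}. \<alpha> a ^ 4) = (\<Sum>a\<in>{0..<int m}. (cmod (\<Sum>t<L. c t * ef m (a * \<phi> t))) ^ 4) / real L ^ 4"
        by (simp add: \<alpha>_def power_divide sum_divide_distrib)
      also have "\<dots> \<le> L powr (4 + 1/5000) / real L ^ 4" using four by (intro divide_right_mono) auto
      also have "\<dots> = L powr (4 + 1/5000) / L powr 4" using Lp by simp
      also have "\<dots> = L powr (1/5000)" by (subst powr_diff[symmetric]) simp
      finally have "T powr (9/10) * (\<Sum>a\<in>{0..<int m}. \<alpha> a ^ 4) \<le> T powr (9/10) * L powr (1/5000)" by (intro mult_left_mono) auto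
      also have "\<dots> = L powr (- 7/10000)" unfolding T_def using Lp by (simp add: powr_powr powr_add[symmetric])
      also have "\<dots> \<le> L powr 0" using L by (intro powr_mono) auto
      finally show "T powr (9/10) * (\<Sum>a\<in>{0..<int m}. \<alpha> a ^ 4) \<le> 1" using Lp by simp
    qed
    finally show "(\<Sum>a\<in>{0..<int m}. (cmod (\<Sum>t<L. c t * ef m (a * \<phi> t)) / L) powr (49/10)) \<le> C'"
      by (simp add: \<alpha>_def C'_def)
  qed
qed

section \<open>Fourth moments\<close>

lemma sum_ef_quad: "(\<Sum>t<n. ef m (a * quad u v t)) = weyl_sum u v n (of_int a / of_nat m)"
  by (simp add: weyl_sum_def ef_def)

lemma quad_diff: "quad u v s - quad u v t = (int s - int t) * (u + v * (int s + int t))"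
  by (simp add: quad_def power2_eq_square algebra_simps)

lemma quad_nonneg: "u \<ge> 0 \<Longrightarrow> v \<ge> 0 \<Longrightarrow> quad u v t \<ge> 0"
  by (simp add: quad_def)

lemma quad_inj: "u \<ge> 0 \<Longrightarrow> v \<ge> 1 \<Longrightarrow> quad u v s = quad u v t \<Longrightarrow> s = t"
proof (rule ccontr)
  assume a: "u \<ge> 0" "v \<ge> 1" "quad u v s = quad u v t" "s \<noteq> t"
  then have "v * (int s + int t) > 0" by (intro mult_pos_pos) auto
  then have "u + v * (int s + int t) > 0" using a by linarith
  moreover have "(int s - int t) * (u + v * (int s + int t)) = 0" using a quad_diff[of u v s t] by simp
  ultimately show False using a by auto
qed

text \<open>The difference is (s - t)(u + v (s + t)) with positive second factor. So |s - t| is a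
  divisor of |z|; the sign of s - t is that of z, and then s + t is determined as well.\<close>

lemma card_quad_diff:
  assumes u: "u \<ge> 0" and v: "v \<ge> 1" and z: "z \<noteq> 0"
  shows "card {(s, t). s < L \<and> t < L \<and> quad u v s - quad u v t = z} \<le> card {d. d dvd nat \<bar>z\<bar>}"
proof -
  have pos: "u + v * (int s + int t) > 0" if "quad u v s - quad u v t = z" for s t
  proof -
    have "s \<noteq> t" using that z by auto
    then have "v * (int s + int t) > 0" using v by (intro mult_pos_pos) auto
    then show ?thesis using u by linarith
  qed
  have inj: "inj_on (\<lambda>(s, t). nat \<bar>int s - int t\<bar>) {(s, t). s < L \<and> t < L \<and> quad u v s - quad u v t = z}"
  proof (rule inj_onI)
    fix x y :: "nat \<times> nat"
    assume xy: "x \<in> {(s, t). s < L \<and> t < L \<and> quad u v s - quad u v t = z}" "y \<in> {(s, t). s < L \<and> t < L \<and> quad u v s - quad u v t = z}"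
      "(\<lambda>(s, t). nat \<bar>int s - int t\<bar>) x = (\<lambda>(s, t). nat \<bar>int s - int t\<bar>) y"
    obtain s t s' t' where st: "x = (s, t)" "y = (s', t')" by (cases x, cases y) auto
    have a: "\<bar>int s - int t\<bar> = \<bar>int s' - int t'\<bar>" "z = quad u v s - quad u v t"
      and b: "quad u v s' - quad u v t' = z"
      using xy by (auto simp: st)
    define k where "k = u + v * (int s + int t)"
    define k' where "k' = u + v * (int s' + int t')"
    have k: "k > 0" "k' > 0" using pos a b by (auto simp: k_def k'_def)
    have e: "(int s - int t) * k = z" "(int s' - int t') * k' = z"
      using a b by (simp_all add: k_def k'_def quad_diff)
    have "int s - int t = int s' - int t'"
    proof (rule ccontr)
      assume ne: "int s - int t \<noteq> int s' - int t'"
      then have neg: "int s' - int t' = - (int s - int t)" using a(1) by linarith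
      have "(int s - int t) * k = - ((int s - int t) * k')" using e by (simp add: neg algebra_simps)
      then have "(int s - int t) * (k + k') = 0" by (simp add: algebra_simps)
      then have "int s - int t = 0" using k by simp
      then show False using e z by simp
    qed
    then have d: "int s - int t = int s' - int t'" "int s - int t \<noteq> 0" using e z by auto
    then have "k = k'" using e by (metis mult_cancel_left)
    then have "v * (int s + int t) = v * (int s' + int t')" by (simp add: k_def k'_def)
    then have "int s + int t = int s' + int t'" using v by simp
    then have "s = s' \<and> t = t'" using d by linarith
    then show "x = y" by (simp add: st)
  qed
  have img: "(\<lambda>(s, t). nat \<bar>int s - int t\<bar>) ` {(s, t). s < L \<and> t < L \<and> quad u v s - quad u v t = z} \<subseteq> {d. d dvd nat \<bar>z\<bar>}"
  proof
    fix x :: nat assume "x \<in> (\<lambda>(s, t). nat \<bar>int s - int t\<bar>) ` {(s, t). s < L \<and> t < L \<and> quad u v s - quad u v t = z}"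
    then obtain s t where x: "x = nat \<bar>int s - int t\<bar>" "z = quad u v s - quad u v t" by auto
    then have "\<bar>int s - int t\<bar> dvd \<bar>z\<bar>" by (simp add: quad_diff)
    then show "x \<in> {d. d dvd nat \<bar>z\<bar>}" by (simp add: x(1) nat_dvd_iff)
  qed
  have "finite {d. d dvd nat \<bar>z\<bar>}" using z by (intro finite_divisors_nat) simp
  from card_inj_on_le[OF inj img this] show ?thesis .
qed

text \<open>As all values lie in [0, m), a congruence between sums of two values is an equation up
  to j m with |j| \<le> 1. Fixing the second entries of both pairs leaves a difference equation for
  the first entries, which has few solutions unless its right side vanishes; that happens only for
  equal second entries and j = 0.\<close>

lemma additive_energy_quad:
  fixes u v :: int and L m D :: nat
  assumes u: "u \<ge> 0" and v: "v \<ge> 1" and lt: "\<And>t. t < L \<Longrightarrow> quad u v t < int m"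
    and D: "\<And>n. 1 \<le> n \<Longrightarrow> n \<le> 2 * m \<Longrightarrow> card {d. d dvd n} \<le> D" and D1: "D \<ge> 1"
  defines "I \<equiv> {..<L} \<times> {..<L}" and "k \<equiv> \<lambda>(s, t). quad u v s + quad u v t"
  shows "card {(p, q). p \<in> I \<and> q \<in> I \<and> int m dvd k p - k q} \<le> 4 * D * L\<^sup>2"
proof -
  define A where "A z = {(s, t). s < L \<and> t < L \<and> quad u v s - quad u v t = z}" for z
  have finA: "finite (A z)" for z
    by (rule finite_subset[of _ "{..<L} \<times> {..<L}"]) (auto simp: A_def)
  define \<zeta> where "\<zeta> x j = quad u v (snd x) - quad u v (fst x) + j * int m" for x :: "nat \<times> nat" and j :: int
  have rng: "0 \<le> quad u v t" "quad u v t < int m" if "t < L" for t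
    using lt[OF that] quad_nonneg u v by auto
  have cA0: "card (A 0) \<le> L"
  proof -
    have "A 0 \<subseteq> (\<lambda>s. (s, s)) ` {..<L}" using quad_inj[OF u v] by (auto simp: A_def)
    then have "card (A 0) \<le> card {..<L}" by (intro surj_card_le) auto
    then show ?thesis by simp
  qed
  have sub: "{(p, q). p \<in> I \<and> q \<in> I \<and> int m dvd k p - k q} \<subseteq>
    (\<Union>x\<in>I. \<Union>j\<in>{-1, 0, 1}. (\<lambda>y. ((fst y, fst x), (snd y, snd x))) ` A (\<zeta> x j))"
  proof clarify
    fix a b c d assume ab: "(a, b) \<in> I" "(c, d) \<in> I" "int m dvd k (a, b) - k (c, d)"
    then have lt: "a < L" "b < L" "c < L" "d < L" by (auto simp: I_def)
    obtain j where j: "k (a, b) - k (c, d) = int m * j" using ab by (auto simp: dvd_def)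
    have "\<bar>int m * j\<bar> < int m * 2" using j rng[OF lt(1)] rng[OF lt(2)] rng[OF lt(3)] rng[OF lt(4)] by (simp add: k_def)
    then have "int m * \<bar>j\<bar> < int m * 2" by (simp add: abs_mult)
    then have "\<bar>j\<bar> < 2" by (simp only: mult_less_cancel_left split: if_splits)
    then have j1: "j \<in> {-1, 0, 1}" by auto
    have "(a, c) \<in> A (\<zeta> (b, d) j)" using lt j by (simp add: A_def \<zeta>_def k_def algebra_simps)
    then show "((a, b), (c, d)) \<in> (\<Union>x\<in>I. \<Union>j\<in>{-1, 0, 1}. (\<lambda>y. ((fst y, fst x), (snd y, snd x))) ` A (\<zeta> x j))"
      using ab j1 by (intro UN_I[of "(b, d)"] UN_I[of j]) (auto simp: I_def intro: image_eqI[of _ _ "(a, c)"])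
  qed
  have each: "card (A (\<zeta> x j)) \<le> D + (if \<zeta> x j = 0 then L else 0)" if "x \<in> I" "j \<in> {-1, 0, 1}" for x j
  proof (cases "\<zeta> x j = 0")
    case True then show ?thesis using cA0 by simp
  next
    case False
    have "fst x < L" "snd x < L" using that by (auto simp: I_def)
    then have "\<bar>\<zeta> x j\<bar> \<le> 2 * int m" using rng[of "fst x"] rng[of "snd x"] that(2) by (auto simp: \<zeta>_def)
    then have "card {d. d dvd nat \<bar>\<zeta> x j\<bar>} \<le> D" using False by (intro D) auto
    then show ?thesis using card_quad_diff[OF u v False, of L] False by (simp add: A_def)
  qed
  have zero: "(\<Sum>j\<in>{-1, 0, 1}. if \<zeta> x j = 0 then L else 0) \<le> (if fst x = snd x then L else 0)" if "x \<in> I" for x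
  proof -
    have "fst x < L" "snd x < L" using that by (auto simp: I_def)
    then have r: "0 \<le> quad u v (fst x)" "quad u v (fst x) < int m" "0 \<le> quad u v (snd x)" "quad u v (snd x) < int m"
      using rng by auto
    have "\<zeta> x (-1) \<noteq> 0" "\<zeta> x 1 \<noteq> 0" using r by (auto simp: \<zeta>_def)
    moreover have "\<zeta> x 0 = 0 \<Longrightarrow> fst x = snd x" using quad_inj[OF u v] by (auto simp: \<zeta>_def)
    ultimately show ?thesis by auto
  qed
  have finI: "finite I" by (simp add: I_def)
  have "card {(p, q). p \<in> I \<and> q \<in> I \<and> int m dvd k p - k q} \<le>
    card (\<Union>x\<in>I. \<Union>j\<in>{-1, 0, 1}. (\<lambda>y. ((fst y, fst x), (snd y, snd x))) ` A (\<zeta> x j))"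
    using sub finA finI by (intro card_mono) auto
  also have "\<dots> \<le> (\<Sum>x\<in>I. card (\<Union>j\<in>{-1, 0, 1}. (\<lambda>y. ((fst y, fst x), (snd y, snd x))) ` A (\<zeta> x j)))"
    by (rule card_UN_le[OF finI])
  also have "\<dots> \<le> (\<Sum>x\<in>I. \<Sum>j\<in>{-1, 0, 1}. card ((\<lambda>y. ((fst y, fst x), (snd y, snd x))) ` A (\<zeta> x j)))"
    by (intro sum_mono card_UN_le) auto
  also have "\<dots> \<le> (\<Sum>x\<in>I. \<Sum>j\<in>{-1, 0, 1}. D + (if \<zeta> x j = 0 then L else 0))"
    by (intro sum_mono order.trans[OF card_image_le each] finA)
  also have "\<dots> = (\<Sum>x\<in>I. 3 * D + (\<Sum>j\<in>{-1, 0, 1}. if \<zeta> x j = 0 then L else 0))"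
    by (intro sum.cong refl) (simp add: sum.distrib)
  also have "\<dots> \<le> (\<Sum>x\<in>I. 3 * D + (if fst x = snd x then L else 0))"
    by (intro sum_mono add_left_mono zero)
  also have "\<dots> = L * L * (3 * D) + (\<Sum>x\<in>{x\<in>I. fst x = snd x}. L)"
    unfolding sum.distrib sum.inter_filter[OF finI, symmetric] by (simp add: I_def card_cartesian_product)
  also have "{x\<in>I. fst x = snd x} = (\<lambda>s. (s, s)) ` {..<L}" by (auto simp: I_def)
  also have "(\<Sum>x\<in>(\<lambda>s. (s, s)) ` {..<L}. L) = L * L" by (simp add: card_image inj_on_def)
  also have "L * L * (3 * D) + L * L \<le> 4 * D * L\<^sup>2"
    using D1 by (simp add: power2_eq_square algebra_simps)
  finally show ?thesis .
qed

text \<open>Parseval for the square of the sum. The divisor exponent 1/20000 gives D =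
  O(L^(1/10000)), since m is at most of order L^2; a second factor L^(1/10000) absorbs the
  constants.\<close>

lemma fourth_moment:
  assumes V: "V \<ge> (1::real)"
  shows "\<exists>L0::nat. \<forall>L m u v c. L \<ge> L0 \<longrightarrow> 0 \<le> u \<longrightarrow> 1 \<le> v \<longrightarrow> (\<forall>t<L. quad u v t < int m) \<longrightarrow> real m \<le> V * (real L)\<^sup>2
    \<longrightarrow> (\<forall>t<L. cmod (c t) \<le> 1) \<longrightarrow>
    (\<Sum>a\<in>{0..<int m}. (cmod (\<Sum>t<L. c t * ef m (a * quad u v t))) ^ 4) \<le> real L powr (4 + 1/5000)"
proof -
  obtain C where C: "C > 0" "\<And>n. n \<ge> 1 \<Longrightarrow> real (card {d. d dvd n}) \<le> C * real n powr (1/20000)"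
    by (rule divisor_bound[of "1/20000"]) auto
  define G where "G = C * (2 * V) powr (1/20000) + 2"
  define K where "K = V * 4 * G"
  have K: "K \<ge> 0" using V C by (simp add: K_def G_def)
  define L0 where "L0 = nat \<lceil>K powr (1 / (1/10000))\<rceil> + 1"
  show ?thesis
  proof (intro exI[of _ L0] allI impI)
    fix L m :: nat and u v :: int and c :: "nat \<Rightarrow> complex"
    assume L: "L0 \<le> L" and u: "0 \<le> u" and v: "1 \<le> v" and lt: "\<forall>t<L. quad u v t < int m" and m: "real m \<le> V * (real L)\<^sup>2"
      and c: "\<forall>t<L. cmod (c t) \<le> 1"
    have Lp: "L \<ge> 1" using L by (simp add: L0_def)
    have m1: "m \<ge> 1"
    proof -
      have "quad u v 0 < int m" using lt Lp by auto
      then show ?thesis by (simp add: quad_def)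
    qed
    define Dr where "Dr = C * real (2 * m) powr (1/20000)"
    define D where "D = nat \<lceil>Dr\<rceil> + 1"
    have Dr0: "Dr \<ge> 0" using C by (simp add: Dr_def)
    have D: "card {d. d dvd n} \<le> D" if n: "1 \<le> n" "n \<le> 2 * m" for n
    proof -
      have "real (card {d. d dvd n}) \<le> C * real n powr (1/20000)" by (rule C(2)[OF n(1)])
      also have "\<dots> \<le> Dr" unfolding Dr_def using n C by (intro mult_left_mono powr_mono2) auto
      also have "\<dots> \<le> real D" unfolding D_def by linarith
      finally show ?thesis by simp
    qed
    have Dle: "real D \<le> G * L powr (1/10000)"
    proof -
      have "real (2 * m) \<le> (2 * V) * (real L)\<^sup>2" using m by simp
      then have "real (2 * m) powr (1/20000) \<le> ((2 * V) * (real L)\<^sup>2) powr (1/20000)" by (intro powr_mono2) auto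
      also have "\<dots> = (2 * V) powr (1/20000) * ((real L)\<^sup>2) powr (1/20000)" by (rule powr_mult)
      also have "((real L)\<^sup>2) powr (1/20000) = L powr (1/10000)" using Lp by (simp add: powr_powr flip: powr_numeral)
      finally have "Dr \<le> C * (2 * V) powr (1/20000) * L powr (1/10000)" unfolding Dr_def using C by (simp add: mult.assoc)
      moreover have "real D \<le> Dr + 2" using Dr0 unfolding D_def by linarith
      moreover have "L powr (1/10000) \<ge> 1" using Lp by (simp add: ge_one_powr_ge_zero)
      ultimately show ?thesis by (simp add: G_def distrib_right)
    qed
    define I where "I = {..<L} \<times> {..<L}"
    define k where "k = (\<lambda>(s, t). quad u v s + quad u v t)"
    define cc where "cc p = c (fst p) * c (snd p)" for p
    have sq: "(\<Sum>t<L. c t * ef m (a * quad u v t)) * (\<Sum>t<L. c t * ef m (a * quad u v t)) = (\<Sum>p\<in>I. cc p * ef m (a * k p))" for a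
      by (simp add: sum_product I_def sum.cartesian_product k_def cc_def case_prod_unfold distrib_left ef_add mult_ac)
    have "(\<Sum>a\<in>{0..<int m}. (cmod (\<Sum>t<L. c t * ef m (a * quad u v t))) ^ 4) = (\<Sum>a\<in>{0..<int m}. (cmod (\<Sum>p\<in>I. cc p * ef m (a * k p)))\<^sup>2)"
      by (intro sum.cong refl) (simp add: sq[symmetric] norm_mult power2_eq_square eval_nat_numeral)
    also have "\<dots> \<le> m * card {(p, q). p \<in> I \<and> q \<in> I \<and> int m dvd k p - k q}"
    proof (rule parseval_le)
      fix p assume "p \<in> I"
      then have "cmod (c (fst p)) \<le> 1" "cmod (c (snd p)) \<le> 1" using c by (auto simp: I_def)
      then show "cmod (cc p) \<le> 1" by (simp add: cc_def norm_mult mult_le_one)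
    qed (use m1 in \<open>auto simp: I_def\<close>)
    also have "real (m * card {(p, q). p \<in> I \<and> q \<in> I \<and> int m dvd k p - k q}) \<le> real (m * (4 * D * L\<^sup>2))"
      unfolding of_nat_le_iff
      using additive_energy_quad[OF u v _ D, of L] lt by (intro mult_left_mono) (auto simp: I_def k_def D_def)
    also have "\<dots> = real m * (4 * real D * (real L)\<^sup>2)" by simp
    also have "\<dots> \<le> (V * (real L)\<^sup>2) * (4 * (G * L powr (1/10000)) * (real L)\<^sup>2)"
      using m Dle V by (intro mult_mono) auto
    also have "\<dots> = K * L powr (1/10000) * L powr 4"
    proof -
      have "L powr 4 = (real L)\<^sup>2 * (real L)\<^sup>2" using Lp by (simp add: power4_eq_xxxx power2_eq_square)
      then show ?thesis by (simp add: K_def mult_ac)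
    qed
    also have "\<dots> \<le> L powr (1/10000) * L powr (1/10000) * L powr 4"
    proof (intro mult_right_mono)
      show "K \<le> L powr (1/10000)"
      proof (rule powr_ge_const)
        have "K powr (1 / (1/10000)) \<le> real L0" unfolding L0_def by linarith
        also have "\<dots> \<le> real L" using L by simp
        finally show "K powr (1 / (1/10000)) \<le> real L" .
      qed (use K Lp in auto)
    qed auto
    also have "\<dots> = L powr (4 + 1/5000)" by (simp only: powr_add[symmetric]) simp
    finally show "(\<Sum>a\<in>{0..<int m}. (cmod (\<Sum>t<L. c t * ef m (a * quad u v t))) ^ 4) \<le> real L powr (4 + 1/5000)" .
  qed
qed

lemma powr_weight_compare:
  fixes x y K :: real
  assumes "0 < x" "y \<le> K * x" "K \<ge> 1" "0 < y"
  shows "x powr (- 12/25) \<le> K * y powr (- 12/25)"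
proof -
  have "(K * x) powr (- 12/25) \<le> y powr (- 12/25)" using assms by (intro powr_mono2') auto
  then have "K powr (- 12/25) * x powr (- 12/25) \<le> y powr (- 12/25)" by (simp add: powr_mult)
  moreover have "K powr (-1) \<le> K powr (- 12/25)" using assms by (intro powr_mono) auto
  then have "K powr (-1) * x powr (- 12/25) \<le> K powr (- 12/25) * x powr (- 12/25)" by (intro mult_right_mono) auto
  ultimately have "K powr (-1) * x powr (- 12/25) \<le> y powr (- 12/25)" by linarith
  then show ?thesis using assms by (simp add: powr_minus_divide field_simps)
qed

text \<open>For the squares 2 a/m is approximated by h/q, so a/m by h/(2q); this is where the
  denominator may reach 8 L. Measuring distances in units of 1/m instead of 1/L^2 costs a factor
  V.\<close>

lemma major_arc_bounded_squares:
  assumes V: "V \<ge> (2::real)"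
  shows "\<exists>L0::nat. \<forall>L m. L \<ge> L0 \<longrightarrow> real m \<le> V * (real L)\<^sup>2 \<longrightarrow> 1 \<le> m \<longrightarrow> major_arc_bounded (20 * V) L m (quad 0 1)"
proof (intro exI[of _ "nat \<lceil>(13::real) powr (1 / (24/100))\<rceil> + 1"] allI impI)
  fix L m :: nat
  assume L: "L \<ge> nat \<lceil>(13::real) powr (1 / (24/100))\<rceil> + 1" and m: "real m \<le> V * (real L)\<^sup>2" "1 \<le> m"
  have Lp: "L \<ge> 1" using L by simp
  show "major_arc_bounded (20 * V) L m (quad 0 1)"
    unfolding major_arc_bounded_def
  proof
    fix a :: int
    obtain q h where q: "q \<ge> 1" "q \<le> 4 * L" "coprime h (int q)"
      "\<bar>2 * of_int 1 * (of_int a / real m) - of_int h / real q\<bar> \<le> 1 / (4 * real L * real q)"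
      "\<forall>n\<le>L. cmod (weyl_sum 0 1 n (of_int a / real m))
      \<le> 10 * real L * (q * (1 + (real L)\<^sup>2 * \<bar>2 * of_int 1 * (of_int a / real m) - of_int h / real q\<bar>)) powr (-12/25) + 13 * L powr (3/4)"
      using weyl_bound[OF Lp, of 1 "of_int a / real m" 0] by blast
    define \<beta> where "\<beta> = of_int a / real m - of_int h / real (2 * q)"
    have b2: "2 * of_int 1 * (of_int a / real m) - of_int h / real q = 2 * \<beta>" using q by (simp add: \<beta>_def)
    have qp: "real q \<ge> 1" "real L \<ge> 1" using q Lp by auto
    have b1: "\<bar>\<beta>\<bar> \<le> 1"
    proof -
      have "1 / (4 * real L * real q) \<le> 1 / 1" using qp by (intro divide_left_mono) (auto intro: mult_ge1_I simp: mult_ge1_I)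
      then show ?thesis using q(4) unfolding b2 by (simp add: abs_mult)
    qed
    have cmp: "(q * (1 + (real L)\<^sup>2 * \<bar>2 * \<beta>\<bar>)) powr (-12/25) \<le> (2 * V) * (real (2 * q) * (1 + m * \<bar>\<beta>\<bar>)) powr (- 12/25)"
    proof (rule powr_weight_compare)
      have "m * \<bar>\<beta>\<bar> \<le> V * (real L)\<^sup>2 * \<bar>\<beta>\<bar>" using m by (intro mult_right_mono) auto
      also have "\<dots> \<le> V * ((real L)\<^sup>2 * \<bar>2 * \<beta>\<bar>)" using V by (simp add: abs_mult)
      finally have "1 + m * \<bar>\<beta>\<bar> \<le> V * (1 + (real L)\<^sup>2 * \<bar>2 * \<beta>\<bar>)" using V by (simp add: distrib_left)
      then have "real (2 * q) * (1 + m * \<bar>\<beta>\<bar>) \<le> real (2 * q) * (V * (1 + (real L)\<^sup>2 * \<bar>2 * \<beta>\<bar>))" by (intro mult_left_mono) auto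
      then show "real (2 * q) * (1 + m * \<bar>\<beta>\<bar>) \<le> 2 * V * (q * (1 + (real L)\<^sup>2 * \<bar>2 * \<beta>\<bar>))" by (simp add: mult_ac)
    qed (use V qp in \<open>auto intro!: mult_pos_pos add_pos_nonneg\<close>)
    have small: "13 * L powr (3/4) \<le> L powr (99/100)"
    proof -
      have "13 \<le> L powr (24/100)"
      proof (rule powr_ge_const)
        show "13 powr (1 / (24/100)) \<le> real L" using L by linarith
      qed (use qp in auto)
      then have "13 * L powr (3/4) \<le> L powr (24/100) * L powr (3/4)" by (intro mult_right_mono) auto
      also have "\<dots> = L powr (99/100)" by (subst powr_add[symmetric]) simp
      finally show ?thesis .
    qed
    have "cmod (\<Sum>t<L. ef m (a * quad 0 1 t)) \<le> 10 * real L * (q * (1 + (real L)\<^sup>2 * \<bar>2 * \<beta>\<bar>)) powr (-12/25) + 13 * L powr (3/4)"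
      using q(5)[rule_format, of L] unfolding b2 by (simp add: sum_ef_quad)
    also have "\<dots> \<le> 10 * real L * ((2 * V) * (real (2 * q) * (1 + m * \<bar>\<beta>\<bar>)) powr (- 12/25)) + L powr (99/100)"
      using cmp small by (intro add_mono mult_left_mono) auto
    finally have fin: "cmod (\<Sum>t<L. ef m (a * quad 0 1 t)) \<le> 20 * V * L * (real (2 * q) * (1 + m * \<bar>\<beta>\<bar>)) powr (- 12/25) + L powr (99/100)"
      by (simp add: mult_ac)
    show "\<exists>(r::nat) (b::int). 1 \<le> r \<and> r \<le> 8 * L \<and> \<bar>of_int a / real m - of_int b / real r\<bar> \<le> 1 \<and>
       cmod (\<Sum>t<L. ef m (a * quad 0 1 t)) \<le>
       20 * V * L * (r * (1 + m * \<bar>of_int a / real m - of_int b / real r\<bar>)) powr (- 12/25) + L powr (99/100)"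
      using q b1 fin by (intro exI[of _ "2 * q"] exI[of _ h]) (auto simp: \<beta>_def)
  qed
qed

section \<open>Quadratics without small major arcs\<close>

lemma norm_shift_sum:
  fixes z :: "nat \<Rightarrow> complex"
  assumes "\<And>t. cmod (z t) = 1"
  shows "cmod ((\<Sum>t<n. z t) - (\<Sum>t<n. z (t + k))) \<le> 2 * k"
proof (induction k)
  case (Suc k)
  have "(\<Sum>t<n. z (t + k)) + z (n + k) = z k + (\<Sum>t<n. z (t + Suc k))"
    using sum.lessThan_Suc_shift[of "\<lambda>t. z (t + k)" n] by simp
  then have "(\<Sum>t<n. z (t + k)) - (\<Sum>t<n. z (t + Suc k)) = z k - z (n + k)" by (simp add: algebra_simps)
  moreover have "cmod (z k - z (n + k)) \<le> 2"
    using norm_triangle_ineq4[of "z k" "z (n + k)"] assms by simp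
  ultimately have "cmod ((\<Sum>t<n. z (t + k)) - (\<Sum>t<n. z (t + Suc k))) \<le> 2" by simp
  then show ?case using Suc
    norm_triangle_ineq[of "(\<Sum>t<n. z t) - (\<Sum>t<n. z (t + k))" "(\<Sum>t<n. z (t + k)) - (\<Sum>t<n. z (t + Suc k))"] by simp
qed simp

text \<open>With R = r/p, the sum is averaged over the p shifts by R s, s < p, and the p-th roots of
  unity so produced cancel, since p does not divide a u. The two errors are the boundary terms of
  the shifts, at most 2 r, and the drift of the phase caused by \<beta>.\<close>

lemma weyl_sum_shift:
  fixes p r n :: nat and a u v :: int and \<beta> \<theta> :: real
  assumes p: "prime p" "p dvd r" and cop: "coprime a (int r)" and v: "int p dvd v" "v \<ge> 0" and u: "\<not> int p dvd u" "u \<ge> 0"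
    and th: "\<theta> = of_int a / real r + \<beta>" and r: "r \<ge> 1"
  shows "cmod (weyl_sum u v n \<theta>) \<le> 2 * real r + 2 * pi * real n * \<bar>\<beta>\<bar> * real r * real_of_int (u + 2 * v * int n + v * int r)"
proof -
  obtain R where R: "r = p * R" using p by auto
  obtain v' where v': "v = int p * v'" using v by auto
  have pp: "p \<ge> 1" using p(1) prime_ge_1_nat by blast
  have Rp: "R \<ge> 1" using r R by (cases R) auto
  define z where "z t = eexp (\<theta> * of_int (quad u v t))" for t
  define E where "E s = ef p (int s * (a * u))" for s :: nat
  define B where "B = 2 * pi * (\<bar>\<beta>\<bar> * (r * (u + 2 * v * n + v * r)))"
  have z1: "cmod (z t) = 1" for t by (simp add: z_def)
  have close: "cmod (z (t + R * s) - z t * E s) \<le> B" if t: "t < n" and s: "s < p" for t s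
  proof -
    define \<Delta> where "\<Delta> = quad u v (t + R * s) - quad u v t"
    have D: "\<Delta> = int (R * s) * (u + v * (2 * int t + int (R * s)))"
      by (simp add: \<Delta>_def quad_diff)
    \<comment> \<open>The part of the increment coming from v becomes an integer after
      multiplication by a/r, because v = p v' cancels the p in r = p R.\<close>
    have "\<theta> * of_int (quad u v (t + R * s)) = \<theta> * of_int (quad u v t) + (of_int (int s * (a * u)) / real p + (of_int (a * v' * int s * (2 * int t + int (R * s))) + \<beta> * of_int \<Delta>))"
    proof -
      have "\<theta> * of_int (quad u v (t + R * s)) = \<theta> * of_int (quad u v t) + (of_int a / real r * of_int \<Delta> + \<beta> * of_int \<Delta>)"
        by (simp add: \<Delta>_def th algebra_simps)
      also have "of_int a / real r * of_int \<Delta> = of_int (int s * (a * u)) / real p + of_int (a * v' * int s * (2 * int t + int (R * s)))"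
        using pp Rp by (simp add: D R v' field_simps)
      finally show ?thesis by simp
    qed
    then have zz: "z (t + R * s) = z t * E s * eexp (\<beta> * of_int \<Delta>)"
      by (simp only: z_def eexp_add eexp_int E_def ef_def) simp
    have "cmod (z (t + R * s) - z t * E s) = cmod (z t * E s * (eexp (\<beta> * of_int \<Delta>) - 1))"
      by (simp add: zz right_diff_distrib)
    also have "\<dots> = cmod (eexp (\<beta> * of_int \<Delta>) - 1)" by (simp add: norm_mult z1 E_def)
    also have "\<dots> \<le> 2 * pi * \<bar>\<beta> * of_int \<Delta>\<bar>" by (rule eexp_minus_1_le)
    also have "\<dots> \<le> B"
    proof -
      have Rs: "R * s \<le> r" using s by (simp add: R)
      then have Rs': "int (R * s) \<le> int r" by (simp only: of_nat_le_iff)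
      then have le: "int (R * s) * (u + v * (2 * int t + int (R * s))) \<le> int r * (u + v * (2 * int n + int r))"
        using t u v by (intro mult_mono add_mono) (auto intro!: add_nonneg_nonneg mult_nonneg_nonneg simp del: of_nat_mult)
      have "0 \<le> \<Delta>" unfolding D using u v by (auto intro!: mult_nonneg_nonneg add_nonneg_nonneg)
      moreover have "real_of_int \<Delta> \<le> r * (u + 2 * v * n + v * r)"
      proof -
        have "real_of_int \<Delta> \<le> real_of_int (int r * (u + v * (2 * int n + int r)))" unfolding D by (simp only: of_int_le_iff le)
        then show ?thesis by (simp add: algebra_simps)
      qed
      ultimately have "\<bar>\<beta> * of_int \<Delta>\<bar> \<le> \<bar>\<beta>\<bar> * (r * (u + 2 * v * n + v * r))"
        unfolding abs_mult by (intro mult_left_mono) auto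
      then show ?thesis unfolding B_def by (intro mult_left_mono) auto
    qed
    finally show ?thesis .
  qed
  have zero: "(\<Sum>s<p. E s) = 0"
  proof -
    have "\<not> int p dvd a * u"
    proof
      assume "int p dvd a * u"
      moreover have "prime (int p)" using p by simp
      ultimately have "int p dvd a" using u by (simp add: prime_dvd_mult_iff)
      moreover have "int p dvd int r" using p by simp
      ultimately have "is_unit (int p)" using cop by (meson coprime_common_divisor)
      then show False using p(1) by auto
    qed
    then show ?thesis using sum_ef[of p "a * u"] pp by (simp add: E_def sum_int_nat)
  qed
  define W where "W = weyl_sum u v n \<theta>"
  have W: "W = (\<Sum>t<n. z t)" by (simp add: W_def weyl_sum_def z_def)
  have "of_nat p * W = (\<Sum>s<p. (W - (\<Sum>t<n. z (t + R * s))) + (\<Sum>t<n. z (t + R * s) - z t * E s))"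
  proof -
    have "(\<Sum>s<p. (W - (\<Sum>t<n. z (t + R * s))) + (\<Sum>t<n. z (t + R * s) - z t * E s)) = (\<Sum>s<p. W - (\<Sum>t<n. z t * E s))"
      by (intro sum.cong refl) (simp add: sum_subtractf)
    also have "\<dots> = of_nat p * W - W * (\<Sum>s<p. E s)"
      by (simp add: sum_subtractf W sum_distrib_left sum_distrib_right)
    finally show ?thesis by (simp add: zero)
  qed
  then have "p * cmod W = cmod (\<Sum>s<p. (W - (\<Sum>t<n. z (t + R * s))) + (\<Sum>t<n. z (t + R * s) - z t * E s))"
    by (metis norm_mult norm_of_nat)
  also have "\<dots> \<le> (\<Sum>s<p. 2 * real r + n * B)"
  proof (rule sum_norm_le)
    fix s assume s: "s \<in> {..<p}"
    have "cmod (W - (\<Sum>t<n. z (t + R * s))) \<le> 2 * (R * s)" unfolding W by (rule norm_shift_sum) (rule z1)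
    also have "\<dots> \<le> 2 * real r"
    proof -
      have "R * s \<le> r" using s by (simp add: R)
      then have "real (R * s) \<le> real r" by (simp only: of_nat_le_iff)
      then show ?thesis by simp
    qed
    finally have 1: "cmod (W - (\<Sum>t<n. z (t + R * s))) \<le> 2 * real r" .
    have 2: "cmod (\<Sum>t<n. z (t + R * s) - z t * E s) \<le> (\<Sum>t<n. B)"
      using s close by (intro sum_norm_le) auto
    show "cmod ((W - (\<Sum>t<n. z (t + R * s))) + (\<Sum>t<n. z (t + R * s) - z t * E s)) \<le> 2 * real r + n * B"
      using norm_triangle_ineq[of "W - (\<Sum>t<n. z (t + R * s))" "\<Sum>t<n. z (t + R * s) - z t * E s"] 1 2 by simp
  qed
  also have "\<dots> = p * (2 * real r + n * B)" by simp
  finally have "cmod W \<le> 2 * real r + n * B" using pp by simp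
  then show ?thesis by (simp add: W_def B_def mult_ac)
qed

text \<open>Modulo a prime p \<le> w the quadratic is linear with invertible slope, so it permutes
  the residues modulo every power of p. That v has no further prime factors makes 2 v coprime to
  every denominator free of primes up to w, and u \<le> 2 v keeps \<open>quad u v L\<close> between
  v L^2 and 3 v L^2.\<close>

definition sieved :: "int \<Rightarrow> int \<Rightarrow> nat \<Rightarrow> bool" where
  "sieved u v w \<longleftrightarrow> 0 \<le> u \<and> u \<le> 2 * v \<and> 1 \<le> v \<and> 2 \<le> w \<and>
    (\<forall>p::nat. prime p \<longrightarrow> p \<le> w \<longrightarrow> int p dvd v \<and> \<not> int p dvd u) \<and>
    (\<forall>p::nat. prime p \<longrightarrow> int p dvd v \<longrightarrow> p \<le> w)"

text \<open>If the denominator \<open>r\<close> has a prime factor \<open>p \<le> w\<close>, then shifting the variable by a multiple of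
  \<open>r / p\<close> multiplies the phase by a nontrivial root of unity, because \<open>p\<close> divides \<open>v\<close> but
  not \<open>u\<close>; the sum is therefore tiny.\<close>

lemma weyl_structure:
  fixes L w :: nat and u v :: int and \<theta> Q :: real
  assumes sv: "sieved u v w" and L: "L \<ge> 1" and Q: "Q \<ge> 1"
  shows "(\<forall>n\<le>L. cmod (weyl_sum u v n \<theta>) \<le> 10 * real L * Q powr (- 12/25) + 13 * L powr (3/4)) \<or>
    (\<forall>n\<le>L. cmod (weyl_sum u v n \<theta>) \<le> 50 * (of_int v)\<^sup>2 * Q ^ 3) \<or>
    (\<exists>(r::nat) (b::int). 1 \<le> r \<and> r \<le> 4 * L \<and> real r \<le> Q \<and> (\<forall>p. prime p \<longrightarrow> p dvd r \<longrightarrow> p > w) \<and>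
      \<bar>\<theta> - of_int b / real r\<bar> \<le> 1 \<and> \<bar>\<theta> - of_int b / real r\<bar> * (2 * of_int v * (real L)\<^sup>2) \<le> Q \<and>
      (\<forall>n\<le>L. cmod (weyl_sum u v n \<theta>) \<le>
        10 * real L * (r * (1 + of_int v * (real L)\<^sup>2 * \<bar>\<theta> - of_int b / real r\<bar>)) powr (- 12/25) + 13 * L powr (3/4)))"
    (is "?A \<or> ?B \<or> ?C")
proof -
  have u: "0 \<le> u" "u \<le> 2 * v" and v: "1 \<le> v" and w: "2 \<le> w"
    and small: "\<And>p. prime p \<Longrightarrow> p \<le> w \<Longrightarrow> int p dvd v \<and> \<not> int p dvd u"
    and smooth: "\<And>p. prime p \<Longrightarrow> int p dvd v \<Longrightarrow> p \<le> w"
    using sv by (auto simp: sieved_def)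
  obtain q h where q: "q \<ge> 1" "q \<le> 4 * L" "coprime h (int q)"
    "\<bar>2 * of_int v * \<theta> - of_int h / real q\<bar> \<le> 1 / (4 * real L * real q)"
    "\<forall>n\<le>L. cmod (weyl_sum u v n \<theta>)
      \<le> 10 * real L * (q * (1 + (real L)\<^sup>2 * \<bar>2 * of_int v * \<theta> - of_int h / real q\<bar>)) powr (-12/25) + 13 * L powr (3/4)"
    using weyl_bound[OF L, of v \<theta> u] by blast
  define \<beta>' where "\<beta>' = 2 * of_int v * \<theta> - of_int h / real q"
  have rv: "real_of_int v \<ge> 1" "real q \<ge> 1" "real L \<ge> 1" using v q L by auto
  show ?thesis
  \<comment> \<open>A large denominator, or a large distance from the fraction, already gives the
    first alternative.\<close>
  proof (cases "real q > Q \<or> (real L)\<^sup>2 * \<bar>\<beta>'\<bar> > Q")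
    case True
    define y where "y = (real L)\<^sup>2 * \<bar>\<beta>'\<bar>"
    have y0: "y \<ge> 0" by (simp add: y_def)
    define z where "z = real q * (1 + y)"
    have "z \<ge> Q"
      using True unfolding y_def[symmetric]
    proof
      assume "real q > Q"
      moreover have "real q * 1 \<le> z" unfolding z_def using y0 by (intro mult_left_mono) auto
      ultimately show ?thesis by linarith
    next
      assume "y > Q"
      moreover have "1 * (1 + y) \<le> z" unfolding z_def using rv y0 by (intro mult_right_mono) auto
      then have "y + 1 \<le> z" by simp
      ultimately show ?thesis by linarith
    qed
    then have "(q * (1 + (real L)\<^sup>2 * \<bar>\<beta>'\<bar>)) powr (-12/25) \<le> Q powr (- 12/25)" using Q unfolding y_def z_def by (intro powr_mono2') auto
    then have "10 * real L * (q * (1 + (real L)\<^sup>2 * \<bar>\<beta>'\<bar>)) powr (-12/25) \<le> 10 * real L * Q powr (- 12/25)"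
      by (intro mult_left_mono) auto
    then have ?A using q(5) unfolding \<beta>'_def[symmetric] by fastforce
    then show ?thesis ..
  next
    case False
    then have qQ: "real q \<le> Q" and bQ: "(real L)\<^sup>2 * \<bar>\<beta>'\<bar> \<le> Q" by auto
    \<comment> \<open>The fraction h/q approximates 2 v \<theta>. Dividing it by 2 v and reducing
      gives a'/r, an approximation of \<theta> itself.\<close>
    define N where "N = 2 * v * int q"
    define g where "g = gcd h N"
    have Np: "N > 0" using v q by (simp add: N_def)
    then have gp: "g > 0" by (simp add: g_def)
    define r where "r = nat (N div g)"
    define a' where "a' = h div g"
    have gN: "g * (N div g) = N" "g * a' = h" by (auto simp: g_def a'_def)
    have Ng: "N div g > 0" using Np gp gN by (metis zero_less_mult_pos)
    have ir: "int r = N div g" using Ng by (simp add: r_def)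
    have r1: "r \<ge> 1" using Ng by (simp add: r_def)
    have cop: "coprime a' (int r)" unfolding a'_def ir g_def using Np by (intro div_gcd_coprime) auto
    define \<beta> where "\<beta> = \<beta>' / (2 * of_int v)"
    have grN: "g * int r = N" using gN ir by simp
    have th: "\<theta> = of_int a' / real r + \<beta>"
    proof -
      have "real_of_int a' / real r = of_int (g * a') / of_int (g * int r)" using gp by simp
      also have "\<dots> = of_int h / (2 * of_int v * real q)" by (simp only: gN grN) (simp add: N_def)
      finally show ?thesis using rv by (simp add: \<beta>_def \<beta>'_def field_simps)
    qed
    have thb: "\<theta> - of_int a' / real r = \<beta>" using th by simp
    have rN: "real r \<le> 2 * of_int v * Q"
    proof -
      have "1 * int r \<le> g * int r" using gp by (intro mult_right_mono) auto
      then have "int r \<le> 2 * v * int q" using grN by (simp only: N_def mult_1)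
      then have "real_of_int (int r) \<le> real_of_int (2 * v * int q)" by (simp only: of_int_le_iff)
      also have "\<dots> = 2 * of_int v * real q" by simp
      also have "\<dots> \<le> 2 * of_int v * Q" using qQ rv by (intro mult_left_mono) auto
      finally show ?thesis by simp
    qed
    have bb: "\<bar>\<beta>\<bar> * (2 * of_int v * (real L)\<^sup>2) \<le> Q"
      using bQ rv by (simp add: \<beta>_def abs_mult mult_ac)
    have b1: "\<bar>\<beta>\<bar> \<le> 1"
    proof -
      have "1 / (4 * real L * real q) \<le> 1 / 1"
      proof (intro divide_left_mono)
        have "1 * 1 \<le> (4 * real L) * real q" using rv by (intro mult_mono) auto
        then show "1 \<le> 4 * real L * real q" by simp
      qed (use rv in auto)
      then have "\<bar>\<beta>'\<bar> \<le> 1" using q(4) by (simp add: \<beta>'_def)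
      moreover have "\<bar>\<beta>\<bar> \<le> \<bar>\<beta>'\<bar> / 1" unfolding \<beta>_def using rv by (simp add: divide_le_eq mult_le_cancel_left1 field_simps)
      ultimately show ?thesis by simp
    qed
    show ?thesis
    proof (cases "\<exists>p. prime p \<and> p dvd r \<and> p \<le> w")
      case True
      then obtain p where p: "prime p" "p dvd r" "p \<le> w" by auto
      have "cmod (weyl_sum u v n \<theta>) \<le> 50 * (of_int v)\<^sup>2 * Q ^ 3" if n: "n \<le> L" for n
      proof -
        define V where "V = real_of_int v"
        have V: "V \<ge> 1" using rv by (simp add: V_def)
        have "cmod (weyl_sum u v n \<theta>) \<le> 2 * real r + 2 * pi * real n * \<bar>\<beta>\<bar> * real r * real_of_int (u + 2 * v * int n + v * int r)"
          using weyl_sum_shift[OF p(1,2) cop _ _ _ u(1) th r1, of v n] small[OF p(1,3)] v by simp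
        also have "\<dots> \<le> 4 * V\<^sup>2 * Q ^ 3 + 7 * real L * \<bar>\<beta>\<bar> * (2 * V * Q) * (6 * V\<^sup>2 * Q * real L)"
        proof (rule add_mono)
          have "2 * real r \<le> 4 * (V * Q)" using rN by (simp add: V_def mult_ac)
          also have "V * Q \<le> V\<^sup>2 * Q ^ 3"
            using V Q by (intro mult_mono) (auto simp: power2_eq_square self_le_power)
          finally show "2 * real r \<le> 4 * V\<^sup>2 * Q ^ 3" by simp
        next
          show "2 * pi * real n * \<bar>\<beta>\<bar> * real r * real_of_int (u + 2 * v * int n + v * int r) \<le> 7 * real L * \<bar>\<beta>\<bar> * (2 * V * Q) * (6 * V\<^sup>2 * Q * real L)"
          proof (intro mult_mono)
          show "2 * pi \<le> 7" using pi_approx by simp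
          show "real r \<le> 2 * V * Q" using rN by (simp add: V_def mult_ac)
          have "real_of_int (u + 2 * v * int n + v * int r) \<le> 2 * V + 2 * V * L + V * (2 * V * Q)"
          proof -
            have "real_of_int u \<le> 2 * V" using u by (simp add: V_def)
            moreover have "2 * V * real n \<le> 2 * V * L" using V n by (intro mult_left_mono) auto
            moreover have "V * real r \<le> V * (2 * V * Q)" using V rN by (intro mult_left_mono) (auto simp: V_def)
            ultimately show ?thesis by (simp add: V_def)
          qed
          also have "\<dots> \<le> 2 * (V\<^sup>2 * Q * L) + 2 * (V\<^sup>2 * Q * L) + 2 * (V\<^sup>2 * Q * L)"
          proof (intro add_mono)
            have VV: "V \<le> V\<^sup>2" using V by (simp add: power2_eq_square)
            have "V * 1 * 1 \<le> V\<^sup>2 * Q * L" using V Q rv VV by (intro mult_mono) auto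
            then show "2 * V \<le> 2 * (V\<^sup>2 * Q * L)" by simp
            have "V * 1 * L \<le> V\<^sup>2 * Q * L" using V Q rv VV by (intro mult_mono) auto
            then show "2 * V * L \<le> 2 * (V\<^sup>2 * Q * L)" by simp
            have "V\<^sup>2 * Q * 1 \<le> V\<^sup>2 * Q * L" using V Q rv by (intro mult_mono) auto
            then show "V * (2 * V * Q) \<le> 2 * (V\<^sup>2 * Q * L)" by (simp add: power2_eq_square mult_ac)
          qed
          also have "\<dots> = 6 * V\<^sup>2 * Q * L" by simp
          finally show "real_of_int (u + 2 * v * int n + v * int r) \<le> 6 * V\<^sup>2 * Q * L" .
          qed (use V Q u v n in \<open>auto intro!: add_nonneg_nonneg mult_nonneg_nonneg\<close>)
        qed
        also have "7 * real L * \<bar>\<beta>\<bar> * (2 * V * Q) * (6 * V\<^sup>2 * Q * real L) = 42 * V\<^sup>2 * Q\<^sup>2 * (\<bar>\<beta>\<bar> * (2 * V * (real L)\<^sup>2))"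
          by (simp add: power2_eq_square)
        also have "42 * V\<^sup>2 * Q\<^sup>2 * (\<bar>\<beta>\<bar> * (2 * V * (real L)\<^sup>2)) \<le> 42 * V\<^sup>2 * Q\<^sup>2 * Q"
          using bb by (intro mult_left_mono) (auto simp: V_def)
        also have "4 * V\<^sup>2 * Q ^ 3 + 42 * V\<^sup>2 * Q\<^sup>2 * Q \<le> 50 * V\<^sup>2 * Q ^ 3"
          using Q by (simp add: power2_eq_square power3_eq_cube)
        finally show ?thesis by (simp add: V_def)
      qed
      then show ?thesis by blast
    next
      case False
      then have big: "p > w" if "prime p" "p dvd r" for p using that by (meson not_le)
      \<comment> \<open>Being coprime to 2 v and a divisor of 2 v q, the denominator r divides q;
        hence the Weyl bound in terms of q implies the one in terms of r.\<close>
      have "coprime (int r) (2 * v)"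
      proof (rule ccontr)
        assume "\<not> coprime (int r) (2 * v)"
        then have "gcd (int r) (2 * v) \<noteq> 1" by (simp add: coprime_iff_gcd_eq_1)
        then have "nat (gcd (int r) (2 * v)) \<noteq> 1" by (metis gcd_ge_0_int int_nat_eq of_nat_1)
        then obtain p where p: "prime p" "p dvd nat (gcd (int r) (2 * v))" using prime_factor_nat by blast
        then have "int p dvd gcd (int r) (2 * v)" by (metis gcd_ge_0_int int_dvd_int_iff int_nat_eq)
        then have pd: "int p dvd int r" "int p dvd 2 * v" by auto
        then have pw: "p > w" using big[OF p(1)] by simp
        have "int p dvd 2 \<or> int p dvd v" using pd(2) p(1) by (simp add: prime_dvd_mult_iff)
        then show False
        proof
          assume "int p dvd 2"
          then have "p \<le> 2" using zdvd_imp_le[of "int p" 2] by simp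
          then show False using pw w by simp
        next
          assume "int p dvd v"
          then show False using smooth[OF p(1)] pw by simp
        qed
      qed
      moreover have "int r dvd 2 * v * int q" using grN by (metis N_def dvd_triv_right)
      ultimately have "int r dvd int q" by (simp add: coprime_dvd_mult_right_iff)
      then have rq: "r \<le> q" using q by (auto dest: dvd_imp_le)
      have "(q * (1 + (real L)\<^sup>2 * \<bar>\<beta>'\<bar>)) powr (- 12/25) \<le> 1 * (r * (1 + of_int v * (real L)\<^sup>2 * \<bar>\<beta>\<bar>)) powr (- 12/25)"
      proof (rule powr_weight_compare)
        have "of_int v * (real L)\<^sup>2 * \<bar>\<beta>\<bar> = (real L)\<^sup>2 * \<bar>\<beta>'\<bar> / 2" using rv by (simp add: \<beta>_def abs_mult)
        also have "\<dots> \<le> (real L)\<^sup>2 * \<bar>\<beta>'\<bar>" by simp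
        finally show "r * (1 + of_int v * (real L)\<^sup>2 * \<bar>\<beta>\<bar>) \<le> 1 * (q * (1 + (real L)\<^sup>2 * \<bar>\<beta>'\<bar>))"
          unfolding mult_1 using rq by (intro mult_mono) (use rv in auto)
      qed (use rv r1 in \<open>auto intro!: mult_pos_pos add_pos_nonneg\<close>)
      then have "10 * real L * (q * (1 + (real L)\<^sup>2 * \<bar>\<beta>'\<bar>)) powr (- 12/25) \<le> 10 * real L * (r * (1 + of_int v * (real L)\<^sup>2 * \<bar>\<beta>\<bar>)) powr (- 12/25)"
        by (intro mult_left_mono) auto
      then have fin: "\<forall>n\<le>L. cmod (weyl_sum u v n \<theta>) \<le>
        10 * real L * (r * (1 + of_int v * (real L)\<^sup>2 * \<bar>\<theta> - of_int a' / real r\<bar>)) powr (- 12/25) + 13 * L powr (3/4)"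
        using q(5) unfolding \<beta>'_def[symmetric] thb by fastforce
      have ?C
        using r1 rq q(2) qQ big b1 bb fin by (intro exI[of _ r] exI[of _ a']) (simp add: thb)
      then show ?thesis by blast
    qed
  qed
qed

text \<open>The modulus is the value of the quadratic at the end of the range, so that
  \<open>ef m (k * quad u v t)\<close> equals 1 at t = L as it does at t = 0;
  \<open>near_integer_sum\<close> depends on this.\<close>

lemma quad_L_bounds:
  assumes sv: "sieved u v w" and L: "L \<ge> 1" and m: "int m = quad u v L"
  shows "of_int v * (real L)\<^sup>2 \<le> real m" "real m \<le> 3 * of_int v * (real L)\<^sup>2" "m \<ge> L\<^sup>2" "m \<ge> 1"
proof -
  have u: "0 \<le> u" "u \<le> 2 * v" "1 \<le> v" using sv by (auto simp: sieved_def)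
  have m': "real m = of_int u * real L + of_int v * (real L)\<^sup>2"
    using arg_cong[OF m, of real_of_int] by (simp add: quad_def)
  have "0 \<le> of_int u * real L" using u by simp
  then show a: "of_int v * (real L)\<^sup>2 \<le> real m" using m' by simp
  have "of_int u * real L \<le> (2 * of_int v) * (real L)\<^sup>2"
    using u L by (intro mult_mono) (auto simp: power2_eq_square)
  then show "real m \<le> 3 * of_int v * (real L)\<^sup>2" using m' by simp
  have "1 * (real L)\<^sup>2 \<le> of_int v * (real L)\<^sup>2" using u by (intro mult_right_mono) auto
  then have "(real L)\<^sup>2 \<le> real m" using a by linarith
  then show "m \<ge> L\<^sup>2" by (simp only: of_nat_power[symmetric] of_nat_le_iff)
  moreover have "L\<^sup>2 \<ge> 1" using L by simp
  ultimately show "m \<ge> 1" by linarith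
qed

text \<open>\<open>weyl_structure\<close> with Q = L^(1/10): the first alternative is
  O(L^(119/125)), the second O(L^(3/10)) with a constant depending on v, both below L^(99/100). As
  \<open>v\<close> is free in the statement, the bound on L may depend on it.\<close>

lemma major_arc_bounded_quad:
  "\<exists>L0::nat. \<forall>L u w m. L \<ge> L0 \<longrightarrow> sieved u v w \<longrightarrow> int m = quad u v L \<longrightarrow> major_arc_bounded 30 L m (quad u v)"
proof -
  have "\<forall>\<^sub>F L::nat in sequentially. 10 * real L powr (119/125) + 13 * real L powr (3/4) \<le> real L powr (99/100)"
    by real_asymp
  then obtain L1 where L1: "\<And>L. L \<ge> L1 \<Longrightarrow> 10 * real L powr (119/125) + 13 * real L powr (3/4) \<le> real L powr (99/100)"
    by (auto simp: eventually_sequentially)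
  define K where "K = 50 * (real_of_int v)\<^sup>2"
  show ?thesis
  proof (intro exI[of _ "L1 + nat \<lceil>K powr (1 / (69/100))\<rceil> + 1"] allI impI)
    fix L w m :: nat and u :: int
    assume L: "L1 + nat \<lceil>K powr (1 / (69/100))\<rceil> + 1 \<le> L" and sv: "sieved u v w" and m: "int m = quad u v L"
    have Lp: "L \<ge> 1" "L \<ge> L1" using L by auto
    have Lr: "real L \<ge> 1" using Lp by simp
    note qb = quad_L_bounds[OF sv Lp(1) m]
    have v: "v \<ge> 1" using sv by (simp add: sieved_def)
    show "major_arc_bounded 30 L m (quad u v)"
      unfolding major_arc_bounded_def
    proof
      fix a :: int
      define \<theta> where "\<theta> = real_of_int a / real m"
      define Q where "Q = real L powr (1/10)"
      have Q: "Q \<ge> 1" using Lr by (simp add: Q_def ge_one_powr_ge_zero)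
      have small: "10 * real L * Q powr (- 12/25) + 13 * L powr (3/4) \<le> L powr (99/100)"
      proof -
        have "L * Q powr (- 12/25) = L powr 1 * L powr (- 6/125)" using Lr by (simp add: Q_def powr_powr)
        also have "\<dots> = L powr (119/125)" by (subst powr_add[symmetric]) simp
        finally show ?thesis using L1[OF Lp(2)] by simp
      qed
      \<comment> \<open>A sum below L^(99/100) satisfies the requirement with r = 1 and b the
        integer part of \<theta>.\<close>
      have trivial: "\<exists>(r::nat) (b::int). 1 \<le> r \<and> r \<le> 8 * L \<and> \<bar>of_int a / real m - of_int b / real r\<bar> \<le> 1 \<and>
       cmod (\<Sum>t<L. ef m (a * quad u v t)) \<le>
       30 * real L * (r * (1 + m * \<bar>of_int a / real m - of_int b / real r\<bar>)) powr (- 12/25) + L powr (99/100)"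
        if "cmod (weyl_sum u v L \<theta>) \<le> L powr (99/100)"
      proof -
        have t1: "\<bar>of_int a / real m - of_int \<lfloor>\<theta>\<rfloor> / real 1\<bar> \<le> 1" unfolding \<theta>_def by simp linarith
        have "cmod (\<Sum>t<L. ef m (a * quad u v t)) \<le> L powr (99/100)" using that by (simp add: sum_ef_quad \<theta>_def)
        moreover have "0 \<le> 30 * real L * (real 1 * (1 + m * \<bar>of_int a / real m - of_int \<lfloor>\<theta>\<rfloor> / real 1\<bar>)) powr (- 12/25)" by simp
        ultimately have "cmod (\<Sum>t<L. ef m (a * quad u v t)) \<le>
       30 * real L * (real 1 * (1 + m * \<bar>of_int a / real m - of_int \<lfloor>\<theta>\<rfloor> / real 1\<bar>)) powr (- 12/25) + L powr (99/100)" by linarith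
        then show ?thesis using t1 Lp by (intro exI[of _ 1] exI[of _ "\<lfloor>\<theta>\<rfloor>"]) simp
      qed
      consider "\<forall>n\<le>L. cmod (weyl_sum u v n \<theta>) \<le> 10 * real L * Q powr (- 12/25) + 13 * L powr (3/4)"
        | "\<forall>n\<le>L. cmod (weyl_sum u v n \<theta>) \<le> 50 * (of_int v)\<^sup>2 * Q ^ 3"
        | r b where "1 \<le> r" "r \<le> 4 * L" "\<bar>\<theta> - of_int b / real r\<bar> \<le> 1"
          "\<forall>n\<le>L. cmod (weyl_sum u v n \<theta>) \<le>
        10 * real L * (r * (1 + of_int v * (real L)\<^sup>2 * \<bar>\<theta> - of_int b / real r\<bar>)) powr (- 12/25) + 13 * L powr (3/4)"
        using weyl_structure[OF sv Lp(1) Q, of \<theta>] by (elim disjE exE conjE)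
      then show "\<exists>(r::nat) (b::int). 1 \<le> r \<and> r \<le> 8 * L \<and> \<bar>of_int a / real m - of_int b / real r\<bar> \<le> 1 \<and>
       cmod (\<Sum>t<L. ef m (a * quad u v t)) \<le>
       30 * real L * (r * (1 + m * \<bar>of_int a / real m - of_int b / real r\<bar>)) powr (- 12/25) + L powr (99/100)"
      proof cases
        case 1
        then have "cmod (weyl_sum u v L \<theta>) \<le> 10 * real L * Q powr (- 12/25) + 13 * L powr (3/4)" by blast
        then show ?thesis using small by (intro trivial) linarith
      next
        case 2
        then have "cmod (weyl_sum u v L \<theta>) \<le> K * Q ^ 3" by (simp add: K_def)
        also have "Q ^ 3 = L powr (3/10)" using Lr by (simp add: Q_def powr_power)
        also have "K * L powr (3/10) \<le> L powr (69/100) * L powr (3/10)"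
        proof (intro mult_right_mono powr_ge_const)
          show "K powr (1 / (69/100)) \<le> real L" using L by linarith
        qed (use Lr in \<open>auto simp: K_def\<close>)
        also have "\<dots> = L powr (99/100)" by (subst powr_add[symmetric]) simp
        finally show ?thesis by (rule trivial)
      next
        case (3 r b)
        note rb = 3(1-3) and D = 3(4)
        define \<beta> where "\<beta> = \<theta> - of_int b / real r"
        have "(r * (1 + of_int v * (real L)\<^sup>2 * \<bar>\<beta>\<bar>)) powr (- 12/25) \<le> 3 * (r * (1 + m * \<bar>\<beta>\<bar>)) powr (- 12/25)"
        proof (rule powr_weight_compare)
          have "m * \<bar>\<beta>\<bar> \<le> (3 * of_int v * (real L)\<^sup>2) * \<bar>\<beta>\<bar>" using qb by (intro mult_right_mono) auto
          then have "1 + m * \<bar>\<beta>\<bar> \<le> 3 * (1 + of_int v * (real L)\<^sup>2 * \<bar>\<beta>\<bar>)" by simp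
          then have "real r * (1 + m * \<bar>\<beta>\<bar>) \<le> real r * (3 * (1 + of_int v * (real L)\<^sup>2 * \<bar>\<beta>\<bar>))" by (intro mult_left_mono) auto
          then show "real r * (1 + m * \<bar>\<beta>\<bar>) \<le> 3 * (real r * (1 + of_int v * (real L)\<^sup>2 * \<bar>\<beta>\<bar>))" by (simp only: mult.left_commute)
        qed (use rb v in \<open>auto intro!: mult_pos_pos add_pos_nonneg\<close>)
        then have "10 * real L * (r * (1 + of_int v * (real L)\<^sup>2 * \<bar>\<beta>\<bar>)) powr (- 12/25) \<le> 10 * real L * (3 * (r * (1 + m * \<bar>\<beta>\<bar>)) powr (- 12/25))"
          by (intro mult_left_mono) auto
        moreover have "13 * L powr (3/4) \<le> L powr (99/100)"
          using L1[OF Lp(2)] by (smt (verit) powr_ge_zero)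
        moreover have "cmod (weyl_sum u v L \<theta>) \<le> 10 * real L * (r * (1 + of_int v * (real L)\<^sup>2 * \<bar>\<beta>\<bar>)) powr (- 12/25) + 13 * L powr (3/4)"
          using D by (simp add: \<beta>_def)
        ultimately have "cmod (weyl_sum u v L \<theta>) \<le> 30 * real L * (r * (1 + m * \<bar>\<beta>\<bar>)) powr (- 12/25) + L powr (99/100)" by simp
        then show ?thesis using rb by (intro exI[of _ r] exI[of _ b]) (simp add: sum_ef_quad \<theta>_def \<beta>_def)
      qed
    qed
  qed
qed

section \<open>The energy of a dense set on few frequencies\<close>

definition qdiff :: "int \<Rightarrow> int \<Rightarrow> nat \<Rightarrow> int" where
  "qdiff u v t = quad u v (Suc t) - quad u v t"

lemma qdiff_eq: "qdiff u v t = u + v * (2 * int t + 1)"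
  by (simp add: qdiff_def quad_diff)

text \<open>The weight is affine in t with constant increment 2 v, so one summation by parts leaves
  an unweighted sum of partial sums.\<close>

lemma sum_by_parts_qdiff:
  fixes z :: "nat \<Rightarrow> complex"
  shows "(\<Sum>t<n. of_int (qdiff u v t) * z t) = of_int (qdiff u v n) * (\<Sum>t<n. z t) - 2 * of_int v * (\<Sum>t<n. \<Sum>s<Suc t. z s)"
  by (induction n) (simp_all add: qdiff_eq algebra_simps)

lemma norm_sum_qdiff_le:
  fixes z :: "nat \<Rightarrow> complex"
  assumes u: "0 \<le> u" "u \<le> 2 * v" "1 \<le> v" and n: "n \<ge> 1" and M: "\<And>k. k \<le> n \<Longrightarrow> cmod (\<Sum>t<k. z t) \<le> M"
  shows "cmod (\<Sum>t<n. of_int (qdiff u v t) * z t) \<le> 7 * real_of_int v * real n * M"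
proof -
  have M0: "M \<ge> 0" using M[of 0] by simp
  have vn: "real_of_int v \<ge> 1" "real n \<ge> 1" using u n by auto
  have q: "0 \<le> qdiff u v n" using u by (auto simp: qdiff_eq intro!: add_nonneg_nonneg mult_nonneg_nonneg)
  have "cmod (of_int (qdiff u v n) * (\<Sum>t<n. z t)) \<le> of_int (qdiff u v n) * M"
    using q M[of n] by (simp add: norm_mult mult_left_mono)
  moreover have "cmod (2 * of_int v * (\<Sum>t<n. \<Sum>s<Suc t. z s)) \<le> 2 * of_int v * (n * M)"
  proof -
    have "cmod (\<Sum>t<n. \<Sum>s<Suc t. z s) \<le> (\<Sum>t<n. M)" by (rule sum_norm_le) (rule M, simp)
    then have "2 * of_int v * cmod (\<Sum>t<n. \<Sum>s<Suc t. z s) \<le> 2 * of_int v * (n * M)"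
      using vn by (intro mult_left_mono) auto
    then show ?thesis using u by (simp add: norm_mult)
  qed
  ultimately have "cmod (\<Sum>t<n. of_int (qdiff u v t) * z t) \<le> of_int (qdiff u v n) * M + 2 * of_int v * (n * M)"
    unfolding sum_by_parts_qdiff by (meson norm_triangle_ineq4 order.trans add_mono)
  also have "real_of_int (qdiff u v n) * M \<le> (5 * real_of_int v * real n) * M"
  proof (rule mult_right_mono[OF _ M0])
    have "real_of_int u \<le> 2 * of_int v * real n"
      using u n vn mult_mono[of "real_of_int u" "2 * of_int v" 1 "real n"] by simp
    moreover have "real_of_int v \<le> of_int v * real n" using vn by simp
    ultimately show "real_of_int (qdiff u v n) \<le> 5 * of_int v * real n" by (simp add: qdiff_eq algebra_simps)
  qed
  finally show ?thesis by (simp add: algebra_simps)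
qed

text \<open>The weighted sum is a telescoping one to first order: z (t + 1) - z t is z t times 2 pi
  i k \<open>qdiff u v t\<close> / m up to a quadratic error, and the total increment vanishes
  because \<open>quad u v L\<close> is m.\<close>

lemma near_integer_sum:
  assumes sv: "sieved u v w" and L: "L \<ge> 1" and m: "int m = quad u v L" and k: "k \<noteq> 0"
  shows "cmod (\<Sum>t<L. of_int (qdiff u v t) * ef m (k * quad u v t)) \<le> 175 * \<bar>real_of_int k\<bar> * real_of_int v * real L"
proof -
  have u: "0 \<le> u" "u \<le> 2 * v" "1 \<le> v" using sv by (auto simp: sieved_def)
  note qb = quad_L_bounds[OF sv L m]
  have mp: "real m > 0" using qb by simp
  have vn: "real_of_int v \<ge> 1" "real L \<ge> 1" using u L by auto
  define x where "x t = real_of_int (k * qdiff u v t) / real m" for t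
  define z where "z t = ef m (k * quad u v t)" for t
  define E where "E t = eexp (x t) - 1 - 2 * pi * \<i> * x t" for t
  have step: "z (Suc t) - z t = z t * (2 * pi * \<i> * x t) + z t * E t" for t
  proof -
    have "z (Suc t) = ef m (k * quad u v t + k * qdiff u v t)" by (simp add: z_def qdiff_def right_diff_distrib)
    also have "\<dots> = z t * eexp (x t)" by (simp add: ef_add z_def ef_def[of m "k * qdiff u v t"] x_def)
    finally show ?thesis by (simp add: E_def algebra_simps)
  qed
  have "(\<Sum>t<L. z (Suc t) - z t) = z L - z 0" by (rule sum_lessThan_telescope)
  also have "\<dots> = 0"
  proof -
    have "z L = 1" unfolding z_def m[symmetric] by (rule ef_dvd) (use qb in auto)
    then show ?thesis by (simp add: z_def quad_def)
  qed
  finally have "(\<Sum>t<L. z t * (2 * pi * \<i> * x t)) + (\<Sum>t<L. z t * E t) = 0"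
    by (simp add: step sum.distrib)
  moreover have "(\<Sum>t<L. z t * (2 * pi * \<i> * x t)) = 2 * pi * \<i> * (of_int k / m) * (\<Sum>t<L. of_int (qdiff u v t) * z t)"
    by (simp add: x_def sum_distrib_left sum_divide_distrib mult_ac)
  ultimately have "2 * pi * \<i> * (of_int k / m) * (\<Sum>t<L. of_int (qdiff u v t) * z t) = - (\<Sum>t<L. z t * E t)"
    by (simp add: add_eq_0_iff)
  then have "cmod (2 * pi * \<i> * (of_int k / m) * (\<Sum>t<L. of_int (qdiff u v t) * z t)) = cmod (\<Sum>t<L. z t * E t)"
    by (metis norm_minus_cancel)
  then have e1: "2 * pi * (\<bar>of_int k\<bar> / m) * cmod (\<Sum>t<L. of_int (qdiff u v t) * z t) = cmod (\<Sum>t<L. z t * E t)"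
    by (simp add: norm_mult norm_divide)
  have "cmod (\<Sum>t<L. z t * E t) \<le> (\<Sum>t<L. (2 * pi * (\<bar>of_int k\<bar> * (5 * of_int v * L) / m))\<^sup>2)"
  proof (rule sum_norm_le)
    fix t assume t: "t \<in> {..<L}"
    have "cmod (z t * E t) = cmod (E t)" by (simp add: norm_mult z_def)
    also have "\<dots> \<le> (2 * pi * x t)\<^sup>2" unfolding E_def by (rule eexp_second_order)
    also have "\<dots> = (2 * pi * \<bar>x t\<bar>)\<^sup>2" by (simp add: power_mult_distrib)
    also have "\<dots> \<le> (2 * pi * (\<bar>of_int k\<bar> * (5 * of_int v * L) / m))\<^sup>2"
    proof (intro power_mono mult_left_mono)
      have q: "0 \<le> qdiff u v t" using u by (auto simp: qdiff_eq intro!: add_nonneg_nonneg mult_nonneg_nonneg)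
      have "real_of_int u \<le> 2 * of_int v * real L"
        using u vn mult_mono[of "real_of_int u" "2 * of_int v" 1 "real L"] by simp
      moreover have "real_of_int v \<le> of_int v * real L" using vn by simp
      moreover have "of_int v * real t \<le> of_int v * real L" using vn t by (intro mult_left_mono) auto
      ultimately have qle: "real_of_int (qdiff u v t) \<le> 5 * of_int v * real L" by (simp add: qdiff_eq algebra_simps)
      have "\<bar>real_of_int k\<bar> * real_of_int (qdiff u v t) / m \<le> \<bar>real_of_int k\<bar> * (5 * real_of_int v * real L) / m"
        by (rule divide_right_mono[OF mult_left_mono[OF qle abs_ge_zero]]) simp
      then show "\<bar>x t\<bar> \<le> \<bar>of_int k\<bar> * (5 * of_int v * L) / m" using q by (simp add: x_def abs_mult)
    qed auto
    finally show "cmod (z t * E t) \<le> (2 * pi * (\<bar>of_int k\<bar> * (5 * of_int v * L) / m))\<^sup>2" .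
  qed
  also have "\<dots> = 2 * pi * (\<bar>of_int k\<bar> / m) * (2 * pi * (\<bar>of_int k\<bar> * (25 * (of_int v)\<^sup>2 * (real L)\<^sup>2 * L) / m))"
    by (simp add: power2_eq_square)
  finally have "2 * pi * (\<bar>of_int k\<bar> / m) * cmod (\<Sum>t<L. of_int (qdiff u v t) * z t)
    \<le> 2 * pi * (\<bar>of_int k\<bar> / m) * (2 * pi * (\<bar>of_int k\<bar> * (25 * (of_int v)\<^sup>2 * (real L)\<^sup>2 * L) / m))" using e1 by simp
  moreover have "2 * pi * (\<bar>real_of_int k\<bar> / m) > 0" using k mp by (intro mult_pos_pos divide_pos_pos) auto
  ultimately have "cmod (\<Sum>t<L. of_int (qdiff u v t) * z t) \<le> 2 * pi * (\<bar>of_int k\<bar> * (25 * (of_int v)\<^sup>2 * (real L)\<^sup>2 * L) / m)"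
    by (simp only: mult_le_cancel_left_pos)
  also have "\<dots> \<le> 7 * (\<bar>of_int k\<bar> * (25 * (of_int v)\<^sup>2 * (real L)\<^sup>2 * L) / (of_int v * (real L)\<^sup>2))"
    using pi_approx qb vn mp by (intro mult_mono divide_left_mono mult_pos_pos) auto
  also have "\<dots> = 175 * \<bar>of_int k\<bar> * of_int v * L" using vn by (simp add: power2_eq_square)
  finally show ?thesis by (simp add: z_def)
qed

text \<open>\<open>weyl_structure\<close> with Q = w. In its third alternative the denominator is at
  most w and free of primes up to w, so it is 1; then the frequency is close to an integer and
  \<open>near_integer_sum\<close> applies. In the other two alternatives all partial sums are small
  and summation by parts suffices.\<close>

lemma weighted_sum_small:
  fixes \<eta> :: real
  assumes eta: "\<eta> > 0"
  shows "\<exists>w0::nat. \<forall>w\<ge>w0. \<forall>v. \<exists>L0::nat. \<forall>L\<ge>L0. \<forall>u m a. sieved u v w \<longrightarrow> int m = quad u v L \<longrightarrow> \<not> int m dvd a \<longrightarrow>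
    cmod (\<Sum>t<L. of_int (qdiff u v t) * ef m (a * quad u v t)) \<le> \<eta> * of_int v * (real L)\<^sup>2"
proof (rule exI[of _ "nat \<lceil>(140 / \<eta>) powr (1 / (12/25))\<rceil>"], intro allI impI)
  fix w :: nat and v :: int assume w: "nat \<lceil>(140 / \<eta>) powr (1 / (12/25))\<rceil> \<le> w"
  \<comment> \<open>These thresholds control 13 L^(3/4), 50 v^2 w^3 and 263 v w L, the errors of the
    three cases: 182 is 13 times 14, 350 is 50 times 7, and 263 rounds up 175 times 3/2. Likewise
    140 in the bound for w is 10 times 14.\<close>
  define L0 where "L0 = nat \<lceil>(182 / \<eta>) powr (1 / (1/4))\<rceil> + nat \<lceil>350 * (of_int v)\<^sup>2 * real w ^ 3 / \<eta>\<rceil> + nat \<lceil>263 * real w / \<eta>\<rceil> + 1"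
  show "\<exists>L0::nat. \<forall>L\<ge>L0. \<forall>u m a. sieved u v w \<longrightarrow> int m = quad u v L \<longrightarrow> \<not> int m dvd a \<longrightarrow>
    cmod (\<Sum>t<L. of_int (qdiff u v t) * ef m (a * quad u v t)) \<le> \<eta> * of_int v * (real L)\<^sup>2"
  proof (intro exI[of _ L0] allI impI)
    fix L m :: nat and u a :: int
    assume L: "L0 \<le> L" and sv: "sieved u v w" and m: "int m = quad u v L" and na: "\<not> int m dvd a"
    have u: "0 \<le> u" "u \<le> 2 * v" "1 \<le> v" "2 \<le> w" using sv by (auto simp: sieved_def)
    have L1: "L \<ge> 1" using L by (simp add: L0_def)
    have Lr: "real L \<ge> 1" "real w \<ge> 1" using L1 u by auto
    note qb = quad_L_bounds[OF sv L1 m]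
    have mp: "real m > 0" using qb by simp
    define \<theta> where "\<theta> = real_of_int a / real m"
    have weighted: "cmod (\<Sum>t<L. of_int (qdiff u v t) * ef m (a * quad u v t)) \<le> \<eta> * of_int v * (real L)\<^sup>2"
      if M: "\<forall>n\<le>L. cmod (weyl_sum u v n \<theta>) \<le> \<eta> * L / 7"
    proof -
      have "cmod (\<Sum>t<L. of_int (qdiff u v t) * ef m (a * quad u v t)) \<le> 7 * real_of_int v * real L * (\<eta> * L / 7)"
        using M by (intro norm_sum_qdiff_le u L1) (simp add: sum_ef_quad \<theta>_def)
      then show ?thesis by (simp add: power2_eq_square mult_ac)
    qed
    consider "\<forall>n\<le>L. cmod (weyl_sum u v n \<theta>) \<le> 10 * real L * real w powr (- 12/25) + 13 * L powr (3/4)"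
      | "\<forall>n\<le>L. cmod (weyl_sum u v n \<theta>) \<le> 50 * (of_int v)\<^sup>2 * real w ^ 3"
      | r b where "1 \<le> r" "real r \<le> real w" "\<forall>p. prime p \<longrightarrow> p dvd r \<longrightarrow> p > w"
          "\<bar>\<theta> - of_int b / real r\<bar> * (2 * of_int v * (real L)\<^sup>2) \<le> real w"
      using weyl_structure[OF sv L1 Lr(2), of \<theta>] by (elim disjE exE conjE)
    then show "cmod (\<Sum>t<L. of_int (qdiff u v t) * ef m (a * quad u v t)) \<le> \<eta> * of_int v * (real L)\<^sup>2"
    proof cases
      case 1
      have "140 / \<eta> \<le> real w powr (12/25)"
        by (rule powr_ge_const) (use w eta Lr in \<open>auto simp: ceiling_le_iff nat_le_iff\<close>)
      then have "real w powr (- 12/25) \<le> \<eta> / 140"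
        using eta Lr by (simp add: powr_minus_divide field_simps)
      then have i: "10 * real L * real w powr (- 12/25) \<le> 10 * real L * (\<eta> / 140)" by (intro mult_left_mono) auto
      have "182 / \<eta> \<le> real L powr (1/4)"
        by (rule powr_ge_const) (use L eta Lr in \<open>auto simp: L0_def intro: order.trans[OF real_nat_ceiling_ge]\<close>)
      then have "182 \<le> \<eta> * real L powr (1/4)" using eta by (simp add: field_simps)
      then have "182 * L powr (3/4) \<le> \<eta> * real L powr (1/4) * L powr (3/4)" by (intro mult_right_mono) auto
      also have "\<dots> = \<eta> * L powr 1" by (simp only: mult.assoc powr_add[symmetric]) simp
      finally have "13 * L powr (3/4) \<le> \<eta> * L / 14" by simp
      with i have "10 * real L * real w powr (- 12/25) + 13 * L powr (3/4) \<le> \<eta> * L / 7" by simp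
      then show ?thesis using 1 by (intro weighted) force
    next
      case 2
      have "350 * (of_int v)\<^sup>2 * real w ^ 3 / \<eta> \<le> real L" using L unfolding L0_def by linarith
      then have "50 * (of_int v)\<^sup>2 * real w ^ 3 \<le> \<eta> * L / 7" using eta by (simp add: field_simps)
      then show ?thesis using 2 by (intro weighted) force
    next
      case (3 r b)
      have r1: "r = 1"
      proof (rule ccontr)
        assume "r \<noteq> 1"
        then obtain p where p: "prime p" "p dvd r" using prime_factor_nat by blast
        have "p \<le> r" using p(2) 3(1) by (intro dvd_imp_le) simp_all
        moreover have "p > w" using 3(3) p by blast
        ultimately show False using 3(2) by simp
      qed
      define k where "k = a - b * int m"
      have k0: "k \<noteq> 0" using na by (auto simp: k_def)
      have "\<bar>real_of_int k\<bar> / m * (2 * of_int v * (real L)\<^sup>2) \<le> real w"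
      proof -
        have "\<theta> - of_int b / real r = of_int k / m" using mp by (simp add: \<theta>_def r1 k_def field_simps)
        then show ?thesis using 3(4) mp by simp
      qed
      then have "\<bar>real_of_int k\<bar> * (2 * of_int v * (real L)\<^sup>2) \<le> real w * m" using mp by (simp add: field_simps)
      also have "\<dots> \<le> real w * (3 * of_int v * (real L)\<^sup>2)" using qb by (intro mult_left_mono) auto
      finally have "(2 * \<bar>real_of_int k\<bar>) * (of_int v * (real L)\<^sup>2) \<le> (3 * real w) * (of_int v * (real L)\<^sup>2)" by (simp add: mult_ac)
      moreover have "of_int v * (real L)\<^sup>2 > 0" using u Lr by (intro mult_pos_pos) auto
      ultimately have kw: "2 * \<bar>real_of_int k\<bar> \<le> 3 * real w" by (simp only: mult_le_cancel_right_pos)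
      have "(\<Sum>t<L. of_int (qdiff u v t) * ef m (a * quad u v t)) = (\<Sum>t<L. of_int (qdiff u v t) * ef m (k * quad u v t))"
      proof (intro sum.cong refl arg_cong[where f = "\<lambda>x. _ * x"] ef_cong)
        fix t
        have "a * quad u v t - k * quad u v t = int m * (b * quad u v t)" by (simp add: k_def algebra_simps)
        then show "int m dvd a * quad u v t - k * quad u v t" by simp
      qed (use mp in simp)
      then have "cmod (\<Sum>t<L. of_int (qdiff u v t) * ef m (a * quad u v t)) \<le> 175 * \<bar>real_of_int k\<bar> * real_of_int v * real L"
        using near_integer_sum[OF sv L1 m k0] by simp
      also have "\<dots> \<le> (263 * real w) * (real_of_int v * real L)"
      proof -
        have "175 * \<bar>real_of_int k\<bar> \<le> 263 * real w" using kw by linarith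
        then have "175 * \<bar>real_of_int k\<bar> * (real_of_int v * real L) \<le> (263 * real w) * (real_of_int v * real L)" using u by (intro mult_right_mono) auto
        then show ?thesis by (simp only: mult.assoc)
      qed
      also have "\<dots> \<le> (\<eta> * L) * (real_of_int v * real L)"
      proof (rule mult_right_mono)
        have "263 * real w / \<eta> \<le> real L" using L unfolding L0_def by linarith
        then show "263 * real w \<le> \<eta> * L" using eta by (simp add: field_simps)
      qed (use u in simp)
      finally show ?thesis by (simp add: power2_eq_square mult_ac)
    qed
  qed
qed

text \<open>The weights \<open>qdiff u v t\<close> make the values \<open>quad u v t\<close> look uniformly distributed on \<open>\<int>/m\<close>.
  The kernel of the dual inequality is then almost diagonal, and the weights are comparable
  to their maximum on \<open>A\<close>.\<close>

lemma energy_bound: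
  fixes K :: nat
  shows "\<exists>w0::nat. \<forall>w\<ge>w0. \<forall>v. \<exists>L0::nat. \<forall>L\<ge>L0. \<forall>u m A S c. sieved u v w \<longrightarrow> int m = quad u v L \<longrightarrow>
    0 < c \<longrightarrow> (\<forall>t\<in>A. c * real L \<le> real t) \<longrightarrow> S \<subseteq> {0..<int m} \<longrightarrow> card S \<le> K \<longrightarrow>
    (\<Sum>a\<in>S. (cmod (\<Sum>t<L. (if t \<in> A then 1 else 0) * ef m (a * quad u v t)))\<^sup>2) \<le> 4 / c * (real L)\<^sup>2"
proof -
  \<comment> \<open>With at most K frequencies the off-diagonal terms then add up to no more than v
    L^2 E, against 3 v L^2 E from the diagonal; hence the 4 in the bound.\<close>
  define \<eta> where "\<eta> = 1 / (real K + 1)"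
  have eta: "\<eta> > 0" by (simp add: \<eta>_def)
  obtain w0 where w0: "\<forall>w\<ge>w0. \<forall>v. \<exists>L0::nat. \<forall>L\<ge>L0. \<forall>u m a. sieved u v w \<longrightarrow> int m = quad u v L \<longrightarrow> \<not> int m dvd a \<longrightarrow>
    cmod (\<Sum>t<L. of_int (qdiff u v t) * ef m (a * quad u v t)) \<le> \<eta> * of_int v * (real L)\<^sup>2"
    using weighted_sum_small[OF eta] by blast
  show ?thesis
  proof (rule exI[of _ w0], intro allI impI)
    fix w :: nat and v :: int assume w: "w0 \<le> w"
    obtain L0 where L0: "\<forall>L\<ge>L0. \<forall>u m a. sieved u v w \<longrightarrow> int m = quad u v L \<longrightarrow> \<not> int m dvd a \<longrightarrow>
      cmod (\<Sum>t<L. of_int (qdiff u v t) * ef m (a * quad u v t)) \<le> \<eta> * of_int v * (real L)\<^sup>2"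
      using w0 w by blast
    show "\<exists>L0::nat. \<forall>L\<ge>L0. \<forall>u m A S c. sieved u v w \<longrightarrow> int m = quad u v L \<longrightarrow>
    0 < c \<longrightarrow> (\<forall>t\<in>A. c * real L \<le> real t) \<longrightarrow> S \<subseteq> {0..<int m} \<longrightarrow> card S \<le> K \<longrightarrow>
    (\<Sum>a\<in>S. (cmod (\<Sum>t<L. (if t \<in> A then 1 else 0) * ef m (a * quad u v t)))\<^sup>2) \<le> 4 / c * (real L)\<^sup>2"
    proof (intro exI[of _ "L0 + 1"] allI impI)
      fix L m :: nat and u :: int and A :: "nat set" and S :: "int set" and c :: real
      assume L: "L0 + 1 \<le> L" and sv: "sieved u v w" and m: "int m = quad u v L" and c: "0 < c"
        and A: "\<forall>t\<in>A. c * real L \<le> real t" and S: "S \<subseteq> {0..<int m}" and K: "card S \<le> K"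
      have u: "0 \<le> u" "u \<le> 2 * v" "1 \<le> v" using sv by (auto simp: sieved_def)
      have L1: "L \<ge> 1" using L by simp
      note qb = quad_L_bounds[OF sv L1 m]
      have fin: "finite S" using S finite_subset by blast
      have Lr: "real L \<ge> 1" using L1 by simp
      define f where "f a = (\<Sum>t<L. (if t \<in> A then 1 else 0) * ef m (a * quad u v t))" for a
      define E where "E = (\<Sum>a\<in>S. (cmod (f a))\<^sup>2)"
      define G where "G a = cmod (\<Sum>t<L. of_int (qdiff u v t) * ef m (a * quad u v t))" for a
      have vL: "of_int v * (real L)\<^sup>2 > 0" using u Lr by (intro mult_pos_pos) auto
      have q0: "qdiff u v t > 0" for t
        using u by (auto simp: qdiff_eq intro!: add_nonneg_pos mult_pos_pos)
      have G0: "G 0 \<le> 3 * (of_int v * (real L)\<^sup>2)"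
      proof -
        have "(\<Sum>t<L. of_int (qdiff u v t) * ef m (0 * quad u v t)) = of_int (\<Sum>t<L. qdiff u v t)" by simp
        also have "(\<Sum>t<L. qdiff u v t) = quad u v L - quad u v 0"
          unfolding qdiff_def by (rule sum_lessThan_telescope)
        also have "\<dots> = int m" by (simp add: m quad_def)
        finally have "G 0 = real m" by (simp add: G_def)
        then show ?thesis using qb by simp
      qed
      have Goff: "G (a - b) \<le> \<eta> * (of_int v * (real L)\<^sup>2)" if "a \<in> S" "b \<in> S" "a \<noteq> b" for a b
      proof -
        have "a \<in> {0..<int m}" "b \<in> {0..<int m}" using that S by blast+
        then have "\<bar>a - b\<bar> < int m" by auto
        then have "\<not> int m dvd a - b" using that(3) dvd_imp_le_int[of "a - b" "int m"] by fastforce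
        then show ?thesis using L0[rule_format, of L, OF _ sv m] L by (simp add: G_def mult.assoc)
      qed
      have "(c * (real_of_int v * real L)) * (cmod (\<Sum>a\<in>S. cnj (f a) * f a))\<^sup>2 \<le>
        L * (\<Sum>a\<in>S. \<Sum>b\<in>S. cmod (cnj (f a)) * cmod (cnj (f b)) * G (a - b))"
      proof -
        have "(c * (real_of_int v * real L)) * (cmod (\<Sum>a\<in>S. cnj (f a) * (\<Sum>t<L. (if t \<in> A then 1 else 0) * ef m (a * quad u v t))))\<^sup>2 \<le>
          L * (\<Sum>a\<in>S. \<Sum>b\<in>S. cmod (cnj (f a)) * cmod (cnj (f b)) * cmod (\<Sum>t<L. complex_of_real (of_int (qdiff u v t)) * ef m ((a - b) * quad u v t)))"
        proof (rule duality[OF fin, where c = "\<lambda>t. if t \<in> A then 1 else 0" and w = "\<lambda>t. real_of_int (qdiff u v t)"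
            and ?w0.0 = "c * (real_of_int v * real L)" and \<omega> = "\<lambda>a. cnj (f a)" and P = "quad u v"])
          fix t assume "t < L"
          show "real_of_int (qdiff u v t) > 0" using q0 by simp
          assume "(if t \<in> A then 1 else 0) \<noteq> (0::complex)"
          then have "c * real L \<le> real t" using A by (auto split: if_splits)
          then have "of_int v * (c * real L) \<le> of_int v * real t" using u by (intro mult_left_mono) auto
          also have "\<dots> \<le> real_of_int (qdiff u v t)"
          proof -
            have "v * int t \<ge> 0" using u by simp
            then have "v * int t \<le> qdiff u v t" using u by (simp add: qdiff_eq algebra_simps)
            then have "real_of_int (v * int t) \<le> real_of_int (qdiff u v t)" by (simp only: of_int_le_iff)
            then show ?thesis by simp
          qed
          finally show "c * (real_of_int v * real L) \<le> real_of_int (qdiff u v t)" by (simp add: mult_ac)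
        qed (use c u Lr in \<open>auto intro!: mult_pos_pos\<close>)
        then show ?thesis by (simp add: f_def G_def)
      qed
      also have "(\<Sum>a\<in>S. cnj (f a) * f a) = complex_of_real E"
        unfolding E_def of_real_sum by (intro sum.cong refl) (subst complex_norm_square, rule mult.commute)
      also have "(cmod (complex_of_real E))\<^sup>2 = E * E" by (simp add: power2_eq_square)
      also have "(\<Sum>a\<in>S. \<Sum>b\<in>S. cmod (cnj (f a)) * cmod (cnj (f b)) * G (a - b)) \<le> 4 * (of_int v * (real L)\<^sup>2) * E"
      proof -
        have "(\<Sum>a\<in>S. \<Sum>b\<in>S. cmod (cnj (f a)) * cmod (cnj (f b)) * G (a - b)) \<le>
          (\<Sum>a\<in>S. \<Sum>b\<in>S. (if a = b then (cmod (f a))\<^sup>2 * (3 * (of_int v * (real L)\<^sup>2)) else 0) + cmod (f a) * cmod (f b) * (\<eta> * (of_int v * (real L)\<^sup>2)))"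
        proof (intro sum_mono)
          fix a b assume ab: "a \<in> S" "b \<in> S"
          show "cmod (cnj (f a)) * cmod (cnj (f b)) * G (a - b) \<le>
            (if a = b then (cmod (f a))\<^sup>2 * (3 * (of_int v * (real L)\<^sup>2)) else 0) + cmod (f a) * cmod (f b) * (\<eta> * (of_int v * (real L)\<^sup>2))"
          proof (cases "a = b")
            case True
            have "(cmod (f a))\<^sup>2 * G 0 \<le> (cmod (f a))\<^sup>2 * (3 * (of_int v * (real L)\<^sup>2))" using G0 by (intro mult_left_mono) auto
            moreover have "0 \<le> cmod (f a) * cmod (f a) * (\<eta> * (of_int v * (real L)\<^sup>2))" using eta vL by simp
            ultimately show ?thesis using True by (simp add: power2_eq_square)
          next
            case False
            then show ?thesis using Goff[OF ab False] by (simp add: mult_left_mono)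
          qed
        qed
        also have "\<dots> = 3 * (of_int v * (real L)\<^sup>2) * E + (\<eta> * (of_int v * (real L)\<^sup>2)) * (\<Sum>a\<in>S. cmod (f a))\<^sup>2"
        proof -
          have "(\<Sum>a\<in>S. \<Sum>b\<in>S. if a = b then (cmod (f a))\<^sup>2 * (3 * (of_int v * (real L)\<^sup>2)) else 0) = E * (3 * (of_int v * (real L)\<^sup>2))"
            using fin by (simp add: E_def sum_distrib_right)
          moreover have "(\<Sum>a\<in>S. \<Sum>b\<in>S. cmod (f a) * cmod (f b) * (\<eta> * (of_int v * (real L)\<^sup>2))) = (\<eta> * (of_int v * (real L)\<^sup>2)) * (\<Sum>a\<in>S. cmod (f a))\<^sup>2"
            by (simp add: power2_eq_square sum_product sum_distrib_left mult_ac)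
          ultimately show ?thesis by (simp only: sum.distrib) (simp only: mult.commute)
        qed
        also have "\<dots> \<le> 3 * (of_int v * (real L)\<^sup>2) * E + (\<eta> * (of_int v * (real L)\<^sup>2)) * (real K * E)"
        proof (rule add_left_mono, rule mult_left_mono)
        show "(\<Sum>a\<in>S. cmod (f a))\<^sup>2 \<le> real K * E"
        proof -
          have "(\<Sum>a\<in>S. 1 * cmod (f a))\<^sup>2 \<le> (\<Sum>a\<in>S. 1\<^sup>2) * (\<Sum>a\<in>S. (cmod (f a))\<^sup>2)" by (rule Cauchy_Schwarz_ineq_sum)
          also have "\<dots> \<le> real K * E" using K by (auto simp: E_def intro!: mult_right_mono sum_nonneg)
          finally show ?thesis by simp
        qed
        show "0 \<le> \<eta> * (of_int v * (real L)\<^sup>2)" by (rule mult_nonneg_nonneg[OF less_imp_le[OF eta] less_imp_le[OF vL]])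
        qed
        also have "\<dots> \<le> 3 * (of_int v * (real L)\<^sup>2) * E + 1 * (of_int v * (real L)\<^sup>2) * E"
        proof (rule add_left_mono)
        show "(\<eta> * (of_int v * (real L)\<^sup>2)) * (real K * E) \<le> 1 * (of_int v * (real L)\<^sup>2) * E"
        proof -
          have "\<eta> * real K \<le> 1" by (simp add: \<eta>_def)
          then have "(\<eta> * real K) * ((of_int v * (real L)\<^sup>2) * E) \<le> 1 * ((of_int v * (real L)\<^sup>2) * E)"
          proof (rule mult_right_mono[OF _ mult_nonneg_nonneg[OF less_imp_le[OF vL]]])
            show "E \<ge> 0" by (simp add: E_def sum_nonneg)
          qed
          then show ?thesis by (simp add: mult_ac)
        qed
        qed
        finally show ?thesis by (simp add: algebra_simps)
      qed
      finally have main: "(c * (real_of_int v * real L)) * (E * E) \<le> L * (4 * (of_int v * (real L)\<^sup>2) * E)" by (simp add: mult_left_mono)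
      have "E \<ge> 0" by (simp add: E_def sum_nonneg)
      have "E \<le> 4 / c * (real L)\<^sup>2"
      proof (cases "E = 0")
        case True
        then show ?thesis using c by simp
      next
        case False
        have "(of_int v * real L * E) * (c * E) \<le> (of_int v * real L * E) * (4 * (real L)\<^sup>2)"
          using main by (simp add: power2_eq_square mult_ac)
        moreover have "of_int v * real L * E > 0" using False \<open>E \<ge> 0\<close> u Lr by simp
        ultimately have "c * E \<le> 4 * (real L)\<^sup>2" by (simp only: mult_le_cancel_left_pos)
        then show ?thesis using c by (simp add: field_simps)
      qed
      then show "(\<Sum>a\<in>S. (cmod (\<Sum>t<L. (if t \<in> A then 1 else 0) * ef m (a * quad u v t)))\<^sup>2) \<le> 4 / c * (real L)\<^sup>2"
        by (simp add: E_def f_def)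
    qed
  qed
qed

section \<open>Quadratic recurrence\<close>

lemma nint_sum_le: "finite I \<Longrightarrow> nint (\<Sum>i\<in>I. x i) \<le> (\<Sum>i\<in>I. nint (x i))"
proof (induction I rule: finite_induct)
  case (insert i I)
  then show ?case using nint_add_le[of "x i" "\<Sum>i\<in>I. x i"] by simp
qed (simp add: nint_def)

lemma nint_diff_same_cell:
  assumes n: "n \<ge> 1" and eq: "\<lfloor>frac x * real n\<rfloor> = \<lfloor>frac y * real n\<rfloor>"
  shows "nint (x - y) \<le> 1 / n"
proof -
  have "\<bar>frac x * real n - frac y * real n\<bar> \<le> 1" using eq by linarith
  then have "\<bar>frac x - frac y\<bar> * real n \<le> 1" using n by (simp add: abs_mult flip: left_diff_distrib)
  then have "\<bar>frac x - frac y\<bar> \<le> 1 / n" using n by (simp add: field_simps)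
  moreover have "nint (x - y) \<le> \<bar>x - y - of_int (\<lfloor>x\<rfloor> - \<lfloor>y\<rfloor>)\<bar>" by (rule nint_le)
  moreover have "x - y - of_int (\<lfloor>x\<rfloor> - \<lfloor>y\<rfloor>) = frac x - frac y" by (simp add: frac_def)
  ultimately show ?thesis by simp
qed

lemma floor_frac_less: "n \<ge> 1 \<Longrightarrow> nat \<lfloor>frac x * real n\<rfloor> < n"
proof -
  assume n: "n \<ge> 1"
  have "frac x * real n < 1 * real n" using n frac_lt_1[of x] by (intro mult_strict_right_mono) auto
  then have "\<lfloor>frac x * real n\<rfloor> < int n" by (simp add: floor_less_iff)
  then show ?thesis using n by (simp add: nat_less_iff)
qed

text \<open>By Ramsey's theorem \<open>\<theta> x y\<close> is nearly constant modulo 1 for distinct \<open>x, y\<close> in an infinite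
  set, and so is \<open>\<theta> x\<^sup>2\<close>. If \<open>q\<close> is the difference of the sums of two disjoint sets of \<open>M\<close>
  elements, the mixed terms of \<open>\<theta> q\<^sup>2\<close> cancel up to \<open>2 M (e0 - e1)\<close>, and Dirichlet's theorem supplies \<open>M\<close>.\<close>

lemma quadratic_recurrence:
  fixes \<theta> \<rho> :: real
  assumes rho: "\<rho> > 0"
  shows "\<exists>q::nat. q \<ge> 1 \<and> nint (\<theta> * (real q)\<^sup>2) \<le> \<rho>"
proof -
  \<comment> \<open>The final error is 2/N + 4 M^2/n with M \<le> N; N and n make each part at most
    \<rho>/2.\<close>
  define N where "N = nat \<lceil>4 / \<rho>\<rceil> + 1"
  have N: "N \<ge> 1" "real N \<ge> 4 / \<rho>" unfolding N_def by (simp, linarith)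
  define n where "n = nat \<lceil>8 * (real N)\<^sup>2 / \<rho>\<rceil> + 1"
  have n: "n \<ge> 1" "real n \<ge> 8 * (real N)\<^sup>2 / \<rho>" unfolding n_def by (simp, linarith)
  define cell where "cell x = nat \<lfloor>frac x * real n\<rfloor>" for x :: real
  have same: "nint (x - y) \<le> 1 / n" if "cell x = cell y" for x y
  proof (rule nint_diff_same_cell[OF n(1)])
    have "\<lfloor>frac x * real n\<rfloor> \<ge> 0" "\<lfloor>frac y * real n\<rfloor> \<ge> 0" by (auto simp: zero_le_floor)
    then show "\<lfloor>frac x * real n\<rfloor> = \<lfloor>frac y * real n\<rfloor>" using that unfolding cell_def by (simp only: eq_nat_nat_iff)
  qed
  \<comment> \<open>The pair {x, y} is coloured by the cell of length 1/n that contains the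
    fractional part of \<theta> x y.\<close>
  obtain Y c1 where Y: "Y \<subseteq> {1::nat..}" "infinite Y" and c1: "\<forall>x\<in>Y. \<forall>y\<in>Y. x \<noteq> y \<longrightarrow> cell (\<theta> * real (\<Prod>{x, y})) = c1"
    using Ramsey2[of "{1::nat..}" "\<lambda>X. cell (\<theta> * real (\<Prod>X))" n] floor_frac_less[OF n(1)] infinite_Ici
    unfolding cell_def by blast
  have "finite ((\<lambda>x. cell (\<theta> * (real x)\<^sup>2)) ` Y)"
    by (rule finite_subset[of _ "{..<n}"]) (auto simp: cell_def floor_frac_less[OF n(1)])
  then obtain x0 where x0: "x0 \<in> Y" "infinite {x\<in>Y. cell (\<theta> * (real x)\<^sup>2) = cell (\<theta> * (real x0)\<^sup>2)}"
    using pigeonhole_infinite[OF Y(2)] by blast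
  define Z where "Z = {x\<in>Y. cell (\<theta> * (real x)\<^sup>2) = cell (\<theta> * (real x0)\<^sup>2)}"
  have Z: "infinite Z" "Z \<subseteq> Y" using x0 by (auto simp: Z_def)
  obtain y0 where y0: "y0 \<in> Y" "y0 \<noteq> x0" using Y(2) by (metis finite.emptyI finite.insertI finite_subset insertI1 singletonI subsetI)
  define e0 where "e0 = \<theta> * (real x0)\<^sup>2"
  define e1 where "e1 = \<theta> * (real x0 * real y0)"
  have pair: "nint (\<theta> * (real x * real y) - (if x = y then e0 else e1)) \<le> 1 / n" if "x \<in> Z" "y \<in> Z" for x y
  proof (cases "x = y")
    case True
    then show ?thesis using that by (auto simp: e0_def Z_def power2_eq_square intro!: same)
  next
    case False
    have "cell (\<theta> * real (\<Prod>{x, y})) = cell (\<theta> * real (\<Prod>{x0, y0}))" using c1 that Z x0 y0 False by (auto simp: subset_iff)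
    then show ?thesis using False y0 by (auto simp: e1_def intro!: same)
  qed
  \<comment> \<open>Nothing is known about e0 and e1 themselves. Only a multiple of e0 - e1 has to
    be near an integer, and the multiplier is at our disposal as the number M of elements.\<close>
  obtain h k where k: "0 < k" "k \<le> int N" "\<bar>of_int k * (e0 - e1) - of_int h\<bar> < 1 / N"
  proof -
    have "N > 0" using N by simp
    then show ?thesis using Dirichlet_approx[of N "e0 - e1"] that by blast
  qed
  define M where "M = nat k"
  have M: "M \<ge> 1" "M \<le> N" "nint (real M * (e0 - e1)) \<le> 1 / N"
    using k nint_le[of "real M * (e0 - e1)" h] by (auto simp: M_def)
  obtain B where B: "finite B" "card B = M" "B \<subseteq> Z" using infinite_arbitrarily_large[OF Z(1)] by blast
  \<comment> \<open>Taking P above all of B makes the difference of the two sums positive.\<close>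
  have "infinite (Z - {..Max B})" using Z(1) by simp
  then obtain P where P: "finite P" "card P = M" "P \<subseteq> Z - {..Max B}" using infinite_arbitrarily_large by blast
  have lt: "b < p" if "b \<in> B" "p \<in> P" for b p
    using that P B(1) Max_ge[of B b] by (meson DiffD2 atMost_iff le_less_trans not_le subsetD)
  have disj: "P \<inter> B = {}" using lt by blast
  define q where "q = \<Sum>P - \<Sum>B"
  have PB: "\<Sum>B < \<Sum>P"
  proof -
    have "B \<noteq> {}" "P \<noteq> {}" using B P M by auto
    have "\<Sum>B \<le> (\<Sum>b\<in>B. Max B)" using B by (intro sum_mono) auto
    also have "\<dots> = (\<Sum>p\<in>P. Max B)" using B P by simp
    also have "\<dots> < \<Sum>P"
    proof (rule sum_strict_mono)
      show "P \<noteq> {}" by fact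
      fix p assume "p \<in> P" then show "Max B < p" using P by auto
    qed (use P in auto)
    finally show ?thesis .
  qed
  have q1: "q \<ge> 1" using PB by (simp add: q_def)
  define s where "s x = (if x \<in> P then 1 else - 1 :: int)" for x :: nat
  define F where "F = P \<union> B"
  have F: "finite F" "F \<subseteq> Z" "card F = 2 * M" using P B disj by (auto simp: F_def card_Un_disjoint)
  have sumF: "(\<Sum>x\<in>F. g x * of_int (s x)) = (\<Sum>x\<in>P. g x) - (\<Sum>x\<in>B. g x)" for g :: "nat \<Rightarrow> real"
  proof -
    have "(\<Sum>x\<in>F. g x * of_int (s x)) = (\<Sum>x\<in>P. g x * of_int (s x)) + (\<Sum>x\<in>B. g x * of_int (s x))"
      unfolding F_def using P B disj by (intro sum.union_disjoint) auto
    also have "(\<Sum>x\<in>P. g x * of_int (s x)) = (\<Sum>x\<in>P. g x)" by (intro sum.cong) (auto simp: s_def)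
    also have "(\<Sum>x\<in>B. g x * of_int (s x)) = (\<Sum>x\<in>B. - g x)" using disj by (intro sum.cong) (auto simp: s_def)
    finally show ?thesis by (simp add: sum_negf)
  qed
  have qe: "real q = (\<Sum>x\<in>F. real x * of_int (s x))"
    using PB by (simp add: sumF q_def of_nat_diff)
  have s0: "(\<Sum>x\<in>F. real_of_int (s x)) = 0" using sumF[of "\<lambda>_. 1"] P B by simp
  have ss: "s x * s y = 1 \<or> s x * s y = - 1" for x y by (auto simp: s_def)
  have sq: "\<theta> * (real q)\<^sup>2 = (\<Sum>x\<in>F. \<Sum>y\<in>F. of_int (s x * s y) * (\<theta> * (real x * real y)))"
    by (simp add: qe power2_eq_square sum_product sum_distrib_left mult_ac)
  \<comment> \<open>As the signs add up to 0, the contribution of e1 cancels and only the 2 M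
    diagonal terms e0 - e1 survive.\<close>
  have me: "(\<Sum>x\<in>F. \<Sum>y\<in>F. of_int (s x * s y) * (if x = y then e0 else e1)) = 2 * (real M * (e0 - e1))"
  proof -
    have "of_int (s x * s y) * (if x = y then e0 else e1) = (if x = y then e0 - e1 else 0) + e1 * (of_int (s x) * of_int (s y))" for x y
      by (auto simp: s_def algebra_simps)
    then have "(\<Sum>x\<in>F. \<Sum>y\<in>F. of_int (s x * s y) * (if x = y then e0 else e1)) =
      (\<Sum>x\<in>F. \<Sum>y\<in>F. if x = y then e0 - e1 else 0) + (\<Sum>x\<in>F. \<Sum>y\<in>F. e1 * (of_int (s x) * of_int (s y)))"
      by (simp only: sum.distrib)
    also have "(\<Sum>x\<in>F. \<Sum>y\<in>F. if x = y then e0 - e1 else 0) = (\<Sum>x\<in>F. e0 - e1)" using F by simp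
    also have "(\<Sum>x\<in>F. \<Sum>y\<in>F. e1 * (of_int (s x) * of_int (s y))) = e1 * ((\<Sum>x\<in>F. of_int (s x)) * (\<Sum>x\<in>F. of_int (s x)))"
      by (subst sum_product) (simp only: sum_distrib_left)
    finally show ?thesis using F s0 by simp
  qed
  have "\<theta> * (real q)\<^sup>2 = 2 * (real M * (e0 - e1)) + (\<Sum>x\<in>F. \<Sum>y\<in>F. of_int (s x * s y) * (\<theta> * (real x * real y) - (if x = y then e0 else e1)))"
    unfolding me[symmetric] sq by (simp only: right_diff_distrib sum_subtractf)
  then have "nint (\<theta> * (real q)\<^sup>2) \<le> nint (2 * (real M * (e0 - e1))) + nint (\<Sum>x\<in>F. \<Sum>y\<in>F. of_int (s x * s y) * (\<theta> * (real x * real y) - (if x = y then e0 else e1)))"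
    by (simp only: nint_add_le)
  also have "nint (2 * (real M * (e0 - e1))) \<le> 2 * (1 / N)"
    using nint_mult_nat_le[of 2 "real M * (e0 - e1)"] M(3) by simp
  also have "nint (\<Sum>x\<in>F. \<Sum>y\<in>F. of_int (s x * s y) * (\<theta> * (real x * real y) - (if x = y then e0 else e1)))
    \<le> (\<Sum>x\<in>F. \<Sum>y\<in>F. 1 / n)"
  proof (intro order.trans[OF nint_sum_le[OF F(1)]] sum_mono)
    fix x y assume "x \<in> F" "y \<in> F"
    then have "nint (\<theta> * (real x * real y) - (if x = y then e0 else e1)) \<le> 1 / n" using F(2) by (intro pair) auto
    moreover have "nint (of_int (s x * s y) * z) \<le> nint z" for z
    proof -
      from ss[of x y] have "\<bar>real_of_int (s x * s y)\<bar> = 1"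
        by (elim disjE) (simp_all only: of_int_1 of_int_minus abs_one abs_minus_cancel)
      then show ?thesis using nint_mult_int_le[of "s x * s y" z] by (simp only: mult_1)
    qed
    ultimately show "nint (of_int (s x * s y) * (\<theta> * (real x * real y) - (if x = y then e0 else e1))) \<le> 1 / n"
      by (meson order.trans)
  qed
  also have "(\<Sum>x\<in>F. \<Sum>y\<in>F. 1 / real n) = 4 * (real M)\<^sup>2 / n" using F by (simp add: power2_eq_square)
  also have "2 * (1 / N) + 4 * (real M)\<^sup>2 / n \<le> \<rho> / 2 + \<rho> / 2"
  proof (intro add_mono)
    show "2 * (1 / real N) \<le> \<rho> / 2" using N rho by (simp add: field_simps)
    have "4 * (real M)\<^sup>2 / n \<le> 4 * (real N)\<^sup>2 / n" using M by (intro divide_right_mono mult_left_mono power_mono) auto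
    also have "\<dots> \<le> \<rho> / 2" using n rho by (simp add: field_simps)
    finally show "4 * (real M)\<^sup>2 / n \<le> \<rho> / 2" .
  qed
  finally show ?thesis using q1 by auto
qed

text \<open>Compactness of [0, 1]: a q that works for one \<theta> with half the tolerance works in
  a neighbourhood, and the distance of \<theta> q^2 to the integers has period 1 in
  \<theta>.\<close>

lemma quadratic_recurrence_uniform:
  fixes \<rho> :: real
  assumes rho: "\<rho> > 0"
  shows "\<exists>Q::nat. \<forall>\<theta>. \<exists>q. 1 \<le> q \<and> q \<le> Q \<and> nint (\<theta> * (real q)\<^sup>2) \<le> \<rho>"
proof -
  obtain q where q: "\<And>\<theta>. q \<theta> \<ge> (1::nat)" "\<And>\<theta>. nint (\<theta> * (real (q \<theta>))\<^sup>2) \<le> \<rho> / 2"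
    using quadratic_recurrence[of "\<rho> / 2"] rho by (metis half_gt_zero)
  have "compact {0..1::real}" by simp
  then obtain C where C: "finite C" "{0..1} \<subseteq> (\<Union>\<theta>\<in>C. ball \<theta> (\<rho> / (2 * (real (q \<theta>))\<^sup>2)))"
  proof (rule compactE_image[of _ UNIV "\<lambda>\<theta>. ball \<theta> (\<rho> / (2 * (real (q \<theta>))\<^sup>2))"])
    show "{0..1} \<subseteq> (\<Union>\<theta>\<in>UNIV. ball \<theta> (\<rho> / (2 * (real (q \<theta>))\<^sup>2)))"
    proof
      fix x :: real
      have "real (q x) \<ge> 1" using q(1)[of x] by simp
      then have "x \<in> ball x (\<rho> / (2 * (real (q x))\<^sup>2))" using rho by simp
      then show "x \<in> (\<Union>\<theta>\<in>UNIV. ball \<theta> (\<rho> / (2 * (real (q \<theta>))\<^sup>2)))" by blast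
    qed
  qed auto
  have "\<exists>q'. 1 \<le> q' \<and> q' \<le> Max (q ` C) \<and> nint (\<theta> * (real q')\<^sup>2) \<le> \<rho>" for \<theta>
  proof -
    have "frac \<theta> \<in> {0..1}" using frac_lt_1[of \<theta>] by (simp add: less_imp_le)
    then have "frac \<theta> \<in> (\<Union>\<theta>\<in>C. ball \<theta> (\<rho> / (2 * (real (q \<theta>))\<^sup>2)))" using C(2) by blast
    then obtain t where t: "t \<in> C" "dist t (frac \<theta>) < \<rho> / (2 * (real (q t))\<^sup>2)" by auto
    have qp: "real (q t) \<ge> 1" using q(1)[of t] by simp
    have "\<theta> * (real (q t))\<^sup>2 = (t * (real (q t))\<^sup>2 + (frac \<theta> - t) * (real (q t))\<^sup>2) + of_int (\<lfloor>\<theta>\<rfloor> * (int (q t))\<^sup>2)"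
      by (simp add: frac_def algebra_simps)
    then have "nint (\<theta> * (real (q t))\<^sup>2) = nint (t * (real (q t))\<^sup>2 + (frac \<theta> - t) * (real (q t))\<^sup>2)" by (simp only: nint_add_int)
    also have "\<dots> \<le> nint (t * (real (q t))\<^sup>2) + nint ((frac \<theta> - t) * (real (q t))\<^sup>2)" by (rule nint_add_le)
    also have "\<dots> \<le> \<rho> / 2 + \<bar>(frac \<theta> - t) * (real (q t))\<^sup>2\<bar>" by (intro add_mono q nint_le_abs)
    also have "\<bar>(frac \<theta> - t) * (real (q t))\<^sup>2\<bar> \<le> \<rho> / 2"
    proof -
      have "\<bar>frac \<theta> - t\<bar> \<le> \<rho> / (2 * (real (q t))\<^sup>2)" using t(2) by (simp add: dist_real_def abs_minus_commute)
      then have "\<bar>frac \<theta> - t\<bar> * (real (q t))\<^sup>2 \<le> \<rho> / (2 * (real (q t))\<^sup>2) * (real (q t))\<^sup>2" by (intro mult_right_mono) auto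
      also have "\<dots> = \<rho> / 2" using qp by simp
      finally show ?thesis by (simp add: abs_mult)
    qed
    finally have "nint (\<theta> * (real (q t))\<^sup>2) \<le> \<rho>" by simp
    then show ?thesis using q(1)[of t] C(1) t(1) by (intro exI[of _ "q t"]) auto
  qed
  then show ?thesis by blast
qed

text \<open>By induction on K: first q1 serves the new frequency with tolerance \<rho>/Q^2, then q2
  \<le> Q serves the old frequencies multiplied by q1^2. Passing to q1 q2 enlarges the first
  distance by at most Q^2.\<close>

lemma quadratic_recurrence_simultaneous:
  fixes \<rho> :: real and K :: nat
  assumes rho: "\<rho> > 0"
  shows "\<exists>Q::nat. \<forall>\<theta>. \<exists>q. 1 \<le> q \<and> q \<le> Q \<and> (\<forall>i<K. nint (\<theta> i * (real q)\<^sup>2) \<le> \<rho>)"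
proof (induction K)
  case 0 then show ?case by (intro exI[of _ 1]) auto
next
  case (Suc K)
  then obtain Q where Q: "\<forall>\<theta>. \<exists>q. 1 \<le> q \<and> q \<le> Q \<and> (\<forall>i<K. nint (\<theta> i * (real q)\<^sup>2) \<le> \<rho>)" by blast
  then have Q1: "Q \<ge> 1" by (metis order.trans)
  define \<rho>' where "\<rho>' = \<rho> / (real Q)\<^sup>2"
  have "\<rho>' > 0" using rho Q1 by (simp add: \<rho>'_def)
  then obtain Q' where Q': "\<forall>\<theta>. \<exists>q. 1 \<le> q \<and> q \<le> Q' \<and> nint (\<theta> * (real q)\<^sup>2) \<le> \<rho>'"
    using quadratic_recurrence_uniform by blast
  have "\<exists>q. 1 \<le> q \<and> q \<le> Q' * Q \<and> (\<forall>i<Suc K. nint (\<theta> i * (real q)\<^sup>2) \<le> \<rho>)" for \<theta> :: "nat \<Rightarrow> real"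
  proof -
    obtain q1 where q1: "1 \<le> q1" "q1 \<le> Q'" "nint (\<theta> K * (real q1)\<^sup>2) \<le> \<rho>'" using Q' by blast
    obtain q2 where q2: "1 \<le> q2" "q2 \<le> Q" "\<forall>i<K. nint ((\<theta> i * (real q1)\<^sup>2) * (real q2)\<^sup>2) \<le> \<rho>"
      using Q[rule_format, of "\<lambda>i. \<theta> i * (real q1)\<^sup>2"] by blast
    have "nint (\<theta> K * (real (q1 * q2))\<^sup>2) = nint (of_nat (q2\<^sup>2) * (\<theta> K * (real q1)\<^sup>2))" by (simp add: power_mult_distrib mult_ac)
    also have "\<dots> \<le> of_nat (q2\<^sup>2) * nint (\<theta> K * (real q1)\<^sup>2)" by (rule nint_mult_nat_le)
    also have "\<dots> \<le> (real Q)\<^sup>2 * \<rho>'" using q1 q2 by (intro mult_mono) (auto intro: power_mono)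
    also have "\<dots> = \<rho>" using Q1 by (simp add: \<rho>'_def)
    finally have K: "nint (\<theta> K * (real (q1 * q2))\<^sup>2) \<le> \<rho>" .
    have "nint (\<theta> i * (real (q1 * q2))\<^sup>2) \<le> \<rho>" if "i < K" for i
      using q2(3) that by (simp add: power_mult_distrib mult_ac)
    with K have "\<forall>i<Suc K. nint (\<theta> i * (real (q1 * q2))\<^sup>2) \<le> \<rho>" by (auto simp: less_Suc_eq)
    moreover have "q1 * q2 \<le> Q' * Q" using q1 q2 by (intro mult_mono) auto
    moreover have "1 \<le> q1 * q2" using q1 q2 by simp
    ultimately show ?thesis by blast
  qed
  then show ?case by blast
qed

text \<open>For each n, recurrence applied to the frequencies a n^2/m gives q, homogeneity applied
  to n q gives k, and n q k lies in Y. The tolerance 1/(100 M^2) pays for the factor k^2. The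
  multiplier s = q k depends on n, but the pair (n s, s) determines n, so at most a factor Q M is
  lost.\<close>

lemma return_set_large:
  fixes Q M X m :: nat and S :: "int set" and B :: "nat set"
  assumes rec: "\<forall>\<theta>::nat \<Rightarrow> real. \<exists>q. 1 \<le> q \<and> q \<le> Q \<and> (\<forall>i<K. nint (\<theta> i * (real q)\<^sup>2) \<le> 1 / (100 * (real M)\<^sup>2))"
    and hom: "\<forall>q\<ge>1. \<exists>k. 1 \<le> k \<and> k \<le> M \<and> q * k \<in> B"
    and S: "finite S" "card S \<le> K" and Q: "Q \<ge> 1" and M: "M \<ge> 1"
  defines "Y \<equiv> {y. 1 \<le> y \<and> y \<le> X \<and> y \<in> B \<and> (\<forall>a\<in>S. nint (of_int a / real m * (real y)\<^sup>2) \<le> 1/100)}"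
  shows "X div (Q * M) \<le> (Q * M) * card Y"
proof -
  obtain f where f: "S = f ` {..<card S}"
    using ex_bij_betw_nat_finite[OF S(1)] by (metis atLeast0LessThan bij_betw_imp_surj_on)
  have ex: "\<exists>s. 1 \<le> s \<and> s \<le> Q * M \<and> n * s \<in> Y" if n: "n \<in> {1..X div (Q * M)}" for n
  proof -
    obtain q where q: "1 \<le> q" "q \<le> Q" "\<forall>i<K. nint ((of_int (f i) / real m * (real n)\<^sup>2) * (real q)\<^sup>2) \<le> 1 / (100 * (real M)\<^sup>2)"
      using rec[rule_format, of "\<lambda>i. of_int (f i) / real m * (real n)\<^sup>2"] by blast
    have "n * q \<ge> 1" using n q by simp
    then obtain k where k: "1 \<le> k" "k \<le> M" "(n * q) * k \<in> B" using hom by blast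
    have s: "1 \<le> q * k" "q * k \<le> Q * M" using q k by (simp, intro mult_mono) auto
    have "n * (q * k) \<le> (X div (Q * M)) * (Q * M)" by (rule mult_le_mono) (use n s in auto)
    also have "\<dots> \<le> X" by simp
    finally have le: "n * (q * k) \<le> X" .
    have "nint (of_int a / real m * (real (n * (q * k)))\<^sup>2) \<le> 1/100" if "a \<in> S" for a
    proof -
      have "a \<in> f ` {..<card S}" by (subst f[symmetric]) (rule that)
      then obtain i where i: "i < card S" "a = f i" by blast
      have "of_int a / real m * (real (n * (q * k)))\<^sup>2 = of_nat (k\<^sup>2) * ((of_int (f i) / real m * (real n)\<^sup>2) * (real q)\<^sup>2)"
        by (simp add: i power_mult_distrib)
      then have "nint (of_int a / real m * (real (n * (q * k)))\<^sup>2) \<le> of_nat (k\<^sup>2) * nint ((of_int (f i) / real m * (real n)\<^sup>2) * (real q)\<^sup>2)"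
        by (simp only: nint_mult_nat_le)
      also have "\<dots> \<le> (real M)\<^sup>2 * (1 / (100 * (real M)\<^sup>2))"
        using q(3) i S(2) k by (intro mult_mono) (auto intro: power_mono)
      also have "\<dots> = 1/100" using M by simp
      finally show ?thesis .
    qed
    then have "n * (q * k) \<in> Y" using le k n q by (simp add: Y_def mult.assoc)
    then show ?thesis using s by blast
  qed
  then obtain s where s: "\<And>n. n \<in> {1..X div (Q * M)} \<Longrightarrow> 1 \<le> s n \<and> s n \<le> Q * M \<and> n * s n \<in> Y" by metis
  have finY: "finite Y" by (rule finite_subset[of _ "{..X}"]) (auto simp: Y_def)
  have "card {1..X div (Q * M)} \<le> card (Y \<times> {1..Q * M})"
  proof (rule card_inj_on_le[where f = "\<lambda>n. (n * s n, s n)"])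
    show "inj_on (\<lambda>n. (n * s n, s n)) {1..X div (Q * M)}"
      using s by (intro inj_onI) fastforce
    show "(\<lambda>n. (n * s n, s n)) ` {1..X div (Q * M)} \<subseteq> Y \<times> {1..Q * M}"
      using s by auto
  qed (use finY in simp)
  then show ?thesis by (simp add: card_cartesian_product mult.commute)
qed

section \<open>Counting solutions from the large spectrum\<close>

lemma solution_count_identity:
  fixes \<phi> \<psi> :: "nat \<Rightarrow> int"
  assumes fin: "finite A" "finite Y" and m: "m > 0"
  defines "f \<equiv> \<lambda>a. \<Sum>t\<in>A. ef m (a * \<phi> t)" and "g \<equiv> \<lambda>a. \<Sum>y\<in>Y. ef m (a * \<psi> y)"
  shows "(\<Sum>a\<in>{0..<int m}. f a * cnj (f a) * (cnj (g a)) ^ 3) =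
    of_nat m * of_nat (card {(t1, t2, y1, y2, y3). t1 \<in> A \<and> t2 \<in> A \<and> y1 \<in> Y \<and> y2 \<in> Y \<and> y3 \<in> Y \<and>
      int m dvd \<phi> t1 - \<phi> t2 - (\<psi> y1 + \<psi> y2 + \<psi> y3)})"
proof -
  define D where "D = (\<lambda>(t1, t2, y1, y2, y3). \<phi> t1 - \<phi> t2 - (\<psi> y1 + \<psi> y2 + \<psi> y3))"
  define W where "W = A \<times> A \<times> Y \<times> Y \<times> Y"
  have "f a * cnj (f a) * (cnj (g a)) ^ 3 = (\<Sum>x\<in>W. ef m (a * D x))" for a
  proof -
    have "(\<Sum>x\<in>W. ef m (a * D x)) = (\<Sum>t1\<in>A. \<Sum>t2\<in>A. \<Sum>y1\<in>Y. \<Sum>y2\<in>Y. \<Sum>y3\<in>Y. ef m (a * (\<phi> t1 - \<phi> t2 - (\<psi> y1 + \<psi> y2 + \<psi> y3))))"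
      by (simp add: W_def D_def sum.cartesian_product case_prod_unfold)
    also have "\<dots> = (\<Sum>t1\<in>A. \<Sum>t2\<in>A. \<Sum>y1\<in>Y. \<Sum>y2\<in>Y. \<Sum>y3\<in>Y.
       ef m (a * \<phi> t1) * (cnj (ef m (a * \<phi> t2)) * (cnj (ef m (a * \<psi> y1)) * (cnj (ef m (a * \<psi> y2)) * cnj (ef m (a * \<psi> y3))))))"
      by (intro sum.cong refl) (simp add: right_diff_distrib distrib_left ef_diff ef_add mult_ac)
    also have "\<dots> = f a * (cnj (f a) * (cnj (g a) * (cnj (g a) * cnj (g a))))"
      by (simp only: sum_distrib_left[symmetric] sum_distrib_right[symmetric] f_def g_def cnj_sum)
    finally show ?thesis by (simp add: power3_eq_cube mult_ac)
  qed
  then have "(\<Sum>a\<in>{0..<int m}. f a * cnj (f a) * (cnj (g a)) ^ 3) = (\<Sum>x\<in>W. \<Sum>a\<in>{0..<int m}. ef m (a * D x))"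
    by (simp only:) (rule sum.swap)
  also have "\<dots> = (\<Sum>x\<in>W. if int m dvd D x then of_nat m else 0)" by (simp only: sum_ef[OF m])
  also have "\<dots> = (\<Sum>x\<in>{x\<in>W. int m dvd D x}. of_nat m)"
    using fin by (subst sum.inter_filter) (auto simp: W_def)
  also have "{x\<in>W. int m dvd D x} = {(t1, t2, y1, y2, y3). t1 \<in> A \<and> t2 \<in> A \<and> y1 \<in> Y \<and> y2 \<in> Y \<and> y3 \<in> Y \<and>
      int m dvd \<phi> t1 - \<phi> t2 - (\<psi> y1 + \<psi> y2 + \<psi> y3)}"
    by (auto simp: W_def D_def)
  finally show ?thesis by (simp add: mult.commute)
qed

lemma Re_cube_ge:
  fixes w :: complex and n :: real
  assumes "cmod (w - of_real n) \<le> n / 10" "n \<ge> 0"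
  shows "Re (w ^ 3) \<ge> n ^ 3 / 2"
proof -
  define d where "d = w - of_real n"
  have d: "cmod d \<le> n / 10" using assms by (simp add: d_def)
  have "w ^ 3 - of_real (n ^ 3) = d * (3 * of_real n * of_real n + 3 * of_real n * d + d * d)"
    by (simp add: d_def power3_eq_cube algebra_simps)
  then have "cmod (w ^ 3 - of_real (n ^ 3)) \<le> cmod d * (cmod (3 * of_real n * of_real n :: complex) + cmod (3 * of_real n * d) + cmod (d * d))"
    by (simp only: norm_mult) (intro mult_left_mono order.trans[OF norm_triangle_ineq] add_mono norm_triangle_ineq, auto simp: norm_mult)
  also have "\<dots> = cmod d * (3 * n * n + 3 * n * cmod d + cmod d * cmod d)" using assms(2) by (simp add: norm_mult)
  also have "\<dots> \<le> n / 10 * (3 * n * n + 3 * n * (n / 10) + n / 10 * (n / 10))"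
    using d assms(2) by (intro mult_mono add_mono) auto
  also have "\<dots> \<le> n ^ 3 / 2" using assms(2) by (simp add: power3_eq_cube field_simps)
  finally have "\<bar>Re (w ^ 3 - of_real (n ^ 3))\<bar> \<le> n ^ 3 / 2" using abs_Re_le_cmod order.trans by blast
  then show ?thesis by (simp only: minus_complex.sel Re_complex_of_real)
qed

text \<open>Since 2 + 3 exceeds 49/10 by 1/10, a factor \<alpha>^(1/10) \<le> \<epsilon>^(1/10) can
  be set aside, and the rest is at most the larger of the two powers. This is where a restriction
  exponent below 5 pays off.\<close>

lemma mixed_power_bound:
  fixes \<alpha> \<beta> \<epsilon> :: real
  assumes "0 \<le> \<alpha>" "\<alpha> \<le> \<epsilon>" "0 \<le> \<beta>"
  shows "\<alpha>\<^sup>2 * \<beta> ^ 3 \<le> \<epsilon> powr (1/10) * (\<alpha> powr (49/10) + \<beta> powr (49/10))"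
proof (cases "\<alpha> = 0 \<or> \<beta> = 0")
  case True then show ?thesis by (auto intro!: mult_nonneg_nonneg)
next
  case False
  then have p: "\<alpha> > 0" "\<beta> > 0" using assms by auto
  have "\<alpha>\<^sup>2 * \<beta> ^ 3 = \<alpha> powr (1/10) * (\<alpha> powr (19/10) * \<beta> powr 3)"
  proof -
    have "\<alpha>\<^sup>2 = \<alpha> powr 2" using p by simp
    also have "\<dots> = \<alpha> powr (1/10) * \<alpha> powr (19/10)" by (subst powr_add[symmetric]) simp
    finally show ?thesis using p by simp
  qed
  also have "\<alpha> powr (19/10) * \<beta> powr 3 \<le> max \<alpha> \<beta> powr (19/10) * max \<alpha> \<beta> powr 3"
    using p by (intro mult_mono powr_mono2) auto
  also have "\<dots> = max \<alpha> \<beta> powr (49/10)" by (subst powr_add[symmetric]) simp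
  also have "\<dots> \<le> \<alpha> powr (49/10) + \<beta> powr (49/10)" by (auto simp: max_def)
  finally have "\<alpha>\<^sup>2 * \<beta> ^ 3 \<le> \<alpha> powr (1/10) * (\<alpha> powr (49/10) + \<beta> powr (49/10))" by (simp add: mult_left_mono)
  also have "\<dots> \<le> \<epsilon> powr (1/10) * (\<alpha> powr (49/10) + \<beta> powr (49/10))"
    using assms by (intro mult_right_mono powr_mono2) auto
  finally show ?thesis .
qed

lemma pigeonhole_increments:
  fixes E :: "nat \<Rightarrow> real"
  assumes "E 0 \<ge> 0" "E J < real J * d"
  shows "\<exists>j<J. E (Suc j) - E j \<le> d"
proof (rule ccontr)
  assume "\<not> (\<exists>j<J. E (Suc j) - E j \<le> d)"
  then have a: "E (Suc j) - E j > d" if "j < J" for j using that by force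
  have "E j \<ge> real j * d" if "j \<le> J" for j
    using that
  proof (induction j)
    case (Suc j)
    then show ?case using a[of j] by (simp add: algebra_simps)
  qed (use assms in simp)
  from this[of J] show False using assms by simp
qed

text \<open>Spectral sets of the indicator of \<open>A\<close> at two consecutive thresholds, and a set \<open>Y\<close> on which the
  characters from the first one are nearly trivial: the first set gives the main term, the increment of
  energy and the restriction estimate control the rest.\<close>

lemma count_from_spectrum:
  fixes A Y :: "nat set" and S S' :: "int set" and \<phi> \<psi> :: "nat \<Rightarrow> int" and m L Ly :: nat and \<epsilon> C C' :: real
  assumes fin: "finite A" "finite Y" and m: "m > 0" and L: "L \<ge> 1" "Ly \<ge> 1"
  defines "f \<equiv> \<lambda>a. \<Sum>t\<in>A. ef m (a * \<phi> t)" and "g \<equiv> \<lambda>a. \<Sum>y\<in>Y. ef m (a * \<psi> y)"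
  assumes S: "S \<subseteq> S'" "S' \<subseteq> {0..<int m}" and zero: "0 \<in> S"
    and S': "\<And>a. a \<in> {0..<int m} - S' \<Longrightarrow> cmod (f a) \<le> \<epsilon> * L"
    and Y: "\<And>a y. a \<in> S \<Longrightarrow> y \<in> Y \<Longrightarrow> nint (of_int (a * \<psi> y) / real m) \<le> 1/100"
    and incr: "(\<Sum>a\<in>S'. (cmod (f a))\<^sup>2) - (\<Sum>a\<in>S. (cmod (f a))\<^sup>2) \<le> (real (card A))\<^sup>2 / 8"
    and LA: "(\<Sum>a\<in>{0..<int m}. (cmod (f a) / L) powr (49/10)) \<le> C"
    and LY: "(\<Sum>a\<in>{0..<int m}. (cmod (g a) / Ly) powr (49/10)) \<le> C'"
    and small: "(real L)\<^sup>2 * real Ly ^ 3 * (\<epsilon> powr (1/10) * (C + C')) \<le> (real (card A))\<^sup>2 / 8 * real (card Y) ^ 3"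
  shows "(real (card A))\<^sup>2 * real (card Y) ^ 3 / 4 \<le> m * real (card {(t1, t2, y1, y2, y3). t1 \<in> A \<and> t2 \<in> A \<and> y1 \<in> Y \<and> y2 \<in> Y \<and> y3 \<in> Y \<and>
      int m dvd \<phi> t1 - \<phi> t2 - (\<psi> y1 + \<psi> y2 + \<psi> y3)})"
    (is "_ \<le> m * real (card ?Sol)")
proof -
  define n where "n = real (card Y)"
  define U where "U = {0..<int m}"
  define E where "E = (\<Sum>a\<in>S. (cmod (f a))\<^sup>2)"
  have SU: "S \<subseteq> U" "S' \<subseteq> U" "finite S" "finite S'" "finite U"
    using S finite_subset[of S' "{0..<int m}"] finite_subset[of S "{0..<int m}"] by (auto simp: U_def)
  have n0: "n \<ge> 0" by (simp add: n_def)
  have gn: "cmod (g a) \<le> n" for a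
    unfolding g_def n_def using sum_norm_bound[of Y "\<lambda>y. ef m (a * \<psi> y)" 1] by simp
  \<comment> \<open>The frequency 0 alone supplies this energy.\<close>
  have E0: "(real (card A))\<^sup>2 \<le> E"
  proof -
    have "(cmod (f 0))\<^sup>2 \<le> E" unfolding E_def using zero SU by (intro member_le_sum) auto
    moreover have "f 0 = of_nat (card A)" by (simp add: f_def)
    ultimately show ?thesis by simp
  qed
  define G where "G a = Re (f a * cnj (f a) * (cnj (g a)) ^ 3)" for a
  have Geq: "G a = (cmod (f a))\<^sup>2 * Re ((cnj (g a)) ^ 3)" for a
  proof -
    have "f a * cnj (f a) * (cnj (g a)) ^ 3 = of_real ((cmod (f a))\<^sup>2) * (cnj (g a)) ^ 3"
      by (simp only: complex_norm_square)
    moreover have "Re (of_real x * z) = x * Re z" for x z by simp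
    ultimately show ?thesis unfolding G_def by (simp only:)
  qed
  have Glow: "G a \<ge> - ((cmod (f a))\<^sup>2 * cmod (g a) ^ 3)" for a
  proof -
    have "\<bar>Re ((cnj (g a)) ^ 3)\<bar> \<le> cmod (g a) ^ 3"
      using abs_Re_le_cmod[of "(cnj (g a)) ^ 3"] by (simp add: norm_power)
    then have "- (cmod (g a) ^ 3) \<le> Re ((cnj (g a)) ^ 3)" by linarith
    then have "(cmod (f a))\<^sup>2 * - (cmod (g a) ^ 3) \<le> (cmod (f a))\<^sup>2 * Re ((cnj (g a)) ^ 3)" by (intro mult_left_mono) auto
    then show ?thesis by (simp add: Geq)
  qed
  have p1: "(\<Sum>a\<in>S. G a) \<ge> n ^ 3 / 2 * E"
  proof -
    have "n ^ 3 / 2 * (cmod (f a))\<^sup>2 \<le> G a" if a: "a \<in> S" for a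
    proof -
      have "cmod (g a - of_real n) = cmod (\<Sum>y\<in>Y. ef m (a * \<psi> y) - 1)" by (simp add: g_def n_def sum_subtractf)
      also have "\<dots> \<le> (\<Sum>y\<in>Y. 1/10)"
      proof (rule sum_norm_le)
        fix y assume y: "y \<in> Y"
        have "cmod (ef m (a * \<psi> y) - 1) \<le> 2 * pi * nint (of_int (a * \<psi> y) / real m)"
          unfolding ef_def by (rule eexp_minus_1_le_nint)
        also have "\<dots> \<le> (2 * 4) * (1/100)" using Y[OF a y] pi_less_4 by (intro mult_mono) auto
        finally show "cmod (ef m (a * \<psi> y) - 1) \<le> 1/10" by simp
      qed
      also have "\<dots> = n / 10" by (simp add: n_def)
      finally have "cmod (cnj (g a - of_real n)) \<le> n / 10" by (simp only: complex_mod_cnj)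
      then have "cmod (cnj (g a) - of_real n) \<le> n / 10" by simp
      then have "Re ((cnj (g a)) ^ 3) \<ge> n ^ 3 / 2" using n0 by (rule Re_cube_ge)
      then have "(cmod (f a))\<^sup>2 * (n ^ 3 / 2) \<le> G a" unfolding Geq by (intro mult_left_mono) auto
      then show ?thesis by (simp add: mult.commute)
    qed
    then show ?thesis unfolding E_def sum_distrib_left by (intro sum_mono)
  qed
  have p2: "(\<Sum>a\<in>S' - S. G a) \<ge> - (n ^ 3 * ((real (card A))\<^sup>2 / 8))"
  proof -
    have "(\<Sum>a\<in>S' - S. (cmod (f a))\<^sup>2 * cmod (g a) ^ 3) \<le> (\<Sum>a\<in>S' - S. (cmod (f a))\<^sup>2 * n ^ 3)"
      using gn by (intro sum_mono mult_left_mono power_mono) auto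
    also have "\<dots> = n ^ 3 * (\<Sum>a\<in>S' - S. (cmod (f a))\<^sup>2)" by (simp add: sum_distrib_left mult.commute)
    also have "(\<Sum>a\<in>S' - S. (cmod (f a))\<^sup>2) = (\<Sum>a\<in>S'. (cmod (f a))\<^sup>2) - E"
      unfolding E_def using SU S(1) by (simp add: sum_diff)
    also have "n ^ 3 * ((\<Sum>a\<in>S'. (cmod (f a))\<^sup>2) - E) \<le> n ^ 3 * ((real (card A))\<^sup>2 / 8)"
      using incr n0 by (intro mult_left_mono) (auto simp: E_def)
    finally have "(\<Sum>a\<in>S' - S. (cmod (f a))\<^sup>2 * cmod (g a) ^ 3) \<le> n ^ 3 * ((real (card A))\<^sup>2 / 8)" .
    moreover have "(\<Sum>a\<in>S' - S. G a) \<ge> (\<Sum>a\<in>S' - S. - ((cmod (f a))\<^sup>2 * cmod (g a) ^ 3))" by (intro sum_mono Glow)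
    ultimately show ?thesis by (simp add: sum_negf)
  qed
  have p3: "(\<Sum>a\<in>U - S'. G a) \<ge> - (n ^ 3 * ((real (card A))\<^sup>2 / 8))"
  proof -
    define \<alpha> where "\<alpha> a = cmod (f a) / L" for a
    define \<beta> where "\<beta> a = cmod (g a) / Ly" for a
    have "(\<Sum>a\<in>U - S'. (cmod (f a))\<^sup>2 * cmod (g a) ^ 3) = (\<Sum>a\<in>U - S'. (real L)\<^sup>2 * real Ly ^ 3 * ((\<alpha> a)\<^sup>2 * \<beta> a ^ 3))"
      using L by (intro sum.cong refl) (simp add: \<alpha>_def \<beta>_def power_divide)
    also have "\<dots> \<le> (\<Sum>a\<in>U - S'. (real L)\<^sup>2 * real Ly ^ 3 * (\<epsilon> powr (1/10) * (\<alpha> a powr (49/10) + \<beta> a powr (49/10))))"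
    proof (intro sum_mono mult_left_mono mixed_power_bound)
      fix a assume "a \<in> U - S'"
      then show "\<alpha> a \<le> \<epsilon>" using S'[of a] L by (simp add: U_def \<alpha>_def field_simps)
    qed (auto simp: \<alpha>_def \<beta>_def)
    also have "\<dots> \<le> (\<Sum>a\<in>U. (real L)\<^sup>2 * real Ly ^ 3 * (\<epsilon> powr (1/10) * (\<alpha> a powr (49/10) + \<beta> a powr (49/10))))"
      using SU by (intro sum_mono2) auto
    also have "\<dots> = (real L)\<^sup>2 * real Ly ^ 3 * (\<epsilon> powr (1/10) * ((\<Sum>a\<in>U. \<alpha> a powr (49/10)) + (\<Sum>a\<in>U. \<beta> a powr (49/10))))"
      by (simp only: sum_distrib_left[symmetric] sum.distrib)
    also have "\<dots> \<le> (real L)\<^sup>2 * real Ly ^ 3 * (\<epsilon> powr (1/10) * (C + C'))"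
      using LA LY by (intro mult_left_mono add_mono) (auto simp: U_def \<alpha>_def \<beta>_def)
    also have "\<dots> \<le> n ^ 3 * ((real (card A))\<^sup>2 / 8)" using small by (simp add: n_def mult.commute)
    finally have "(\<Sum>a\<in>U - S'. (cmod (f a))\<^sup>2 * cmod (g a) ^ 3) \<le> n ^ 3 * ((real (card A))\<^sup>2 / 8)" .
    moreover have "(\<Sum>a\<in>U - S'. G a) \<ge> (\<Sum>a\<in>U - S'. - ((cmod (f a))\<^sup>2 * cmod (g a) ^ 3))" by (intro sum_mono Glow)
    ultimately show ?thesis by (simp add: sum_negf)
  qed
  \<comment> \<open>The main term with factor 1/2 minus two errors with factor 1/8 leaves
    1/4.\<close>
  have "(\<Sum>a\<in>U. G a) = (\<Sum>a\<in>U - S'. G a) + (\<Sum>a\<in>S' - S. G a) + (\<Sum>a\<in>S. G a)"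
    using sum.subset_diff[OF SU(2,5), of G] sum.subset_diff[OF S(1) SU(4), of G] by simp
  also have "\<dots> \<ge> n ^ 3 / 2 * E - n ^ 3 * ((real (card A))\<^sup>2 / 8) - n ^ 3 * ((real (card A))\<^sup>2 / 8)"
    using p1 p2 p3 by linarith
  finally have "n ^ 3 / 2 * E - n ^ 3 * ((real (card A))\<^sup>2 / 8) - n ^ 3 * ((real (card A))\<^sup>2 / 8) \<le> (\<Sum>a\<in>U. G a)" by simp
  moreover have "n ^ 3 / 2 * E \<ge> n ^ 3 / 2 * (real (card A))\<^sup>2" using E0 n0 by (intro mult_left_mono) auto
  ultimately have "(real (card A))\<^sup>2 * n ^ 3 / 4 \<le> (\<Sum>a\<in>U. G a)" by (simp add: algebra_simps)
  also have "(\<Sum>a\<in>U. G a) = Re (\<Sum>a\<in>{0..<int m}. f a * cnj (f a) * (cnj (g a)) ^ 3)" by (simp add: G_def U_def)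
  also have "\<dots> = m * real (card ?Sol)"
    unfolding f_def g_def solution_count_identity[OF fin m] by simp
  finally show ?thesis by (simp add: n_def)
qed

section \<open>Choice of thresholds and the count for a sieved quadratic\<close>

lemma quad_mono: "0 \<le> u \<Longrightarrow> 0 \<le> v \<Longrightarrow> s \<le> t \<Longrightarrow> quad u v s \<le> quad u v t"
  unfolding quad_def by (intro add_mono mult_left_mono power_mono) auto

lemma sum_indicator_exp:
  fixes A :: "nat set" and L :: nat and z :: "nat \<Rightarrow> complex"
  assumes "A \<subseteq> {..<L}"
  shows "(\<Sum>t<L. (if t \<in> A then 1 else 0) * z t) = (\<Sum>t\<in>A. z t)"
proof -
  have "(\<Sum>t\<in>A. z t) = (\<Sum>t<L. if t \<in> A then z t else 0)"
    using assms by (subst sum.inter_restrict[symmetric]) (auto simp: Int_absorb1)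
  then show ?thesis by (simp add: if_distrib[of "\<lambda>x. x * _"] cong: if_cong)
qed

text \<open>The bound for w depends only on \<delta> and M, whereas T0 and c may depend on the
  quadratic. A finite set Z of solutions is exhibited, so that the finiteness of the whole solution
  set, on which the meaning of \<open>card\<close> rests, is no issue here.\<close>

theorem core_count:
  fixes \<delta> :: real and M :: nat
  assumes d: "\<delta> > 0" and M: "M \<ge> 1"
  shows "\<exists>w0::nat. \<forall>w\<ge>w0. \<forall>u (s::nat). sieved u ((int s)\<^sup>2) w \<longrightarrow> (\<exists>(T0::nat) (c::real). c > 0 \<and>
    (\<forall>T\<ge>T0. \<forall>A B. A \<subseteq> {..T} \<longrightarrow> \<delta> * real T \<le> real (card A) \<longrightarrow> (\<forall>q\<ge>1. \<exists>k. 1 \<le> k \<and> k \<le> M \<and> q * k \<in> B) \<longrightarrow>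
      (\<exists>Z. finite Z \<and> Z \<subseteq> {(t1, t2, y1, y2, y3). t1 \<in> A \<and> t2 \<in> A \<and> y1 \<in> B \<and> y2 \<in> B \<and> y3 \<in> B \<and>
         quad u ((int s)\<^sup>2) t1 - quad u ((int s)\<^sup>2) t2 = (int y1)\<^sup>2 + (int y2)\<^sup>2 + (int y3)\<^sup>2} \<and>
         c * real T ^ 3 \<le> real (card Z))))"
proof -
  obtain CA and LA0 :: nat where CA: "CA > 0" and LA0: "\<forall>L m \<phi> c. L \<ge> LA0 \<longrightarrow> L\<^sup>2 \<le> m \<longrightarrow> major_arc_bounded 30 L m \<phi> \<longrightarrow> (\<forall>t<L. cmod (c t) \<le> 1)
      \<longrightarrow> (\<Sum>a\<in>{0..<int m}. (cmod (\<Sum>t<L. c t * ef m (a * \<phi> t))) ^ 4) \<le> real L powr (4 + 1/5000)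
      \<longrightarrow> (\<Sum>a\<in>{0..<int m}. (cmod (\<Sum>t<L. c t * ef m (a * \<phi> t)) / L) powr (49/10)) \<le> CA"
    using restriction_Lp[of 30] by (elim exE conjE meta_impE) simp_all
  obtain CY and LY0 :: nat where CY: "CY > 0" and LY0: "\<forall>L m \<phi> c. L \<ge> LY0 \<longrightarrow> L\<^sup>2 \<le> m \<longrightarrow> major_arc_bounded (20 * 32) L m \<phi> \<longrightarrow> (\<forall>t<L. cmod (c t) \<le> 1)
      \<longrightarrow> (\<Sum>a\<in>{0..<int m}. (cmod (\<Sum>t<L. c t * ef m (a * \<phi> t))) ^ 4) \<le> real L powr (4 + 1/5000)
      \<longrightarrow> (\<Sum>a\<in>{0..<int m}. (cmod (\<Sum>t<L. c t * ef m (a * \<phi> t)) / L) powr (49/10)) \<le> CY"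
    using restriction_Lp[of "20 * 32"] by (elim exE conjE meta_impE) simp_all
  obtain LF2 :: nat where LF2: "\<forall>L m u v c. L \<ge> LF2 \<longrightarrow> 0 \<le> u \<longrightarrow> 1 \<le> v \<longrightarrow> (\<forall>t<L. quad u v t < int m) \<longrightarrow> real m \<le> 32 * (real L)\<^sup>2
    \<longrightarrow> (\<forall>t<L. cmod (c t) \<le> 1) \<longrightarrow>
    (\<Sum>a\<in>{0..<int m}. (cmod (\<Sum>t<L. c t * ef m (a * quad u v t))) ^ 4) \<le> real L powr (4 + 1/5000)"
    using fourth_moment[of 32] by (elim exE meta_impE) simp_all
  obtain LS :: nat where LS: "\<forall>L m. L \<ge> LS \<longrightarrow> real m \<le> 32 * (real L)\<^sup>2 \<longrightarrow> 1 \<le> m \<longrightarrow> major_arc_bounded (20 * 32) L m (quad 0 1)"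
    using major_arc_bounded_squares[of 32] by (elim exE meta_impE) simp_all
  have "1 / (100 * (real M)\<^sup>2) > 0" using M by simp
  then obtain Qf :: "nat \<Rightarrow> nat" where Qf: "\<And>K. \<forall>\<theta>. \<exists>q. 1 \<le> q \<and> q \<le> Qf K \<and> (\<forall>i<K. nint (\<theta> i * (real q)\<^sup>2) \<le> 1 / (100 * (real M)\<^sup>2))"
    using quadratic_recurrence_simultaneous by metis
  have Qf1: "Qf K \<ge> 1" for K using Qf[of K] by (metis order.trans)
  \<comment> \<open>\<open>K \<epsilon>\<close> exceeds the number of frequencies with |f| \<ge>
    \<epsilon> L that the energy bound (32/\<delta>) L^2 permits, \<open>\<kappa> \<epsilon>\<close>
    bounds the density of the corresponding return set from below, and \<open>h \<epsilon>\<close>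
    bounds the 1/10-th power of the next threshold.\<close>
  define K where "K \<epsilon> = nat \<lceil>32 / (\<delta> * \<epsilon>\<^sup>2)\<rceil> + 1" for \<epsilon> :: real
  define \<kappa> where "\<kappa> \<epsilon> = 1 / (2 * (real (Qf (K \<epsilon>) * M))\<^sup>2)" for \<epsilon>
  define h where "h \<epsilon> = \<delta>\<^sup>2 * \<kappa> \<epsilon> ^ 3 / (1024 * (CA + CY))" for \<epsilon>
  \<comment> \<open>The start \<delta>/8 puts the frequency 0 into every spectrum, since |A2| \<ge>
    \<delta> T/2 and L = 2 T.\<close>
  define eps where "eps = rec_nat (\<delta> / 8) (\<lambda>_ \<epsilon>. min \<epsilon> (h \<epsilon> ^ 10))"
  have eps0: "eps 0 = \<delta> / 8" and epsS: "eps (Suc j) = min (eps j) (h (eps j) ^ 10)" for j by (simp_all add: eps_def)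
  have kappa: "\<kappa> \<epsilon> > 0" for \<epsilon> using Qf1[of "K \<epsilon>"] M by (simp add: \<kappa>_def)
  have h: "h \<epsilon> > 0" for \<epsilon> using kappa[of \<epsilon>] d CA CY by (simp add: h_def)
  have eps: "eps j > 0" for j
  proof (induction j)
    case 0 then show ?case using d by (simp add: eps0)
  next
    case (Suc j) then show ?case using h[of "eps j"] by (simp add: epsS)
  qed
  have eps_mono: "eps j \<le> eps i" if "i \<le> j" for i j
    using that by (induction rule: dec_induct) (auto simp: epsS)
  have K: "real (K \<epsilon>) > 32 / (\<delta> * \<epsilon>\<^sup>2)" for \<epsilon> unfolding K_def by linarith
  \<comment> \<open>The quotient of the energy bound (32/\<delta>)(2 T)^2 and the admissible
    increment \<delta>^2 T^2/32 is 4096/\<delta>^3.\<close>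
  define J where "J = nat \<lceil>4096 / \<delta> ^ 3\<rceil> + 1"
  have J: "real J > 4096 / \<delta> ^ 3" unfolding J_def by linarith
  define \<kappa>m where "\<kappa>m = Min ((\<lambda>j. \<kappa> (eps j)) ` {..J})"
  have km: "\<kappa>m > 0" unfolding \<kappa>m_def using kappa by (subst Min_gr_iff) auto
  have kmle: "\<kappa>m \<le> \<kappa> (eps j)" if "j \<le> J" for j unfolding \<kappa>m_def using that by (intro Min_le) auto
  define Qm where "Qm = Max ((\<lambda>j. Qf (K (eps j))) ` {..J})"
  have Qmge: "Qf (K (eps j)) \<le> Qm" if "j \<le> J" for j unfolding Qm_def using that by (intro Max_ge) auto
  obtain w0 where w0: "\<forall>w\<ge>w0. \<forall>v. \<exists>L0::nat. \<forall>L\<ge>L0. \<forall>u m A S c. sieved u v w \<longrightarrow> int m = quad u v L \<longrightarrow>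
    0 < c \<longrightarrow> (\<forall>t\<in>A. c * real L \<le> real t) \<longrightarrow> S \<subseteq> {0..<int m} \<longrightarrow> card S \<le> K (eps J) \<longrightarrow>
    (\<Sum>a\<in>S. (cmod (\<Sum>t<L. (if t \<in> A then 1 else 0) * ef m (a * quad u v t)))\<^sup>2) \<le> 4 / c * (real L)\<^sup>2"
    using energy_bound[of "K (eps J)"] by blast
  show ?thesis
  proof (rule exI[of _ w0], intro allI impI)
    fix w :: nat and u :: int and s :: nat
    assume w: "w0 \<le> w" and sv: "sieved u ((int s)\<^sup>2) w"
    define v where "v = (int s)\<^sup>2"
    note sv = sv[folded v_def]
    have u: "0 \<le> u" "u \<le> 2 * v" "1 \<le> v" using sv by (auto simp: sieved_def)
    have s1: "s \<ge> 1" using u by (cases s) (auto simp: v_def)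
    have vs: "real_of_int v = (real s)\<^sup>2" by (simp add: v_def)
    obtain LE :: nat where LE: "\<forall>L\<ge>LE. \<forall>u m A S c. sieved u v w \<longrightarrow> int m = quad u v L \<longrightarrow>
      0 < c \<longrightarrow> (\<forall>t\<in>A. c * real L \<le> real t) \<longrightarrow> S \<subseteq> {0..<int m} \<longrightarrow> card S \<le> K (eps J) \<longrightarrow>
      (\<Sum>a\<in>S. (cmod (\<Sum>t<L. (if t \<in> A then 1 else 0) * ef m (a * quad u v t)))\<^sup>2) \<le> 4 / c * (real L)\<^sup>2"
      using w0[rule_format, OF w, of v] by (elim exE)
    have "1 \<le> 3 * real_of_int v" using u by simp
    then obtain LF1 :: nat where LF1: "\<forall>L m u v' c. L \<ge> LF1 \<longrightarrow> 0 \<le> u \<longrightarrow> 1 \<le> v' \<longrightarrow> (\<forall>t<L. quad u v' t < int m) \<longrightarrow> real m \<le> 3 * real_of_int v * (real L)\<^sup>2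
      \<longrightarrow> (\<forall>t<L. cmod (c t) \<le> 1) \<longrightarrow>
      (\<Sum>a\<in>{0..<int m}. (cmod (\<Sum>t<L. c t * ef m (a * quad u v' t))) ^ 4) \<le> real L powr (4 + 1/5000)"
      using fourth_moment[of "3 * real_of_int v"] by (elim exE meta_impE) simp_all
    obtain LQ :: nat where LQ: "\<forall>L u w m. L \<ge> LQ \<longrightarrow> sieved u v w \<longrightarrow> int m = quad u v L \<longrightarrow> major_arc_bounded 30 L m (quad u v)"
      using major_arc_bounded_quad[of v] by (elim exE)
    define T0 where "T0 = LA0 + LE + LF1 + LQ + 4 * (LY0 + LF2 + LS) + 4 * (Qm * M) + nat \<lceil>8 / \<delta>\<rceil> + 8"
    define c where "c = \<delta>\<^sup>2 * \<kappa>m ^ 3 / (8192 * real_of_int v)"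
    have cpos: "c > 0" using d km u by (simp add: c_def)
    have main: "\<exists>Z. finite Z \<and> Z \<subseteq> {(t1, t2, y1, y2, y3). t1 \<in> A \<and> t2 \<in> A \<and> y1 \<in> B \<and> y2 \<in> B \<and> y3 \<in> B \<and>
         quad u v t1 - quad u v t2 = (int y1)\<^sup>2 + (int y2)\<^sup>2 + (int y3)\<^sup>2} \<and> c * real T ^ 3 \<le> real (card Z)"
      if T: "T \<ge> T0" and A: "A \<subseteq> {..T}" "\<delta> * real T \<le> real (card A)" and B: "\<forall>q\<ge>1. \<exists>k. 1 \<le> k \<and> k \<le> M \<and> q * k \<in> B"
      for T A B
    proof -
      have T8: "T \<ge> 8" "real T \<ge> 8 / \<delta>" using T unfolding T0_def by (simp, linarith)
      then have dT: "\<delta> * real T \<ge> 8" using d by (simp add: field_simps)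
      \<comment> \<open>The elements of A are at most T. Doubling the range makes m so large that
        the congruences modulo m met below are equations.\<close>
      define L where "L = 2 * T"
      define m where "m = nat (quad u v L)"
      have m: "int m = quad u v L" unfolding m_def using quad_nonneg[of u v L] u by simp
      have L1: "L \<ge> 1" using T8 by (simp add: L_def)
      note qb = quad_L_bounds[OF sv L1 m]
      have mp: "m > 0" using qb by simp
      have mT: "real m \<le> 8 * of_int v * (real T)\<^sup>2"
      proof -
        have "real_of_int (int m) = real_of_int (quad u v L)" by (simp only: m)
        then have "real m = real_of_int u * (2 * real T) + 4 * (real_of_int v * (real T)\<^sup>2)"
          by (simp add: quad_def L_def power_mult_distrib)
        moreover have "real_of_int u * (2 * real T) \<le> (2 * real_of_int v) * (2 * (real T)\<^sup>2)"
          using u T8 by (intro mult_mono) (auto simp: power2_eq_square)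
        ultimately show ?thesis by simp
      qed
      \<comment> \<open>Elements below \<delta> T/4 are discarded, because the weights in
        \<open>energy_bound\<close> are only comparable to their maximum away from 0; at least
        \<delta> T/2 elements remain.\<close>
      define A2 where "A2 = {t\<in>A. \<delta> / 8 * real L \<le> real t}"
      have finA: "finite A" using A(1) finite_subset by blast
      then have finA2: "finite A2" by (simp add: A2_def)
      have A2sub: "A2 \<subseteq> {..<L}" "A2 \<subseteq> A" using A(1) T8 by (auto simp: A2_def L_def)
      have cA2: "real (card A2) \<ge> \<delta> * real T / 2"
      proof -
        have "A \<subseteq> A2 \<union> {..<nat \<lceil>\<delta> * real T / 4\<rceil>}"
        proof
          fix t assume "t \<in> A"
          show "t \<in> A2 \<union> {..<nat \<lceil>\<delta> * real T / 4\<rceil>}"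
          proof (cases "\<delta> / 8 * real L \<le> real t")
            case False
            then have "real t < \<delta> * real T / 4" by (simp add: L_def)
            then have "t < nat \<lceil>\<delta> * real T / 4\<rceil>" by linarith
            then show ?thesis by simp
          qed (use \<open>t \<in> A\<close> in \<open>simp add: A2_def\<close>)
        qed
        then have "card A \<le> card (A2 \<union> {..<nat \<lceil>\<delta> * real T / 4\<rceil>})" using finA2 by (intro card_mono) auto
        also have "\<dots> \<le> card A2 + card {..<nat \<lceil>\<delta> * real T / 4\<rceil>}" by (rule card_Un_le)
        finally have "real (card A) \<le> real (card A2) + real (nat \<lceil>\<delta> * real T / 4\<rceil>)" by simp
        moreover have "real (nat \<lceil>\<delta> * real T / 4\<rceil>) \<le> \<delta> * real T / 4 + 1" using dT by linarith
        ultimately show ?thesis using A(2) dT by linarith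
      qed
      define f where "f a = (\<Sum>t\<in>A2. ef m (a * quad u v t))" for a
      have fif: "(\<Sum>t<L. (if t \<in> A2 then 1 else 0) * ef m (a * quad u v t)) = f a" for a
        unfolding f_def by (rule sum_indicator_exp[OF A2sub(1)])
      have energy: "(\<Sum>a\<in>S. (cmod (f a))\<^sup>2) \<le> 32 / \<delta> * (real L)\<^sup>2" if "S \<subseteq> {0..<int m}" "card S \<le> K (eps J)" for S
      proof -
        have "L \<ge> LE" using T by (simp add: T0_def L_def)
        moreover have "\<forall>t\<in>A2. \<delta> / 8 * real L \<le> real t" by (simp add: A2_def)
        moreover have "0 < \<delta> / 8" using d by simp
        ultimately have "(\<Sum>a\<in>S. (cmod (f a))\<^sup>2) \<le> 4 / (\<delta> / 8) * (real L)\<^sup>2"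
          using LE[rule_format, of L u m "\<delta> / 8" A2 S] sv m that fif by simp
        then show ?thesis by simp
      qed
      define S where "S j = {a\<in>{0..<int m}. eps j * L \<le> cmod (f a)}" for j
      have Ssub: "S j \<subseteq> {0..<int m}" for j by (auto simp: S_def)
      have finS: "finite (S j)" for j using Ssub[of j] by (rule finite_subset) simp
      have Smono: "S i \<subseteq> S j" if "i \<le> j" for i j
      proof -
        have "eps j * L \<le> eps i * L" using eps_mono[OF that] by (intro mult_right_mono) auto
        then show ?thesis by (auto simp: S_def)
      qed
      have lowE: "real (card S') * ((eps j)\<^sup>2 * (real L)\<^sup>2) \<le> (\<Sum>a\<in>S'. (cmod (f a))\<^sup>2)" if "S' \<subseteq> S j" for S' j
      proof -
        have "(eps j * L)\<^sup>2 \<le> (cmod (f a))\<^sup>2" if "a \<in> S'" for a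
          using that \<open>S' \<subseteq> S j\<close> eps[of j] by (intro power_mono) (auto simp: S_def)
        then have "(\<Sum>a\<in>S'. (eps j * L)\<^sup>2) \<le> (\<Sum>a\<in>S'. (cmod (f a))\<^sup>2)" by (intro sum_mono)
        then show ?thesis by (simp add: power_mult_distrib)
      qed
      have Lsq: "(real L)\<^sup>2 > 0" using L1 by simp
      have cardle: "real (card S') \<le> 32 / (\<delta> * (eps j)\<^sup>2)" if "S' \<subseteq> S j" "card S' \<le> K (eps J)" for S' j
      proof -
        have "S' \<subseteq> {0..<int m}" using that(1) Ssub[of j] by blast
        then have "real (card S') * ((eps j)\<^sup>2 * (real L)\<^sup>2) \<le> 32 / \<delta> * (real L)\<^sup>2"
          using lowE[OF that(1)] energy[of S'] that(2) by linarith
        then have "(real (card S') * (eps j)\<^sup>2) * (real L)\<^sup>2 \<le> (32 / \<delta>) * (real L)\<^sup>2" by (simp only: mult.assoc)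
        then have "real (card S') * (eps j)\<^sup>2 \<le> 32 / \<delta>" using Lsq by (simp only: mult_le_cancel_right_pos)
        then show ?thesis using eps[of j] d by (simp add: field_simps)
      qed
      \<comment> \<open>The energy bound covers only sets of at most \<open>K (eps J)\<close>
        frequencies. If the last spectrum were larger, a subset of exactly this size would
        contradict it.\<close>
      have cSJ: "card (S J) \<le> K (eps J)"
      proof (rule ccontr)
        assume "\<not> card (S J) \<le> K (eps J)"
        then obtain S' where S': "S' \<subseteq> S J" "card S' = K (eps J)"
          using obtain_subset_with_card_n[of "K (eps J)" "S J"] by auto
        then have "real (K (eps J)) \<le> 32 / (\<delta> * (eps J)\<^sup>2)" using cardle[OF S'(1)] by simp
        then show False using K[of "eps J"] by simp
      qed
      have cSle: "card (S j) \<le> K (eps J)" if "j \<le> J" for j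
        using card_mono[OF finS Smono[OF that]] cSJ by linarith
      have cSj: "card (S j) \<le> K (eps j)" if "j \<le> J" for j
      proof -
        have "real (card (S j)) \<le> 32 / (\<delta> * (eps j)\<^sup>2)" by (rule cardle[OF order_refl cSle[OF that]])
        then show ?thesis using K[of "eps j"] by linarith
      qed
      define E where "E j = (\<Sum>a\<in>S j. (cmod (f a))\<^sup>2)" for j
      define dd where "dd = \<delta>\<^sup>2 * (real T)\<^sup>2 / 32"
      have "\<exists>j<J. E (Suc j) - E j \<le> dd"
      proof (rule pigeonhole_increments)
        show "E 0 \<ge> 0" by (simp add: E_def sum_nonneg)
        have "E J \<le> 32 / \<delta> * (real L)\<^sup>2" unfolding E_def by (rule energy[OF Ssub cSJ])
        also have "\<dots> = 4096 / \<delta> ^ 3 * dd" using d by (simp add: dd_def L_def power2_eq_square power3_eq_cube field_simps)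
        also have "\<dots> < real J * dd" using J d T8 by (intro mult_strict_right_mono) (auto simp: dd_def)
        finally show "E J < real J * dd" .
      qed
      then obtain j where j: "j < J" "E (Suc j) - E j \<le> dd" by blast
      define \<epsilon> where "\<epsilon> = eps j"
      define Q where "Q = Qf (K \<epsilon>)"
      have Q1: "Q \<ge> 1" using Qf1 by (simp add: Q_def)
      \<comment> \<open>With y \<le> X a sum of three squares is at most 3 v T^2/4, too small to
        wrap around modulo m. \<open>Ly\<close> is one larger so that Y is contained in
        \<open>{..<Ly}\<close>.\<close>
      define X where "X = s * T div 2"
      define Ly where "Ly = X + 1"
      have X2: "2 * X \<le> s * T" "s * T \<le> 2 * X + 1" by (auto simp: X_def)
      have sT: "s * T \<ge> T" using s1 by simp
      have XT: "real X \<ge> real T / 4" using X2 sT T8 by linarith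
      have X1: "X \<ge> 2" using X2 sT T8 by linarith
      have XQ: "X \<ge> Q * M"
      proof -
        have "Q * M \<le> Qm * M" using Qmge[of j] j by (intro mult_right_mono) (auto simp: Q_def \<epsilon>_def)
        moreover have "4 * (Qm * M) \<le> T" using T by (simp add: T0_def)
        ultimately show ?thesis using X2 sT by linarith
      qed
      define Y where "Y = {y. 1 \<le> y \<and> y \<le> X \<and> y \<in> B \<and> (\<forall>a\<in>S j. nint (of_int a / real m * (real y)\<^sup>2) \<le> 1/100)}"
      have "X div (Q * M) \<le> (Q * M) * card Y"
        unfolding Y_def using return_set_large[OF Qf[of "K \<epsilon>"] B finS[of j] _ _ M, of X m] cSj[of j] j Q1 by (simp add: Q_def \<epsilon>_def)
      then have "real (X div (Q * M)) \<le> real (Q * M) * real (card Y)" by (simp only: of_nat_mult[of "Q * M", symmetric] of_nat_le_iff)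
      moreover have QM: "Q * M \<ge> 1" using Q1 M by simp
      \<comment> \<open>Rounding down loses at most a factor 2, since X \<ge> Q M.\<close>
      moreover have "real X / real (Q * M) \<le> 2 * real (X div (Q * M))"
      proof -
        define k where "k = X div (Q * M)"
        have "k \<ge> 1" using XQ QM by (simp add: k_def div_greater_zero_iff Suc_le_eq)
        moreover have "X < (k + 1) * (Q * M)"
          using dividend_less_div_times[of "Q * M" X] QM by (simp add: k_def)
        moreover have "(k + 1) * (Q * M) \<le> (2 * k) * (Q * M)" using \<open>k \<ge> 1\<close> by (intro mult_le_mono) auto
        ultimately have "X \<le> 2 * k * (Q * M)" by linarith
        then have "real X \<le> real (2 * k * (Q * M))" by (simp only: of_nat_le_iff)
        then have "real X \<le> 2 * real k * real (Q * M)" by (simp add: mult.assoc)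
        then show ?thesis using QM by (simp add: k_def divide_le_eq del: of_nat_mult)
      qed
      ultimately have "real X / real (Q * M) \<le> 2 * (real (Q * M) * real (card Y))" by linarith
      then have cY: "\<kappa> \<epsilon> * real X \<le> real (card Y)"
        using QM unfolding \<kappa>_def Q_def[symmetric] by (simp add: power2_eq_square field_simps del: of_nat_mult)
      have finY: "finite Y" by (rule finite_subset[of _ "{..X}"]) (auto simp: Y_def)
      have Ysub: "Y \<subseteq> {..<Ly}" by (auto simp: Y_def Ly_def)
      have X4: "4 * (int X)\<^sup>2 \<le> v * (int T)\<^sup>2"
      proof -
        have "int (2 * X) \<le> int (s * T)" using X2 by (simp only: of_nat_le_iff)
        then have "(int (2 * X))\<^sup>2 \<le> (int (s * T))\<^sup>2" by (intro power_mono) auto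
        then show ?thesis by (simp add: v_def power_mult_distrib)
      qed
      have mval: "int m = u * (2 * int T) + 4 * (v * (int T)\<^sup>2)" by (simp add: m quad_def L_def power2_eq_square)
      have vT: "v * (int T)\<^sup>2 > 0" using u T8 by (intro mult_pos_pos) auto
      have uT: "u * (2 * int T) \<ge> 0" using u by simp
      have yX: "(int y)\<^sup>2 \<le> (int X)\<^sup>2" if "y \<le> X" for y using that by (intro power_mono) auto
      have Lyr: "real Ly \<ge> real s * real T / 2"
      proof -
        have "s * T \<le> 2 * Ly" using X2 by (simp add: Ly_def)
        then have "real (s * T) \<le> real (2 * Ly)" by (simp only: of_nat_le_iff)
        then have "real s * real T \<le> 2 * real Ly" by simp
        then show ?thesis by simp
      qed
      have m32: "real m \<le> 32 * (real Ly)\<^sup>2"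
      proof -
        have "(real s * real T / 2)\<^sup>2 \<le> (real Ly)\<^sup>2" using Lyr by (intro power_mono) auto
        then show ?thesis using mT by (simp add: vs power_mult_distrib power_divide)
      qed
      have Lym: "Ly\<^sup>2 \<le> m"
      proof -
        have "Ly \<le> 2 * X" using X1 by (simp add: Ly_def)
        then have "(int Ly)\<^sup>2 \<le> (int (2 * X))\<^sup>2" by (intro power_mono) auto
        then have "(int Ly)\<^sup>2 \<le> 4 * (int X)\<^sup>2" by (simp add: power_mult_distrib)
        then have "int (Ly\<^sup>2) \<le> int m" using X4 mval vT uT by simp
        then show ?thesis by (simp only: of_nat_le_iff)
      qed
      have Lyge: "Ly \<ge> LY0" "Ly \<ge> LF2" "Ly \<ge> LS"
      proof -
        have "4 * (LY0 + LF2 + LS) \<le> T" using T by (simp add: T0_def)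
        moreover have "a \<le> X + 1" if "4 * a \<le> T" "T \<le> P" "P \<le> 2 * X + 1" for a P using that by linarith
        ultimately have "LY0 + LF2 + LS \<le> Ly" unfolding Ly_def using X2 sT by blast
        then show "Ly \<ge> LY0" "Ly \<ge> LF2" "Ly \<ge> LS" by auto
      qed
      have LA: "(\<Sum>a\<in>{0..<int m}. (cmod (f a) / L) powr (49/10)) \<le> CA"
      proof -
        define ca :: "nat \<Rightarrow> complex" where "ca t = (if t \<in> A2 then 1 else 0)" for t
        have ca: "\<forall>t<L. cmod (ca t) \<le> 1" by (simp add: ca_def)
        have "\<forall>t<L. quad u v t < int m"
        proof (intro allI impI)
          fix t assume t: "t < L"
          then have "quad u v t \<noteq> quad u v L" using quad_inj[of u v t L] u by auto
          moreover have "quad u v t \<le> quad u v L" using t u by (intro quad_mono) auto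
          ultimately show "quad u v t < int m" using m by simp
        qed
        moreover have "L \<ge> LF1" "L \<ge> LA0" "L \<ge> LQ" using T by (auto simp: T0_def L_def)
        ultimately have "(\<Sum>a\<in>{0..<int m}. (cmod (\<Sum>t<L. ca t * ef m (a * quad u v t))) ^ 4) \<le> real L powr (4 + 1/5000)"
          using LF1[rule_format, of L u v m ca] u qb ca by simp
        moreover have "major_arc_bounded 30 L m (quad u v)" using LQ[rule_format, OF \<open>L \<ge> LQ\<close> sv m] .
        ultimately have "(\<Sum>a\<in>{0..<int m}. (cmod (\<Sum>t<L. ca t * ef m (a * quad u v t)) / L) powr (49/10)) \<le> CA"
          using LA0[rule_format, OF \<open>L \<ge> LA0\<close> qb(3), of "quad u v" ca] ca by simp
        then show ?thesis by (simp add: ca_def fif)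
      qed
      define g where "g a = (\<Sum>y\<in>Y. ef m (a * quad 0 1 y))" for a
      have LYb: "(\<Sum>a\<in>{0..<int m}. (cmod (g a) / Ly) powr (49/10)) \<le> CY"
      proof -
        define ca :: "nat \<Rightarrow> complex" where "ca t = (if t \<in> Y then 1 else 0)" for t
        have ca: "\<forall>t<Ly. cmod (ca t) \<le> 1" by (simp add: ca_def)
        have gif: "(\<Sum>t<Ly. ca t * ef m (a * quad 0 1 t)) = g a" for a
          unfolding g_def ca_def by (rule sum_indicator_exp[OF Ysub])
        have "\<forall>t<Ly. quad 0 1 t < int m"
        proof (intro allI impI)
          fix t assume "t < Ly"
          then have "(int t)\<^sup>2 \<le> (int X)\<^sup>2" by (intro yX) (simp add: Ly_def)
          moreover have "quad 0 1 t = (int t)\<^sup>2" by (simp add: quad_def)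
          ultimately show "quad 0 1 t < int m" using X4 mval vT uT zero_le_power2[of "int X"] by linarith
        qed
        then have "(\<Sum>a\<in>{0..<int m}. (cmod (\<Sum>t<Ly. ca t * ef m (a * quad 0 1 t))) ^ 4) \<le> real Ly powr (4 + 1/5000)"
          using LF2[rule_format, OF Lyge(2), of 0 1 m ca] m32 ca by simp
        moreover have "major_arc_bounded (20 * 32) Ly m (quad 0 1)"
          using LS[rule_format, OF Lyge(3) m32] mp by simp
        ultimately have "(\<Sum>a\<in>{0..<int m}. (cmod (\<Sum>t<Ly. ca t * ef m (a * quad 0 1 t)) / Ly) powr (49/10)) \<le> CY"
          using LY0[rule_format, OF Lyge(1) Lym, of "quad 0 1" ca] ca by simp
        then show ?thesis by (simp only: gif)
      qed
      have A2sq: "\<delta>\<^sup>2 * (real T)\<^sup>2 / 4 \<le> (real (card A2))\<^sup>2"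
      proof -
        have "(\<delta> * real T / 2)\<^sup>2 \<le> (real (card A2))\<^sup>2" using cA2 d by (intro power_mono) auto
        then show ?thesis by (simp add: power_mult_distrib power_divide)
      qed
      have Ycube: "(\<kappa> \<epsilon>) ^ 3 * real X ^ 3 \<le> real (card Y) ^ 3"
      proof -
        have "(\<kappa> \<epsilon> * real X) ^ 3 \<le> real (card Y) ^ 3" using cY kappa[of \<epsilon>] by (intro power_mono) auto
        then show ?thesis by (simp add: power_mult_distrib)
      qed
      define Z where "Z = {(t1, t2, y1, y2, y3). t1 \<in> A2 \<and> t2 \<in> A2 \<and> y1 \<in> Y \<and> y2 \<in> Y \<and> y3 \<in> Y \<and>
        int m dvd quad u v t1 - quad u v t2 - (quad 0 1 y1 + quad 0 1 y2 + quad 0 1 y3)}"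
      have count: "(real (card A2))\<^sup>2 * real (card Y) ^ 3 / 4 \<le> m * real (card Z)"
        unfolding Z_def
      proof (rule count_from_spectrum[where S = "S j" and S' = "S (Suc j)" and \<epsilon> = "eps (Suc j)" and C = CA and C' = CY and L = L and Ly = Ly])
        show "finite A2" "finite Y" "0 < m" "1 \<le> L" "1 \<le> Ly" by (use finA2 finY mp L1 in \<open>auto simp: Ly_def\<close>)
        show "S j \<subseteq> S (Suc j)" by (rule Smono) simp
        show "S (Suc j) \<subseteq> {0..<int m}" by (rule Ssub)
        show "0 \<in> S j"
        proof -
          have "eps j \<le> \<delta> / 8" using eps_mono[of 0 j] by (simp add: eps0)
          then have "eps j * L \<le> \<delta> / 8 * L" by (intro mult_right_mono) auto
          also have "\<dots> \<le> real (card A2)" using cA2 d T8 by (simp add: L_def)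
          finally show ?thesis using mp by (simp add: S_def f_def)
        qed
        show "cmod (\<Sum>t\<in>A2. ef m (a * quad u v t)) \<le> eps (Suc j) * real L" if "a \<in> {0..<int m} - S (Suc j)" for a
          using that by (auto simp: S_def f_def)
        show "nint (of_int (a * quad 0 1 y) / real m) \<le> 1 / 100" if "a \<in> S j" "y \<in> Y" for a y
          using that by (simp add: Y_def quad_def)
        show "(\<Sum>a\<in>S (Suc j). (cmod (\<Sum>t\<in>A2. ef m (a * quad u v t)))\<^sup>2) - (\<Sum>a\<in>S j. (cmod (\<Sum>t\<in>A2. ef m (a * quad u v t)))\<^sup>2) \<le> (real (card A2))\<^sup>2 / 8"
          using j(2) A2sq by (simp add: E_def f_def dd_def)
        show "(\<Sum>a\<in>{0..<int m}. (cmod (\<Sum>t\<in>A2. ef m (a * quad u v t)) / real L) powr (49/10)) \<le> CA"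
          using LA by (simp add: f_def)
        show "(\<Sum>a\<in>{0..<int m}. (cmod (\<Sum>y\<in>Y. ef m (a * quad 0 1 y)) / real Ly) powr (49/10)) \<le> CY"
          using LYb by (simp add: g_def)
        show "(real L)\<^sup>2 * real Ly ^ 3 * (eps (Suc j) powr (1/10) * (CA + CY)) \<le> (real (card A2))\<^sup>2 / 8 * real (card Y) ^ 3"
        proof -
          \<comment> \<open>The tenth power in the recursion for \<open>eps\<close> undoes the
            exponent 1/10 of \<open>mixed_power_bound\<close>.\<close>
          have "eps (Suc j) powr (1/10) \<le> (h \<epsilon> ^ 10) powr (1/10)"
            using eps[of "Suc j"] by (intro powr_mono2) (auto simp: epsS \<epsilon>_def)
          also have "h \<epsilon> ^ 10 = h \<epsilon> powr real 10" using h[of \<epsilon>] by (rule powr_realpow[symmetric])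
          also have "(h \<epsilon> powr real 10) powr (1/10) = h \<epsilon>" unfolding powr_powr using h[of \<epsilon>] by simp
          finally have "eps (Suc j) powr (1/10) * (CA + CY) \<le> h \<epsilon> * (CA + CY)"
            using CA CY by (intro mult_right_mono) auto
          moreover have "CA + CY \<noteq> 0" using CA CY by simp
          moreover have "p / (1024 * r) * r = p / 1024" if "r \<noteq> 0" for p r :: real using that by simp
          ultimately have e: "eps (Suc j) powr (1/10) * (CA + CY) \<le> \<delta>\<^sup>2 * \<kappa> \<epsilon> ^ 3 / 1024"
            unfolding h_def by metis
          have "real Ly \<le> 2 * real X" using X1 by (simp add: Ly_def)
          then have ly3: "real Ly ^ 3 \<le> (2 * real X) ^ 3" by (intro power_mono) auto
          have "(real L)\<^sup>2 * real Ly ^ 3 * (eps (Suc j) powr (1/10) * (CA + CY)) \<le> (real L)\<^sup>2 * (2 * real X) ^ 3 * (\<delta>\<^sup>2 * \<kappa> \<epsilon> ^ 3 / 1024)"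
          proof (rule mult_mono[OF _ e])
            show "(real L)\<^sup>2 * real Ly ^ 3 \<le> (real L)\<^sup>2 * (2 * real X) ^ 3"
              using ly3 by (rule mult_left_mono) simp
          qed (use CA CY in auto)
          also have "\<dots> = (\<delta>\<^sup>2 * (real T)\<^sup>2 / 4) / 8 * ((\<kappa> \<epsilon>) ^ 3 * real X ^ 3)"
            by (simp add: L_def power2_eq_square power3_eq_cube)
          also have "\<dots> \<le> (real (card A2))\<^sup>2 / 8 * real (card Y) ^ 3"
            using A2sq Ycube kappa[of \<epsilon>] by (intro mult_mono divide_right_mono) auto
          finally show ?thesis .
        qed
      qed
      have finZ: "finite Z"
        by (rule finite_subset[of _ "A2 \<times> A2 \<times> Y \<times> Y \<times> Y"]) (use finA2 finY in \<open>auto simp: Z_def\<close>)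
      have Zsub: "Z \<subseteq> {(t1, t2, y1, y2, y3). t1 \<in> A \<and> t2 \<in> A \<and> y1 \<in> B \<and> y2 \<in> B \<and> y3 \<in> B \<and>
         quad u v t1 - quad u v t2 = (int y1)\<^sup>2 + (int y2)\<^sup>2 + (int y3)\<^sup>2}"
      proof clarify
        fix t1 t2 y1 y2 y3 assume "(t1, t2, y1, y2, y3) \<in> Z"
        then have z: "t1 \<in> A2" "t2 \<in> A2" "y1 \<in> Y" "y2 \<in> Y" "y3 \<in> Y"
          "int m dvd quad u v t1 - quad u v t2 - (quad 0 1 y1 + quad 0 1 y2 + quad 0 1 y3)" by (auto simp: Z_def)
        have le: "t1 \<le> T" "t2 \<le> T" using z A(1) by (auto simp: A2_def)
        have q: "0 \<le> quad u v t1" "quad u v t1 \<le> quad u v T" "0 \<le> quad u v t2" "quad u v t2 \<le> quad u v T"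
          using u le by (auto intro!: quad_nonneg quad_mono)
        have qT: "quad u v T = u * int T + v * (int T)\<^sup>2" by (simp add: quad_def)
        have uT2: "u * int T \<ge> 0" using u by simp
        define y where "y = quad 0 1 y1 + quad 0 1 y2 + quad 0 1 y3"
        have y: "y = (int y1)\<^sup>2 + (int y2)\<^sup>2 + (int y3)\<^sup>2" by (simp add: y_def quad_def)
        have "(int y1)\<^sup>2 \<le> (int X)\<^sup>2" "(int y2)\<^sup>2 \<le> (int X)\<^sup>2" "(int y3)\<^sup>2 \<le> (int X)\<^sup>2"
          using z by (auto simp: Y_def intro!: yX simp del: power_mono_iff)
        then have yb: "0 \<le> y" "y \<le> 3 * (int X)\<^sup>2" unfolding y by (simp, linarith)
        \<comment> \<open>The choices of L and X take effect here: a multiple of m smaller than m in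
          absolute value is 0.\<close>
        have "\<bar>quad u v t1 - quad u v t2 - y\<bar> < int m"
          using q qT yb X4 mval vT uT2 by linarith
        moreover have "int m dvd quad u v t1 - quad u v t2 - y" using z(6) by (simp add: y_def)
        ultimately have "quad u v t1 - quad u v t2 - y = 0"
          using dvd_imp_le_int[of "quad u v t1 - quad u v t2 - y" "int m"] by fastforce
        then show "t1 \<in> A \<and> t2 \<in> A \<and> y1 \<in> B \<and> y2 \<in> B \<and> y3 \<in> B \<and>
         quad u v t1 - quad u v t2 = (int y1)\<^sup>2 + (int y2)\<^sup>2 + (int y3)\<^sup>2"
          using z y by (auto simp: A2_def Y_def)
      qed
      have "(\<delta>\<^sup>2 * (real T)\<^sup>2 / 4) * (\<kappa>m ^ 3 * (real T / 4) ^ 3) / 4 \<le> (real (card A2))\<^sup>2 * real (card Y) ^ 3 / 4"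
      proof (intro divide_right_mono mult_mono A2sq)
        have "\<kappa>m ^ 3 * (real T / 4) ^ 3 \<le> (\<kappa> \<epsilon>) ^ 3 * real X ^ 3"
          using kmle[of j] j km XT by (intro mult_mono power_mono) (auto simp: \<epsilon>_def)
        then show "\<kappa>m ^ 3 * (real T / 4) ^ 3 \<le> real (card Y) ^ 3" using Ycube by linarith
      qed (use km in auto)
      also have "\<dots> \<le> m * real (card Z)" by (rule count)
      also have "\<dots> \<le> 8 * of_int v * (real T)\<^sup>2 * real (card Z)" using mT by (intro mult_right_mono) auto
      finally have "(8 * of_int v * (real T)\<^sup>2) * (c * real T ^ 3) \<le> (8 * of_int v * (real T)\<^sup>2) * real (card Z)"
        using u by (simp add: c_def power2_eq_square power3_eq_cube field_simps)
      moreover have "8 * real_of_int v * (real T)\<^sup>2 > 0" using u T8 by simp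
      ultimately have "c * real T ^ 3 \<le> real (card Z)" by (simp only: mult_le_cancel_left_pos)
      then show ?thesis using finZ Zsub by blast
    qed
    show "\<exists>(T0::nat) (c::real). c > 0 \<and>
    (\<forall>T\<ge>T0. \<forall>A B. A \<subseteq> {..T} \<longrightarrow> \<delta> * real T \<le> real (card A) \<longrightarrow> (\<forall>q\<ge>1. \<exists>k. 1 \<le> k \<and> k \<le> M \<and> q * k \<in> B) \<longrightarrow>
      (\<exists>Z. finite Z \<and> Z \<subseteq> {(t1, t2, y1, y2, y3). t1 \<in> A \<and> t2 \<in> A \<and> y1 \<in> B \<and> y2 \<in> B \<and> y3 \<in> B \<and>
         quad u ((int s)\<^sup>2) t1 - quad u ((int s)\<^sup>2) t2 = (int y1)\<^sup>2 + (int y2)\<^sup>2 + (int y3)\<^sup>2} \<and>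
         c * real T ^ 3 \<le> real (card Z)))"
      unfolding v_def[symmetric]
      by (rule exI[of _ T0], rule exI[of _ c], intro conjI cpos allI impI, rule main)
  qed
qed

section \<open>Reduction to a quadratic without small major arcs\<close>

definition class_gcd :: "nat \<Rightarrow> nat \<Rightarrow> nat" where
  "class_gcd V x = gcd (2 * x) (V\<^sup>2)"

definition class_modulus :: "nat \<Rightarrow> nat \<Rightarrow> nat" where
  "class_modulus V x = V\<^sup>2 div class_gcd V x"

text \<open>With g = \<open>class_gcd V x\<close>, every small prime p still divides V / g, hence
  the leading coefficient (V / g)^2. It cannot divide the linear coefficient 2 x / g, since then p g
  would be a larger common divisor of 2 x and V^2.\<close>

definition good_class :: "nat \<Rightarrow> nat \<Rightarrow> nat \<Rightarrow> bool" where
  "good_class V w x \<longleftrightarrow> (\<forall>p. prime p \<longrightarrow> p \<le> w \<longrightarrow> p * class_gcd V x dvd V)"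

lemma class_modulus_mult: "class_gcd V x * class_modulus V x = V\<^sup>2"
  by (simp add: class_modulus_def class_gcd_def)

lemma class_gcd_pos: "V \<ge> 1 \<Longrightarrow> class_gcd V x \<ge> 1"
  by (simp add: class_gcd_def Suc_le_eq)

lemma good_class_dvd:
  assumes "good_class V w x" "w \<ge> 2"
  shows "class_gcd V x dvd V"
proof -
  have "2 * class_gcd V x dvd V" using assms two_is_prime_nat by (auto simp: good_class_def)
  then show ?thesis by (rule dvd_mult_right)
qed

lemma class_modulus_eq:
  assumes "good_class V w x" "w \<ge> 2" "V \<ge> 1"
  shows "class_modulus V x = V * (V div class_gcd V x)"
  using good_class_dvd[OF assms(1,2)] by (simp add: class_modulus_def power2_eq_square div_mult_swap)

lemma dvd_double_cong:
  fixes d W x b :: nat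
  assumes "d dvd W" "x mod W = b mod W"
  shows "d dvd 2 * x \<longleftrightarrow> d dvd 2 * b"
proof -
  have "x mod d = b mod d" using assms by (metis mod_mod_cancel)
  then show ?thesis by (metis dvd_eq_mod_eq_0 mod_mult_right_eq)
qed

text \<open>Let g be the gcd of b. If p g divides 2 x and V^2, then p divides V, so p \<le> w, and
  goodness makes p g a divisor of V and of the modulus V (V / g). The congruence carries the
  divisibility over to 2 b, against the maximality of g.\<close>

lemma class_gcd_cong:
  assumes g: "good_class V w b" and w: "w \<ge> 2" and V: "V \<ge> 1" and smooth: "\<And>p. prime p \<Longrightarrow> p dvd V \<Longrightarrow> p \<le> w"
    and x: "x mod class_modulus V b = b mod class_modulus V b"
  shows "class_gcd V x = class_gcd V b"
proof -
  define d where "d = class_gcd V b"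
  have d1: "d \<ge> 1" using class_gcd_pos[OF V] by (simp add: d_def)
  have dV: "d dvd V" using good_class_dvd[OF g w] by (simp add: d_def)
  have W: "class_modulus V b = V * (V div d)" using class_modulus_eq[OF g w V] by (simp add: d_def)
  have db: "d dvd 2 * b" by (simp add: d_def class_gcd_def)
  have "d dvd 2 * x" using dvd_double_cong[OF _ x, of d] db dV by (simp add: W)
  then have "d dvd class_gcd V x" using dV by (auto simp: class_gcd_def power2_eq_square)
  then obtain e where e: "class_gcd V x = d * e" by auto
  have "e = 1"
  proof (rule ccontr)
    assume "e \<noteq> 1"
    then obtain p where p: "prime p" "p dvd e" using prime_factor_nat by blast
    have pd: "p * d dvd class_gcd V x" using p(2) by (simp add: e mult.commute mult_dvd_mono)
    then have pd2: "p * d dvd 2 * x" "p * d dvd V\<^sup>2" by (auto simp: class_gcd_def)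
    have "p dvd V\<^sup>2" using pd2(2) dvd_mult_left by blast
    then have "p dvd V" using p(1) prime_dvd_power by blast
    then have "p \<le> w" by (rule smooth[OF p(1)])
    then have "p * d dvd V" using g p(1) by (auto simp: good_class_def d_def)
    then have "p * d dvd class_modulus V b" by (simp add: W)
    then have "p * d dvd 2 * b" using dvd_double_cong[OF _ x] pd2(1) by blast
    then have "p * d dvd d" using pd2(2) by (simp add: d_def class_gcd_def)
    then have "p * d \<le> d" using d1 by (intro dvd_imp_le) auto
    then show False using prime_gt_1_nat[OF p(1)] d1 by simp
  qed
  then show ?thesis by (simp add: e d_def)
qed

lemma good_class_cong: "class_gcd V x = class_gcd V b \<Longrightarrow> good_class V w x = good_class V w b"
  by (simp add: good_class_def)

text \<open>A prime up to w has multiplicity at least k in (w!)^k, but at most k - 1 in the gcd,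
  which divides 2 x; so there is room for one more factor p.\<close>

lemma good_class_if_power_free:
  assumes k: "k \<ge> 1" and x: "x \<ge> 1" and free: "\<And>p. prime p \<Longrightarrow> p \<le> w \<Longrightarrow> \<not> p ^ k dvd 2 * x"
  shows "good_class (fact w ^ k) w x"
  unfolding good_class_def
proof (intro allI impI)
  fix p :: nat assume p: "prime p" "p \<le> w"
  define V :: nat where "V = fact w ^ k"
  define g where "g = class_gcd V x"
  have V1: "V \<ge> 1" by (simp add: V_def)
  have g1: "g \<ge> 1" using class_gcd_pos[OF V1] by (simp add: g_def)
  have gx: "g dvd 2 * x" "g dvd V\<^sup>2" by (simp_all add: g_def class_gcd_def)
  have "p * g dvd V"
  proof (rule multiplicity_le_imp_dvd)
    show "p * g \<noteq> 0" using p(1) g1 by (auto simp: prime_gt_0_nat)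
    fix q :: nat assume q: "prime q"
    have mm: "multiplicity q (p * g) = multiplicity q p + multiplicity q g"
      using q p(1) g1 by (intro prime_elem_multiplicity_mult_distrib) (auto simp: prime_gt_0_nat)
    show "multiplicity q (p * g) \<le> multiplicity q V"
    proof (cases "q \<le> w")
      case True
      have "multiplicity q g < k"
      proof (rule ccontr)
        assume "\<not> multiplicity q g < k"
        then have "q ^ k dvd g" by (intro multiplicity_dvd') simp
        then have "q ^ k dvd 2 * x" using gx(1) dvd_trans by blast
        then show False using free[OF q True] by simp
      qed
      moreover have "multiplicity q p \<le> 1"
        using p(1) q by (cases "q = p") (auto simp: prime_multiplicity_other)
      moreover have "k \<le> multiplicity q V"
      proof (rule multiplicity_geI)
        show "V \<noteq> 0" using V1 by simp
        show "\<not> is_unit q" using q by auto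
        have "q dvd fact w" using True q by (simp add: prime_dvd_fact_iff)
        then show "q ^ k dvd V" unfolding V_def by (rule dvd_power_same)
      qed
      ultimately show ?thesis using mm by linarith
    next
      case False
      have "\<not> q dvd V"
      proof
        assume "q dvd V"
        then have "q dvd fact w" unfolding V_def using q prime_dvd_power by blast
        then show False using False q by (simp add: prime_dvd_fact_iff)
      qed
      then have "\<not> q dvd g" using gx(2) q by (metis dvd_trans prime_dvd_power)
      then have "multiplicity q g = 0" by (rule not_dvd_imp_multiplicity_0)
      moreover have "multiplicity q p = 0" using False p q by (intro prime_multiplicity_other) auto
      ultimately show ?thesis using mm by simp
    qed
  qed
  then show "p * class_gcd (fact w ^ k) x dvd fact w ^ k" by (simp add: g_def V_def)
qed

text \<open>The sum of 1/q^2 over q \<ge> 2 telescopes to at most 1, and each term gains q^(2-k)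
  \<le> 2^(2-k).\<close>

lemma sum_inverse_powers_le:
  assumes "k \<ge> 2"
  shows "(\<Sum>q\<in>{2..w}. 1 / real q ^ k) \<le> 4 / 2 ^ k"
proof -
  have tel: "(\<Sum>q\<in>{2..w}. 1 / (real q)\<^sup>2) \<le> 1"
  proof -
    have "(\<Sum>q\<in>{2..w}. 1 / (real q)\<^sup>2) \<le> 1 - 1 / real (max 1 w)"
    proof (induction w)
      case (Suc w)
      show ?case
      proof (cases "w \<ge> 1")
        case True
        then have "{2..Suc w} = insert (Suc w) {2..w}" by auto
        then have "(\<Sum>q\<in>{2..Suc w}. 1 / (real q)\<^sup>2) = 1 / (real (Suc w))\<^sup>2 + (\<Sum>q\<in>{2..w}. 1 / (real q)\<^sup>2)" by simp
        also have "\<dots> \<le> 1 / (real (Suc w))\<^sup>2 + (1 - 1 / real w)" using Suc True by (simp add: max_def)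
        also have "\<dots> \<le> 1 - 1 / real (Suc w)"
        proof -
          have "1 / (real (Suc w))\<^sup>2 \<le> 1 / (real w * real (Suc w))" using True by (intro divide_left_mono) (auto simp: power2_eq_square)
          also have "\<dots> = 1 / real w - 1 / real (Suc w)" using True by (simp add: field_simps)
          finally show ?thesis by simp
        qed
        finally show ?thesis using True by (simp add: max_def)
      qed (auto simp: max_def)
    qed simp
    also have "\<dots> \<le> 1" by simp
    finally show ?thesis .
  qed
  have "(\<Sum>q\<in>{2..w}. 1 / real q ^ k) \<le> (\<Sum>q\<in>{2..w}. 4 / 2 ^ k * (1 / (real q)\<^sup>2))"
  proof (rule sum_mono)
    fix q assume q: "q \<in> {2..w}"
    have "(2::real) ^ (k - 2) \<le> real q ^ (k - 2)" using q by (intro power_mono) auto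
    then have "2 ^ (k - 2) * (real q)\<^sup>2 \<le> real q ^ (k - 2) * (real q)\<^sup>2" by (intro mult_right_mono) auto
    also have "\<dots> = real q ^ k" using assms by (simp only: power_add[symmetric] le_add_diff_inverse2)
    finally have "1 / real q ^ k \<le> 1 / (2 ^ (k - 2) * (real q)\<^sup>2)" using q by (intro divide_left_mono) auto
    also have "(2::real) ^ (k - 2) = 2 ^ k / 4" using power_add[of "2::real" "k - 2" 2] unfolding le_add_diff_inverse2[OF assms] power2_eq_square by linarith
    finally show "1 / real q ^ k \<le> 4 / 2 ^ k * (1 / (real q)\<^sup>2)" by simp
  qed
  also have "\<dots> = 4 / 2 ^ k * (\<Sum>q\<in>{2..w}. 1 / (real q)\<^sup>2)" by (simp only: sum_distrib_left)
  also have "\<dots> \<le> 4 / 2 ^ k * 1" using tel by (intro mult_left_mono) auto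
  finally show ?thesis by simp
qed

text \<open>Passing from 2 x to x costs one factor 2 if p = 2 and nothing otherwise, hence the
  exponents k + 1 and k. The bound is independent of w, so k can be fixed in terms of \<delta>
  alone.\<close>

lemma card_not_power_free:
  assumes k: "k \<ge> 2"
  shows "real (card {x\<in>{1..n}. \<exists>p. prime p \<and> p \<le> w \<and> p ^ Suc k dvd 2 * x}) \<le> 4 / 2 ^ k * real n"
proof -
  have dv: "p ^ k dvd x" if "prime p" "p ^ Suc k dvd 2 * x" for p x :: nat
  proof (cases "p = 2")
    case True
    then show ?thesis using that(2) by simp
  next
    case False
    then have "coprime p 2" using that(1) two_is_prime_nat primes_coprime by blast
    then have "coprime (p ^ k) 2" by (simp only: coprime_power_left_iff simp_thms)
    moreover have "p ^ k dvd 2 * x" using that(2) dvd_mult_right[of p "p ^ k"] by simp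
    ultimately show ?thesis by (simp add: coprime_dvd_mult_right_iff)
  qed
  have "{x\<in>{1..n}. \<exists>p. prime p \<and> p \<le> w \<and> p ^ Suc k dvd 2 * x} \<subseteq> (\<Union>q\<in>{2..w}. {x\<in>{1..n}. q ^ k dvd x})"
  proof clarify
    fix x p assume "x \<in> {1..n}" "prime p" "p \<le> w" "p ^ Suc k dvd 2 * x"
    then show "x \<in> (\<Union>q\<in>{2..w}. {x\<in>{1..n}. q ^ k dvd x})"
      using dv[of p x] prime_ge_2_nat[of p] by (intro UN_I[of p]) auto
  qed
  then have "card {x\<in>{1..n}. \<exists>p. prime p \<and> p \<le> w \<and> p ^ Suc k dvd 2 * x} \<le> card (\<Union>q\<in>{2..w}. {x\<in>{1..n}. q ^ k dvd x})"
    by (intro card_mono) auto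
  also have "\<dots> \<le> (\<Sum>q\<in>{2..w}. card {x\<in>{1..n}. q ^ k dvd x})" by (rule card_UN_le) simp
  finally have "real (card {x\<in>{1..n}. \<exists>p. prime p \<and> p \<le> w \<and> p ^ Suc k dvd 2 * x}) \<le> (\<Sum>q\<in>{2..w}. real (card {x\<in>{1..n}. q ^ k dvd x}))"
    by (simp only: of_nat_sum[symmetric] of_nat_le_iff)
  also have "\<dots> \<le> (\<Sum>q\<in>{2..w}. real n * (1 / real q ^ k))"
  proof (rule sum_mono)
    fix q assume q: "q \<in> {2..w}"
    define d where "d = q ^ k"
    have d: "d \<ge> 1" using q by (simp add: d_def)
    have "{x\<in>{1..n}. d dvd x} \<subseteq> (\<lambda>i. d * i) ` {1..n div d}"
    proof
      fix x assume "x \<in> {x\<in>{1..n}. d dvd x}"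
      then obtain i where i: "x = d * i" "1 \<le> x" "x \<le> n" by auto
      then have "i \<ge> 1" by (cases i) auto
      moreover have "i \<le> n div d" using i d by (simp add: less_eq_div_iff_mult_less_eq mult.commute)
      ultimately show "x \<in> (\<lambda>i. d * i) ` {1..n div d}" using i by auto
    qed
    then have "card {x\<in>{1..n}. d dvd x} \<le> card {1..n div d}" by (intro order.trans[OF card_mono card_image_le]) auto
    then have "real (card {x\<in>{1..n}. d dvd x}) \<le> real (n div d)" by simp
    also have "\<dots> \<le> real n / real d" by (rule of_nat_div_le_of_nat)
    finally show "real (card {x\<in>{1..n}. q ^ k dvd x}) \<le> real n * (1 / real q ^ k)" by (simp add: d_def)
  qed
  also have "\<dots> = real n * (\<Sum>q\<in>{2..w}. 1 / real q ^ k)" by (simp only: sum_distrib_left)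
  also have "\<dots> \<le> real n * (4 / 2 ^ k)" using sum_inverse_powers_le[OF k] by (intro mult_left_mono) auto
  finally show ?thesis by (simp add: mult.commute)
qed

text \<open>The classes overlap. Giving the class of \<open>b\<close> the weight \<open>1 / class_gcd V b\<close>, for \<open>b\<close> in a full
  period modulo \<open>V\<^sup>2\<close>, makes every good element be covered with total weight at least 1.\<close>

lemma dense_good_class:
  fixes A :: "nat set"
  assumes w: "w \<ge> 2" and V: "V \<ge> 1" and smooth: "\<And>p. prime p \<Longrightarrow> p dvd V \<Longrightarrow> p \<le> w"
    and A: "finite A" and good: "real (card {x\<in>A. good_class V w x}) \<ge> D"
    and D: "D > 0"
  shows "\<exists>b. good_class V w b \<and> b < class_modulus V b \<and>
    real (card {x\<in>A. x mod class_modulus V b = b}) * real (class_modulus V b) \<ge> D"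
proof -
  define g where "g = class_gcd V"
  define W where "W = class_modulus V"
  define R where "R = {b\<in>{0..<V\<^sup>2}. good_class V w b}"
  define G where "G = {x\<in>A. good_class V w x}"
  have gcong: "g x = g b" if "good_class V w b" "x mod W b = b mod W b" for x b
    unfolding g_def
  proof (rule class_gcd_cong[OF that(1) w V])
    show "p \<le> w" if "prime p" "p dvd V" for p using that by (rule smooth)
    show "x mod class_modulus V b = b mod class_modulus V b" using that(2) by (simp only: W_def)
  qed
  have gW: "g b * W b = V\<^sup>2" for b unfolding g_def W_def by (rule class_modulus_mult)
  have g1: "g b \<ge> 1" for b unfolding g_def by (rule class_gcd_pos[OF V])
  have W1: "W b \<ge> 1" for b using gW[of b] V by (cases "W b") auto
  have finR: "finite R" "finite G" using A by (auto simp: R_def G_def)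
  have inner: "(\<Sum>b\<in>{b\<in>R. x mod W b = b mod W b}. 1 / real (g b)) \<ge> 1" if x: "x \<in> G" for x
  proof -
    \<comment> \<open>The g x representatives below V^2 of the class of x. Their gcd is again g x,
      so their weights 1 / g x add up to 1.\<close>
    define B where "B = (\<lambda>i. x mod W x + W x * i) ` {0..<g x}"
    have gx: "good_class V w x" using x by (simp add: G_def)
    have BB: "g b = g x \<and> b \<in> {b\<in>R. x mod W b = b mod W b}" if "b \<in> B" for b
    proof -
      obtain i where i: "b = x mod W x + W x * i" and "i \<in> {0..<g x}" using \<open>b \<in> B\<close> unfolding B_def by (rule imageE)
      then have ig: "i < g x" by simp
      have bm: "b mod W x = x mod W x" by (simp add: i)
      have gb: "g b = g x" using gx bm by (rule gcong)
      then have Wb: "W b = W x" by (simp add: W_def class_modulus_def g_def)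
      have "b < W x + W x * i" using i mod_less_divisor[of "W x" x] W1[of x] by (simp add: Suc_le_eq)
      also have "\<dots> = W x * Suc i" by simp
      also have "\<dots> \<le> W x * g x" using ig by (intro mult_left_mono) auto
      also have "\<dots> = V\<^sup>2" using gW[of x] by (simp add: mult.commute)
      finally have "b < V\<^sup>2" .
      moreover have "good_class V w b" using good_class_cong[of V b x w] gb gx by (simp add: g_def)
      ultimately show ?thesis using gb bm Wb by (simp add: R_def)
    qed
    have "card B = g x" unfolding B_def using W1[of x] by (subst card_image) (auto simp: inj_on_def)
    then have "1 = (\<Sum>b\<in>B. 1 / real (g x))" using g1[of x] by simp
    also have "\<dots> = (\<Sum>b\<in>B. 1 / real (g b))" using BB by (intro sum.cong refl) simp
    also have "\<dots> \<le> (\<Sum>b\<in>{b\<in>R. x mod W b = b mod W b}. 1 / real (g b))"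
      using BB finR by (intro sum_mono2) auto
    finally show ?thesis .
  qed
  define N where "N b = {x\<in>A. x mod W b = b mod W b}" for b
  have "D \<le> (\<Sum>x\<in>G. 1)" using good by (simp add: G_def)
  also have "\<dots> \<le> (\<Sum>x\<in>G. \<Sum>b\<in>{b\<in>R. x mod W b = b mod W b}. 1 / real (g b))" by (intro sum_mono inner)
  also have "\<dots> = (\<Sum>b\<in>R. \<Sum>x\<in>{x\<in>G. x mod W b = b mod W b}. 1 / real (g b))"
    by (rule sum.swap_restrict[OF finR(2,1)])
  also have "\<dots> \<le> (\<Sum>b\<in>R. real (card (N b)) / real (g b))"
  proof (rule sum_mono)
    fix b
    have "card {x\<in>G. x mod W b = b mod W b} \<le> card (N b)" unfolding N_def using A by (intro card_mono) (auto simp: G_def)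
    then show "(\<Sum>x\<in>{x\<in>G. x mod W b = b mod W b}. 1 / real (g b)) \<le> real (card (N b)) / real (g b)"
      by (simp add: divide_right_mono)
  qed
  finally have tot: "D \<le> (\<Sum>b\<in>R. real (card (N b)) / real (g b))" .
  show ?thesis
  proof (cases "R = {}")
    case True
    then show ?thesis using tot D by simp
  next
    case False
    \<comment> \<open>At most V^2 values of b share a total of at least D, so one of them carries at
      least the average.\<close>
    have "\<exists>b\<in>R. D / real (V\<^sup>2) \<le> real (card (N b)) / real (g b)"
    proof (rule ccontr)
      assume "\<not> (\<exists>b\<in>R. D / real (V\<^sup>2) \<le> real (card (N b)) / real (g b))"
      then have "(\<Sum>b\<in>R. real (card (N b)) / real (g b)) < (\<Sum>b\<in>R. D / real (V\<^sup>2))"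
        using finR False by (intro sum_strict_mono) (auto simp: not_le)
      then have lt: "D < real (card R) * (D / real (V\<^sup>2))" using tot by simp
      have "card R \<le> card {0..<V\<^sup>2}" by (intro card_mono) (auto simp: R_def)
      then have "real (card R) \<le> real (V\<^sup>2)" by simp
      then have "real (card R) * (D / real (V\<^sup>2)) \<le> real (V\<^sup>2) * (D / real (V\<^sup>2))" using D by (intro mult_right_mono) auto
      also have "\<dots> = D" using V by simp
      finally show False using lt by simp
    qed
    then obtain b where b: "b \<in> R" "D / real (V\<^sup>2) \<le> real (card (N b)) / real (g b)" by blast
    \<comment> \<open>Reduction modulo its own modulus changes neither the class nor the gcd of b;
      \<open>sieved_good_class\<close> needs b below the modulus.\<close>
    define b0 where "b0 = b mod W b"
    have gb: "good_class V w b" using b by (simp add: R_def)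
    have b0m: "b0 mod W b = b mod W b" by (simp add: b0_def)
    have g0: "g b0 = g b" using gb b0m by (rule gcong)
    then have W0: "W b0 = W b" by (simp add: W_def class_modulus_def g_def)
    have "good_class V w b0" using good_class_cong[of V b0 b w] g0 gb by (simp add: g_def)
    moreover have "b0 < W b0" unfolding W0 unfolding b0_def using W1[of b] by (intro mod_less_divisor) simp
    moreover have "N b = {x\<in>A. x mod W b0 = b0}" unfolding N_def W0 unfolding b0_def by (rule refl)
    moreover have "D \<le> real (card (N b)) * real (W b)"
    proof -
      have "D / real (V\<^sup>2) * real (V\<^sup>2) \<le> real (card (N b)) / real (g b) * real (V\<^sup>2)" using b(2) by (intro mult_right_mono) auto
      then have "D \<le> real (card (N b)) / real (g b) * real (V\<^sup>2)" using V by simp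
      also have "real (V\<^sup>2) = real (g b) * real (W b)" by (simp only: gW[of b, symmetric] of_nat_mult)
      also have "real (card (N b)) / real (g b) * (real (g b) * real (W b)) = real (card (N b)) * real (W b)" using g1[of b] by simp
      finally show ?thesis .
    qed
    ultimately show ?thesis unfolding W_def by (intro exI[of _ b0]) (use W0 in \<open>simp add: W_def\<close>)
  qed
qed

text \<open>With d the gcd, V = d s and 2 b = d u, the inequality u \<le> 2 s^2 is b < V s
  multiplied by 2 and divided by d. The divisibility conditions restate that p d divides V but is
  not a common divisor of 2 b and V^2.\<close>

lemma sieved_good_class:
  assumes g: "good_class V w b" and w: "w \<ge> 2" and V: "V \<ge> 1" and smooth: "\<And>p. prime p \<Longrightarrow> p dvd V \<Longrightarrow> p \<le> w"
    and b: "b < class_modulus V b"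
  shows "sieved (int (2 * b div class_gcd V b)) ((int (V div class_gcd V b))\<^sup>2) w"
proof -
  define d where "d = class_gcd V b"
  define s where "s = V div d"
  define u where "u = 2 * b div d"
  have d1: "d \<ge> 1" unfolding d_def by (rule class_gcd_pos[OF V])
  have dV: "d dvd V" unfolding d_def by (rule good_class_dvd[OF g w])
  have Vs: "V = d * s" using dV by (simp add: s_def)
  have ub: "2 * b = d * u" by (simp add: u_def d_def class_gcd_def)
  have s1: "s \<ge> 1" using V Vs by (cases s) auto
  have W: "class_modulus V b = V * s" unfolding s_def d_def by (rule class_modulus_eq[OF g w V])
  have us: "u \<le> 2 * s\<^sup>2"
  proof -
    have "d * u \<le> 2 * (V * s)" using b ub unfolding W by linarith
    then have "d * u \<le> d * (2 * s\<^sup>2)" by (simp add: Vs power2_eq_square algebra_simps)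
    then show ?thesis using d1 by simp
  qed
  have div: "p dvd s \<and> \<not> p dvd u" if p: "prime p" "p \<le> w" for p
  proof
    have pd: "p * d dvd V" using g p by (auto simp: good_class_def d_def)
    then have "p * d dvd s * d" by (simp add: Vs mult.commute)
    then show "p dvd s" using d1 by simp
    show "\<not> p dvd u"
    proof
      assume "p dvd u"
      then have "p * d dvd 2 * b" unfolding ub by (simp add: mult.commute)
      moreover have "p * d dvd V\<^sup>2" using pd by (simp add: power2_eq_square)
      ultimately have "p * d dvd d" by (simp add: d_def class_gcd_def)
      then have "p * d \<le> d" using d1 by (intro dvd_imp_le) auto
      then show False using prime_gt_1_nat[OF p(1)] d1 by simp
    qed
  qed
  have "sieved (int u) ((int s)\<^sup>2) w"
    unfolding sieved_def
  proof (intro conjI allI impI)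
    have "int u \<le> int (2 * s\<^sup>2)" using us by (simp only: of_nat_le_iff)
    then show "int u \<le> 2 * (int s)\<^sup>2" by simp
    show "1 \<le> (int s)\<^sup>2" using s1 by simp
    show "int p dvd (int s)\<^sup>2" "\<not> int p dvd int u" if "prime p" "p \<le> w" for p
      using div[OF that] by (auto simp: power2_eq_square)
    show "p \<le> w" if "prime p" "int p dvd (int s)\<^sup>2" for p
    proof (rule smooth[OF that(1)])
      have "p dvd s\<^sup>2" using that(2) by (metis int_dvd_int_iff of_nat_power)
      then have "p dvd s" using that(1) prime_dvd_power by blast
      then show "p dvd V" by (simp add: Vs)
    qed
  qed (use w in auto)
  then show ?thesis by (simp add: u_def s_def d_def)
qed


lemma finite_solutions:
  assumes "A \<subseteq> initial_segment N" "B \<subseteq> {b. b > 0}"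
  shows "finite (solutions A B)"
proof (rule finite_subset)
  define I where "I = {1..\<lfloor>N\<rfloor>}"
  show "solutions A B \<subseteq> I \<times> I \<times> I \<times> I \<times> I"
  proof
    fix z assume "z \<in> solutions A B"
    then obtain x1 x2 y1 y2 y3 where z: "z = (x1, x2, y1, y2, y3)" "x1 \<in> A" "x2 \<in> A" "y1 \<in> B" "y2 \<in> B" "y3 \<in> B"
      "x1\<^sup>2 - x2\<^sup>2 = y1\<^sup>2 + y2\<^sup>2 + y3\<^sup>2" by (auto simp: solutions_def)
    have x: "x1 \<in> I" "x2 \<in> I" using z assms(1) by (auto simp: I_def initial_segment_def)
    have y: "y1 > 0" "y2 > 0" "y3 > 0" using z assms(2) by auto
    have "y \<in> I" if "y > 0" "y\<^sup>2 \<le> x1\<^sup>2" for y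
    proof -
      have "y \<le> x1" by (rule power2_le_imp_le) (use that x in \<open>auto simp: I_def\<close>)
      then show ?thesis using that x by (auto simp: I_def)
    qed
    moreover have "y1\<^sup>2 \<le> x1\<^sup>2" "y2\<^sup>2 \<le> x1\<^sup>2" "y3\<^sup>2 \<le> x1\<^sup>2"
      using z(7) zero_le_power2[of x2] zero_le_power2[of y1] zero_le_power2[of y2] zero_le_power2[of y3] by linarith+
    ultimately show "z \<in> I \<times> I \<times> I \<times> I \<times> I" using x y z(1) by simp
  qed
qed simp

text \<open>Here 2 b W = V^2 u and W^2 = V^2 s^2 V^2 / d^2 d^2 / V^2 = V^2 s^2, so (b + W t)^2 - b^2
  is V^2 times the quadratic with coefficients u and s^2.\<close>

lemma lift_solution:
  fixes b t1 t2 d u s W V :: nat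
  assumes "2 * b = d * u" "V = d * s" "W = V * s"
    and "quad (int u) ((int s)\<^sup>2) t1 - quad (int u) ((int s)\<^sup>2) t2 = (int y1)\<^sup>2 + (int y2)\<^sup>2 + (int y3)\<^sup>2"
  shows "(int (b + W * t1))\<^sup>2 - (int (b + W * t2))\<^sup>2 = (int (V * y1))\<^sup>2 + (int (V * y2))\<^sup>2 + (int (V * y3))\<^sup>2"
proof -
  define b' d' u' s' a1 a2 where "b' = int b" "d' = int d" "u' = int u" "s' = int s" "a1 = int t1" "a2 = int t2"
  note df = this
  have b: "2 * b' = d' * u'" using arg_cong[OF assms(1), of int] by (simp add: df)
  have W: "int W = d' * s' * s'" and V: "int V = d' * s'" using assms(2,3) by (simp_all add: df)
  have "(int (b + W * t1))\<^sup>2 - (int (b + W * t2))\<^sup>2 = (2 * b') * (d' * s' * s') * (a1 - a2) + (d' * s' * s')\<^sup>2 * (a1\<^sup>2 - a2\<^sup>2)"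
    by (simp add: W df power2_eq_square algebra_simps)
  also have "\<dots> = (d' * s')\<^sup>2 * ((u' * a1 + s'\<^sup>2 * a1\<^sup>2) - (u' * a2 + s'\<^sup>2 * a2\<^sup>2))"
    unfolding b by (simp add: power2_eq_square algebra_simps)
  also have "(u' * a1 + s'\<^sup>2 * a1\<^sup>2) - (u' * a2 + s'\<^sup>2 * a2\<^sup>2) = (int y1)\<^sup>2 + (int y2)\<^sup>2 + (int y3)\<^sup>2"
    using assms(4) by (simp add: quad_def df)
  finally show ?thesis by (simp add: V[symmetric] power_mult_distrib distrib_left)
qed

text \<open>The parameters are fixed in the order w, k, V. Then only finitely many good classes
  remain, so T0 and c can be made uniform although the class with many elements depends on
  A.\<close>

theorem theorem2p3:
  fixes \<delta> :: real and M :: nat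
  assumes "\<delta> > 0" and "M \<ge> 1"
  shows "\<exists>(N0::real) (c0::real). c0 > 0 \<and>
    (\<forall>N::real. N \<ge> N0 \<longrightarrow>
      (\<forall>(A::int set) (B::int set).
         A \<subseteq> initial_segment N \<longrightarrow> real (card A) \<ge> \<delta> * N \<longrightarrow>
         B \<subseteq> {b. b > 0} \<longrightarrow> homogeneous_set M B \<longrightarrow>
         real (card (solutions A B)) \<ge> c0 * N ^ 3))"
proof -
  have "\<delta> / 2 > 0" using assms(1) by simp
  from core_count[OF this assms(2)] obtain w0 :: nat where w0: "\<forall>w\<ge>w0. \<forall>u (s::nat). sieved u ((int s)\<^sup>2) w \<longrightarrow> (\<exists>(T0::nat) (c::real). c > 0 \<and>
    (\<forall>T\<ge>T0. \<forall>A B. A \<subseteq> {..T} \<longrightarrow> \<delta> / 2 * real T \<le> real (card A) \<longrightarrow> (\<forall>q\<ge>1. \<exists>k. 1 \<le> k \<and> k \<le> M \<and> q * k \<in> B) \<longrightarrow>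
      (\<exists>Z. finite Z \<and> Z \<subseteq> {(t1, t2, y1, y2, y3). t1 \<in> A \<and> t2 \<in> A \<and> y1 \<in> B \<and> y2 \<in> B \<and> y3 \<in> B \<and>
         quad u ((int s)\<^sup>2) t1 - quad u ((int s)\<^sup>2) t2 = (int y1)\<^sup>2 + (int y2)\<^sup>2 + (int y3)\<^sup>2} \<and>
         c * real T ^ 3 \<le> real (card Z))))" by blast
  define w where "w = max w0 2"
  have w: "w \<ge> w0" "w \<ge> 2" by (simp_all add: w_def)
  \<comment> \<open>Makes the proportion 4 / 2^k of possibly bad elements at most
    \<delta>/2.\<close>
  obtain k0 where k0: "(1/2) ^ k0 < \<delta> / 8" using real_arch_pow_inv[of "\<delta> / 8" "1/2"] assms(1) by auto
  define k where "k = k0 + 2"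
  have k: "k \<ge> 2" "4 / 2 ^ k \<le> \<delta> / 2" using k0 by (simp_all add: k_def power_add power_one_over field_simps)
  define V :: nat where "V = fact w ^ Suc k"
  have V: "V \<ge> 1" by (simp add: V_def)
  have smooth: "p \<le> w" if "prime p" "p dvd V" for p
  proof -
    have "p dvd fact w" using that unfolding V_def by (rule prime_dvd_power)
    then show ?thesis using that(1) by (simp add: prime_dvd_fact_iff)
  qed
  define W where "W = class_modulus V"
  define R where "R = {b. good_class V w b \<and> b < W b}"
  have gW: "class_gcd V b * W b = V\<^sup>2" for b unfolding W_def by (rule class_modulus_mult)
  have Wle: "W b \<le> V\<^sup>2" "W b \<ge> 1" for b
    using gW[of b] class_gcd_pos[OF V, of b] V by (metis dvd_imp_le dvd_triv_right zero_less_power Suc_le_eq One_nat_def, cases "W b") auto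
  have finR: "finite R"
    by (rule finite_subset[of _ "{..<V\<^sup>2}"]) (use Wle(1) in \<open>auto simp: R_def intro: less_le_trans\<close>)
  define ub where "ub b = 2 * b div class_gcd V b" for b
  define sb where "sb b = V div class_gcd V b" for b
  have sv: "sieved (int (ub b)) ((int (sb b))\<^sup>2) w" if "b \<in> R" for b
    unfolding ub_def sb_def using that by (intro sieved_good_class[OF _ w(2) V smooth]) (auto simp: R_def W_def)
  define good where "good b T0 c \<longleftrightarrow> c > 0 \<and>
    (\<forall>T\<ge>T0. \<forall>A B. A \<subseteq> {..T} \<longrightarrow> \<delta> / 2 * real T \<le> real (card A) \<longrightarrow> (\<forall>q\<ge>1. \<exists>k. 1 \<le> k \<and> k \<le> M \<and> q * k \<in> B) \<longrightarrow>
      (\<exists>Z. finite Z \<and> Z \<subseteq> {(t1, t2, y1, y2, y3). t1 \<in> A \<and> t2 \<in> A \<and> y1 \<in> B \<and> y2 \<in> B \<and> y3 \<in> B \<and>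
         quad (int (ub b)) ((int (sb b))\<^sup>2) t1 - quad (int (ub b)) ((int (sb b))\<^sup>2) t2 = (int y1)\<^sup>2 + (int y2)\<^sup>2 + (int y3)\<^sup>2} \<and>
         c * real T ^ 3 \<le> real (card Z)))" for b and T0 :: nat and c :: real
  have "\<forall>b\<in>R. \<exists>T0 c. good b T0 c"
    unfolding good_def using w0[rule_format, OF w(1) sv] by blast
  then obtain Tf cf where Tc: "\<And>b. b \<in> R \<Longrightarrow> good b (Tf b) (cf b)" by metis
  define cm where "cm = Min (insert 1 (cf ` R))"
  have cm: "cm > 0" unfolding cm_def using finR Tc by (subst Min_gr_iff) (auto simp: good_def)
  \<comment> \<open>The first part gives N / (2 V^2) \<ge> 1, so that rounding in the definition of
    T is harmless and T \<ge> N / (2 V^2); the cube of this produces the 8 V^6 in \<open>c0\<close>.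
    The second part gives T \<ge> \<open>Tf b\<close> for every class.\<close>
  define N0 where "N0 = 2 * (real V)\<^sup>2 + (real V)\<^sup>2 * real ((\<Sum>b\<in>R. Tf b) + 1)"
  define c0 where "c0 = cm / (8 * real V ^ 6)"
  have main: "real (card (solutions A B)) \<ge> c0 * N ^ 3"
    if N: "N \<ge> N0" and A: "A \<subseteq> initial_segment N" "real (card A) \<ge> \<delta> * N" and B: "B \<subseteq> {b. b > 0}" "homogeneous_set M B"
    for N :: real and A B :: "int set"
  proof -
    have Vr: "real V \<ge> 1" using V by simp
    have "0 \<le> (real V)\<^sup>2 * real ((\<Sum>b\<in>R. Tf b) + 1)" by (rule mult_nonneg_nonneg[OF zero_le_power2 of_nat_0_le_iff])
    then have N2: "N \<ge> 2 * (real V)\<^sup>2" using N unfolding N0_def by linarith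
    have V21: "(real V)\<^sup>2 \<ge> 1" using Vr by simp
    have Npos: "N > 0" using N2 V21 by linarith
    define n where "n = nat \<lfloor>N\<rfloor>"
    have n: "real n \<le> N" "int n = \<lfloor>N\<rfloor>" using Npos by (simp_all add: n_def)
    define A1 where "A1 = {x::nat. int x \<in> A}"
    have A1sub: "A1 \<subseteq> {1..n}"
    proof
      fix x assume "x \<in> A1"
      then have "1 \<le> int x" "int x \<le> int n" using A(1) n by (auto simp: A1_def initial_segment_def)
      then show "x \<in> {1..n}" by auto
    qed
    have finA1: "finite A1" using A1sub finite_subset by blast
    have "A = int ` A1"
    proof
      show "A \<subseteq> int ` A1"
      proof
        fix x assume x: "x \<in> A"
        then have "x \<ge> 1" using A(1) by (auto simp: initial_segment_def)
        then have "x = int (nat x)" "nat x \<in> A1" using x by (auto simp: A1_def)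
        then show "x \<in> int ` A1" by blast
      qed
    qed (auto simp: A1_def)
    then have cA: "card A = card A1" by (simp add: card_image)
    have good_count: "real (card {x\<in>A1. good_class V w x}) \<ge> \<delta> / 2 * N"
    proof -
      have "A1 \<subseteq> {x\<in>A1. good_class V w x} \<union> {x\<in>{1..n}. \<exists>p. prime p \<and> p \<le> w \<and> p ^ Suc k dvd 2 * x}"
      proof
        fix x assume x: "x \<in> A1"
        then have x1: "x \<ge> 1" "x \<in> {1..n}" using A1sub by auto
        have "good_class V w x" if "\<not> (\<exists>p. prime p \<and> p \<le> w \<and> p ^ Suc k dvd 2 * x)"
          unfolding V_def by (rule good_class_if_power_free) (use that x1 in auto)
        then show "x \<in> {x\<in>A1. good_class V w x} \<union> {x\<in>{1..n}. \<exists>p. prime p \<and> p \<le> w \<and> p ^ Suc k dvd 2 * x}"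
          using x x1 by blast
      qed
      then have "card A1 \<le> card ({x\<in>A1. good_class V w x} \<union> {x\<in>{1..n}. \<exists>p. prime p \<and> p \<le> w \<and> p ^ Suc k dvd 2 * x})"
        using finA1 by (intro card_mono) auto
      also have "\<dots> \<le> card {x\<in>A1. good_class V w x} + card {x\<in>{1..n}. \<exists>p. prime p \<and> p \<le> w \<and> p ^ Suc k dvd 2 * x}"
        by (rule card_Un_le)
      finally have "real (card A1) \<le> real (card {x\<in>A1. good_class V w x}) + real (card {x\<in>{1..n}. \<exists>p. prime p \<and> p \<le> w \<and> p ^ Suc k dvd 2 * x})"
        by (simp only: of_nat_add[symmetric] of_nat_le_iff)
      moreover have "real (card {x\<in>{1..n}. \<exists>p. prime p \<and> p \<le> w \<and> p ^ Suc k dvd 2 * x}) \<le> 4 / 2 ^ k * real n"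
        by (rule card_not_power_free[OF k(1)])
      moreover have "4 / 2 ^ k * real n \<le> \<delta> / 2 * N" using k(2) n(1) assms(1) by (intro mult_mono) auto
      ultimately show ?thesis using A(2) cA by simp
    qed
    have "\<delta> / 2 * N > 0" using assms(1) Npos by simp
    then obtain b where b: "good_class V w b" "b < class_modulus V b"
      "real (card {x\<in>A1. x mod class_modulus V b = b}) * real (class_modulus V b) \<ge> \<delta> / 2 * N"
      using dense_good_class[OF w(2) V smooth finA1 good_count] by blast
    have bR: "b \<in> R" using b by (simp add: R_def W_def)
    define d where "d = class_gcd V b"
    define W' where "W' = W b"
    define T where "T = nat \<lfloor>N / real W'\<rfloor>"
    have W1: "real W' \<ge> 1" "real W' \<le> (real V)\<^sup>2"
      using Wle[of b] by (simp_all add: W'_def)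
    have NW: "N / real W' \<ge> 0" using Npos by simp
    then have T: "real T \<le> N / real W'" "N / real W' < real T + 1" unfolding T_def by linarith+
    have NWV: "N / (real V)\<^sup>2 \<le> N / real W'" using W1 Npos V21 by (intro divide_left_mono mult_pos_pos) linarith+
    have TTf: "T \<ge> Tf b"
    proof -
      have "(real V)\<^sup>2 * real ((\<Sum>b\<in>R. Tf b) + 1) \<le> N" using N V21 by (simp add: N0_def)
      moreover have "(real V)\<^sup>2 > 0" using V21 by linarith
      ultimately have "real ((\<Sum>b\<in>R. Tf b) + 1) \<le> N / (real V)\<^sup>2" by (subst pos_le_divide_eq) (simp_all only: mult.commute)
      then have "real ((\<Sum>b\<in>R. Tf b) + 1) < real T + 1" using NWV T(2) by linarith
      then have "real ((\<Sum>b\<in>R. Tf b) + 1) < real (T + 1)" by (simp only: of_nat_add of_nat_1)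
      then have "(\<Sum>b\<in>R. Tf b) + 1 < T + 1" by (simp only: of_nat_less_iff)
      moreover have "Tf b \<le> (\<Sum>b\<in>R. Tf b)" using bR finR by (intro member_le_sum) auto
      ultimately show ?thesis by linarith
    qed
    define A' where "A' = {t. b + W' * t \<in> A1}"
    have A'sub: "A' \<subseteq> {..T}"
    proof
      fix t assume "t \<in> A'"
      then have "W' * t \<le> n" using A1sub by (auto simp: A'_def)
      then have "real (W' * t) \<le> N" using n(1) by (meson of_nat_mono order.trans)
      then have "real t \<le> N / real W'" using W1 by (simp add: pos_le_divide_eq mult.commute)
      then have "real t < real T + 1" using T by linarith
      then show "t \<in> {..T}" by simp
    qed
    have cA': "\<delta> / 2 * real T \<le> real (card A')"
    proof -
      have "card {x\<in>A1. x mod W' = b} \<le> card A'"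
      proof (rule card_inj_on_le[where f = "\<lambda>x. x div W'"])
        show "inj_on (\<lambda>x. x div W') {x\<in>A1. x mod W' = b}"
          by (rule inj_onI) (metis (mono_tags, lifting) mem_Collect_eq mod_mult_div_eq)
        show "(\<lambda>x. x div W') ` {x\<in>A1. x mod W' = b} \<subseteq> A'"
          by (auto simp: A'_def)
        show "finite A'" using A'sub finite_subset by blast
      qed
      then have "real (card {x\<in>A1. x mod W' = b}) * real W' \<le> real (card A') * real W'" by (intro mult_right_mono) auto
      then have "\<delta> / 2 * N \<le> real (card A') * real W'" using b(3) by (simp add: W'_def W_def)
      moreover have "real T * real W' \<le> N" using T(1) W1 by (simp add: pos_le_divide_eq)
      then have "\<delta> / 2 * (real T * real W') \<le> \<delta> / 2 * N" using assms(1) by (intro mult_left_mono) auto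
      ultimately have "(\<delta> / 2 * real T) * real W' \<le> real (card A') * real W'" by (simp add: mult.assoc)
      then show ?thesis using W1 by (simp add: mult_le_cancel_right)
    qed
    \<comment> \<open>The y with V y in B again form a homogeneous set with the same M: apply the
      hypothesis to the multipliers V q.\<close>
    define B' where "B' = {y. int (V * y) \<in> B}"
    have hom: "\<forall>q\<ge>1. \<exists>k. 1 \<le> k \<and> k \<le> M \<and> q * k \<in> B'"
    proof (intro allI impI)
      fix q :: nat assume q: "q \<ge> 1"
      have "V * q \<ge> 1" using V q by (simp add: Suc_le_eq)
      then have "int (V * q) \<ge> 1" by linarith
      then have "B \<inter> (\<lambda>m. int (V * q) * m) ` initial_segment (real M) \<noteq> {}" using B(2) unfolding homogeneous_set_def by blast
      then obtain m where m: "1 \<le> m" "m \<le> int M" "int (V * q) * m \<in> B" by (auto simp: initial_segment_def)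
      then have "q * nat m \<in> B'" by (simp add: B'_def mult.assoc)
      then show "\<exists>k. 1 \<le> k \<and> k \<le> M \<and> q * k \<in> B'" using m by (intro exI[of _ "nat m"]) auto
    qed
    obtain Z where Z: "finite Z" "Z \<subseteq> {(t1, t2, y1, y2, y3). t1 \<in> A' \<and> t2 \<in> A' \<and> y1 \<in> B' \<and> y2 \<in> B' \<and> y3 \<in> B' \<and>
         quad (int (ub b)) ((int (sb b))\<^sup>2) t1 - quad (int (ub b)) ((int (sb b))\<^sup>2) t2 = (int y1)\<^sup>2 + (int y2)\<^sup>2 + (int y3)\<^sup>2}"
      "cf b * real T ^ 3 \<le> real (card Z)"
      using Tc[OF bR, unfolded good_def] TTf A'sub cA' hom by blast
    define F where "F = (\<lambda>(t1, t2, y1, y2, y3). (int (b + W' * t1), int (b + W' * t2), int (V * y1), int (V * y2), int (V * y3)))"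
    have ev: "2 * b = d * ub b" "V = d * sb b" "W' = V * sb b"
      using good_class_dvd[OF b(1) w(2)] class_modulus_eq[OF b(1) w(2) V]
      by (simp_all add: d_def ub_def sb_def W'_def W_def class_gcd_def)
    have "inj_on F Z" using W1 V by (auto simp: F_def inj_on_def)
    then have "card Z = card (F ` Z)" by (simp add: card_image)
    also have "\<dots> \<le> card (solutions A B)"
    proof (rule card_mono[OF finite_solutions[OF A(1) B(1)]])
      show "F ` Z \<subseteq> solutions A B"
      proof
        fix z assume "z \<in> F ` Z"
        then obtain t1 t2 y1 y2 y3 where z: "(t1, t2, y1, y2, y3) \<in> Z" "z = F (t1, t2, y1, y2, y3)" by auto
        then have q: "t1 \<in> A'" "t2 \<in> A'" "y1 \<in> B'" "y2 \<in> B'" "y3 \<in> B'"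
          "quad (int (ub b)) ((int (sb b))\<^sup>2) t1 - quad (int (ub b)) ((int (sb b))\<^sup>2) t2 = (int y1)\<^sup>2 + (int y2)\<^sup>2 + (int y3)\<^sup>2"
          using Z(2) by auto
        have "(int (b + W' * t1))\<^sup>2 - (int (b + W' * t2))\<^sup>2 = (int (V * y1))\<^sup>2 + (int (V * y2))\<^sup>2 + (int (V * y3))\<^sup>2"
          by (rule lift_solution[OF ev q(6)])
        then show "z \<in> solutions A B"
          using q unfolding z(2) F_def solutions_def A'_def A1_def B'_def by (simp only: mem_Collect_eq prod.case simp_thms)
      qed
    qed
    finally have cZ: "real (card Z) \<le> real (card (solutions A B))" by simp
    have "N / (2 * (real V)\<^sup>2) \<le> real T"
    proof -
      have "0 < 2 * (real V)\<^sup>2" using V21 by linarith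
      then have "1 \<le> N / (2 * (real V)\<^sup>2)" using N2 by (simp only: le_divide_eq_1_pos)
      moreover have "N / (real V)\<^sup>2 = 2 * (N / (2 * (real V)\<^sup>2))" by simp
      ultimately show ?thesis using NWV T(2) by linarith
    qed
    then have "(N / (2 * (real V)\<^sup>2)) ^ 3 \<le> real T ^ 3" using Npos by (intro power_mono) auto
    then have "cm * (N / (2 * (real V)\<^sup>2)) ^ 3 \<le> cf b * real T ^ 3"
      using cm bR finR Npos by (intro mult_mono) (auto simp: cm_def)
    moreover have "cm * (N / (2 * (real V)\<^sup>2)) ^ 3 = c0 * N ^ 3"
      by (simp add: c0_def power_divide power_mult_distrib flip: power_mult)
    ultimately show ?thesis using Z(3) cZ by linarith
  qed
  have "c0 > 0" using cm V by (simp add: c0_def)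
  with main show ?thesis by blast
qed

end
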